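(* Let $k$ be a field and let $n \ge 8$ be an integer. Then $\mathfrak{B}_{n,k}$ is reducible.
   Context: All rings and algebras are commutative, associative, and with $1$. $\mathfrak{B}_n$ is the affine finite-type $\mathbb{Z}$-scheme representing the functor that sends a scheme $S$ to the set of isomorphism classes of pairs $(\mathcal{A},\phi)$ with $\mathcal{A}$ an $\mathcal{O}_S$-algebra and $\phi\colon \mathcal{A} \to \mathcal{O}_S^{\oplus n}$ an $\mathcal{O}_S$-module isomorphism (two pairs $(\mathcal{A},\phi)$, $(\mathcal{A}',\phi')$ are identified if there is an $\mathcal{O}_S$-algebra isomorphism $\alpha\colon\mathcal{A}\to\mathcal{A}'$ with $\phi'\circ\alpha=\phi$), and sends a morphism to pullback along it. $\mathfrak{B}_{n,k}=\mathfrak{B}_n\times_{\mathrm{Spec}\,\mathbb{Z}}\mathrm{Spec}\,k$. *)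

theory Defs
  imports "HOL-Analysis.Abstract_Topology" "HOL-Algebra.QuotRing" "HOL-Algebra.Module" "HOL-Library.Poly_Mapping"
begin

section \<open>Reducible spaces and prime spectra\<close>

text \<open>
  The empty space is neither reducible nor irreducible.
\<close>

definition reducible_space :: "'a topology \<Rightarrow> bool" where
  "reducible_space X \<longleftrightarrow>
     (\<exists>C D. closedin X C \<and> closedin X D \<and> C \<noteq> topspace X \<and> D \<noteq> topspace X \<and>
            C \<union> D = topspace X)"

definition irreducible_space :: "'a topology \<Rightarrow> bool" where
  "irreducible_space X \<longleftrightarrow> topspace X \<noteq> {} \<and>
     (\<forall>C D. closedin X C \<and> closedin X D \<and> C \<union> D = topspace X \<longrightarrow>
            C = topspace X \<or> D = topspace X)"

lemma reducible_space_iff: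
  "reducible_space X \<longleftrightarrow> topspace X \<noteq> {} \<and> \<not> irreducible_space X"
proof -
  have "topspace X \<noteq> {}" if "closedin X C" "C \<noteq> topspace X" for C
    using that closedin_subset by fastforce
  then show ?thesis
    unfolding reducible_space_def irreducible_space_def by blast
qed

definition vanishing_set :: "('a, 'm) ring_scheme \<Rightarrow> 'a set \<Rightarrow> 'a set set" where
  "vanishing_set R I = {P. primeideal P R \<and> I \<subseteq> P}"

definition Spec :: "('a, 'm) ring_scheme \<Rightarrow> 'a set topology" where
  "Spec R = topology (\<lambda>U. \<exists>I. I \<subseteq> carrier R \<and> U = {P. primeideal P R} - vanishing_set R I)"

lemma istopology_Spec:
  "istopology (\<lambda>U. \<exists>I. I \<subseteq> carrier R \<and> U = {P. primeideal P R} - vanishing_set R I)"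
  (is "istopology ?L")
  unfolding istopology_def
proof (intro conjI allI impI)
  fix S T assume "?L S" "?L T"
  then obtain I J where I: "I \<subseteq> carrier R" "S = {P. primeideal P R} - vanishing_set R I"
    and J: "J \<subseteq> carrier R" "T = {P. primeideal P R} - vanishing_set R J"
    by blast
  let ?K = "{a \<otimes>\<^bsub>R\<^esub> b | a b. a \<in> I \<and> b \<in> J}"
  have "?K \<subseteq> carrier R" if "primeideal P R" for P
  proof -
    interpret primeideal P R by fact
    show ?thesis using I(1) J(1) by blast
  qed
  then have "\<exists>K. K \<subseteq> carrier R \<and> {P. primeideal P R} - vanishing_set R K = {P. primeideal P R} - vanishing_set R ?K"
    by (cases "\<exists>P. primeideal P R") (auto simp: vanishing_set_def)
  moreover have "?K \<subseteq> P \<longleftrightarrow> I \<subseteq> P \<or> J \<subseteq> P" if "primeideal P R" for P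
  proof
    interpret primeideal P R by fact
    assume K: "?K \<subseteq> P"
    show "I \<subseteq> P \<or> J \<subseteq> P"
    proof (rule disjCI)
      assume "\<not> J \<subseteq> P"
      then obtain b where b: "b \<in> J" "b \<notin> P" by blast
      show "I \<subseteq> P"
      proof
        fix a assume "a \<in> I"
        then have "a \<otimes>\<^bsub>R\<^esub> b \<in> P" "a \<in> carrier R" "b \<in> carrier R"
          using K b I(1) J(1) by blast+
        then show "a \<in> P" using I_prime b(2) by blast
      qed
    qed
  next
    interpret primeideal P R by fact
    assume "I \<subseteq> P \<or> J \<subseteq> P"
    then show "?K \<subseteq> P"
      using I(1) J(1) I_l_closed I_r_closed by blast
  qed
  then have "S \<inter> T = {P. primeideal P R} - vanishing_set R ?K"
    unfolding I(2) J(2) by (simp add: vanishing_set_def set_eq_iff del: subset_iff) blast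
  ultimately show "?L (S \<inter> T)" by metis
next
  fix \<K> assume "\<forall>K\<in>\<K>. ?L K"
  from bchoice[OF this] obtain I where
    "\<forall>K\<in>\<K>. I K \<subseteq> carrier R \<and> K = {P. primeideal P R} - vanishing_set R (I K)"
    by (rule exE)
  then have I: "\<And>K. K \<in> \<K> \<Longrightarrow> I K \<subseteq> carrier R"
    "\<And>K. K \<in> \<K> \<Longrightarrow> K = {P. primeideal P R} - vanishing_set R (I K)"
    by - (drule (1) bspec, erule conjunct1, drule (1) bspec, erule conjunct2)
  have "(\<lambda>K. {P. primeideal P R} - vanishing_set R (I K)) ` \<K> = (\<lambda>K. K) ` \<K>"
    by (rule image_cong[OF refl]) (rule I(2)[symmetric])
  then have "\<Union>\<K> = (\<Union>K\<in>\<K>. {P. primeideal P R} - vanishing_set R (I K))"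
    by simp
  also have "\<dots> = {P. primeideal P R} - vanishing_set R (\<Union>K\<in>\<K>. I K)"
    by (auto simp: vanishing_set_def)
  finally show "?L (\<Union>\<K>)"
    using I(1) by (intro exI[of _ "\<Union>K\<in>\<K>. I K"] conjI) (rule UN_least, assumption+)
qed

lemma openin_Spec:
  "openin (Spec R) U \<longleftrightarrow>
     (\<exists>I. I \<subseteq> carrier R \<and> U = {P. primeideal P R} - vanishing_set R I)"
  unfolding Spec_def using istopology_Spec[of R] by simp

lemma topspace_Spec [simp]: "topspace (Spec R) = {P. primeideal P R}"
proof -
  have "openin (Spec R) ({P. primeideal P R} - vanishing_set R (carrier R))"
    unfolding openin_Spec by blast
  moreover have "\<not> carrier R \<subseteq> P" if "primeideal P R" for P
  proof -
    interpret primeideal P R by fact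
    show ?thesis using I_notcarr a_subset by blast
  qed
  then have "vanishing_set R (carrier R) = {}"
    by (auto simp: vanishing_set_def)
  ultimately have "{P. primeideal P R} \<subseteq> topspace (Spec R)"
    using openin_subset by fastforce
  moreover have "topspace (Spec R) \<subseteq> {P. primeideal P R}"
    using openin_Spec[of R "topspace (Spec R)"] by auto
  ultimately show ?thesis by blast
qed

lemma closedin_Spec:
  "closedin (Spec R) C \<longleftrightarrow> (\<exists>I. I \<subseteq> carrier R \<and> C = vanishing_set R I)"
proof -
  have *: "vanishing_set R I \<subseteq> {P. primeideal P R}" for I
    by (auto simp: vanishing_set_def)
  have "C \<subseteq> {P. primeideal P R} \<and> {P. primeideal P R} - C = {P. primeideal P R} - vanishing_set R I
          \<longleftrightarrow> C = vanishing_set R I" for I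
    using *[of I] by blast
  then show ?thesis
    unfolding closedin_def openin_Spec topspace_Spec by blast
qed

section \<open>The coordinate ring of the scheme of based algebras\<close>

text \<open>
  A commutative algebra structure on the free module with basis \<open>e\<^sub>0, \<dots>, e\<^sub>n\<^sub>-\<^sub>1\<close> is given
  by the coordinates \<open>c\<^sub>i\<^sub>j\<^sub>l\<close> of the products \<open>e\<^sub>i e\<^sub>j = (\<Sum>l. c\<^sub>i\<^sub>j\<^sub>l e\<^sub>l)\<close> and the coordinates
  \<open>u\<^sub>i\<close> of the identity element; \<open>StrC i j l\<close> and \<open>UnitC i\<close> are the corresponding
  variables. The \<open>u\<^sub>i\<close> are determined by the \<open>c\<^sub>i\<^sub>j\<^sub>l\<close>, since an identity element is unique.
  They are included so that the existence of the identity is expressed by polynomial equations.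
\<close>

datatype coord = StrC nat nat nat | UnitC nat

definition coords :: "nat \<Rightarrow> coord set" where
  "coords n = {StrC i j l | i j l. i < n \<and> j < n \<and> l < n} \<union> {UnitC i | i. i < n}"

type_synonym 'k coord_poly = "(coord \<Rightarrow>\<^sub>0 nat) \<Rightarrow>\<^sub>0 'k"

definition base_ring :: "'k::comm_ring_1 ring" where
  "base_ring = \<lparr>carrier = UNIV, mult = (*), one = 1, zero = 0, add = (+)\<rparr>"

definition coord_poly_ring :: "nat \<Rightarrow> 'k::comm_ring_1 coord_poly ring" where
  "coord_poly_ring n =
     \<lparr>carrier = {p. \<forall>m\<in>Poly_Mapping.keys p. Poly_Mapping.keys m \<subseteq> coords n},
      mult = (*), one = 1, zero = 0, add = (+)\<rparr>"

definition coord_const :: "'k::comm_ring_1 \<Rightarrow> 'k coord_poly" where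
  "coord_const a = Poly_Mapping.single 0 a"

definition coord_var :: "coord \<Rightarrow> 'k::comm_ring_1 coord_poly" where
  "coord_var x = Poly_Mapping.single (Poly_Mapping.single x 1) 1"

abbreviation str_var :: "nat \<Rightarrow> nat \<Rightarrow> nat \<Rightarrow> 'k::comm_ring_1 coord_poly" where
  "str_var i j l \<equiv> coord_var (StrC i j l)"

abbreviation unit_var :: "nat \<Rightarrow> 'k::comm_ring_1 coord_poly" where
  "unit_var i \<equiv> coord_var (UnitC i)"

definition comm_relations :: "nat \<Rightarrow> 'k::comm_ring_1 coord_poly set" where
  "comm_relations n = {str_var i j l - str_var j i l | i j l. i < n \<and> j < n \<and> l < n}"

definition assoc_relations :: "nat \<Rightarrow> 'k::comm_ring_1 coord_poly set" where
  "assoc_relations n =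
     {(\<Sum>p<n. str_var i j p * str_var p l m) - (\<Sum>p<n. str_var j l p * str_var i p m)
       | i j l m. i < n \<and> j < n \<and> l < n \<and> m < n}"

definition unit_relations :: "nat \<Rightarrow> 'k::comm_ring_1 coord_poly set" where
  "unit_relations n =
     {(\<Sum>i<n. unit_var i * str_var i j l) - (if j = l then 1 else 0) | j l. j < n \<and> l < n}"

definition based_algebra_ideal :: "nat \<Rightarrow> 'k::comm_ring_1 coord_poly set" where
  "based_algebra_ideal n =
     genideal (coord_poly_ring n) (comm_relations n \<union> assoc_relations n \<union> unit_relations n)"

definition based_algebra_ring :: "nat \<Rightarrow> 'k::comm_ring_1 coord_poly set ring" where
  "based_algebra_ring n = coord_poly_ring n Quot based_algebra_ideal n"

text \<open>
  The underlying topological space of the affine scheme of based algebras of rank \<open>n\<close>, base changed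
  to \<open>'k\<close>. The last section proves that \<open>based_algebra_ring n\<close> over \<open>'k\<close> represents the functor
  that sends a commutative \<open>'k\<close>-algebra \<open>S\<close> to the set of isomorphism classes of based
  algebras of rank \<open>n\<close> over \<open>S\<close>. For \<open>'k = int\<close> this is the coordinate ring of the scheme over the
  integers (a ring has a unique \<open>int\<close>-algebra structure), and for general \<open>'k\<close> it is the
  coordinate ring of its fibre product with \<open>Spec 'k\<close>.
\<close>

definition based_algebra_scheme ::
    "'k::comm_ring_1 itself \<Rightarrow> nat \<Rightarrow> 'k coord_poly set set topology" where
  "based_algebra_scheme _ n = Spec (based_algebra_ring n :: 'k coord_poly set ring)"

section \<open>Homomorphisms out of the coordinate ring\<close>

lemma cring_base_ring: "cring (base_ring :: 'k::comm_ring_1 ring)"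
proof (rule cringI)
  show "abelian_group (base_ring :: 'k ring)"
  proof (rule abelian_groupI)
    fix x :: 'k
    show "\<exists>y\<in>carrier base_ring. y \<oplus>\<^bsub>base_ring\<^esub> x = \<zero>\<^bsub>base_ring\<^esub>"
      by (rule bexI[of _ "- x"]) (auto simp: base_ring_def)
  qed (auto simp: base_ring_def algebra_simps)
  show "comm_monoid (base_ring :: 'k ring)"
    by (rule comm_monoidI) (auto simp: base_ring_def algebra_simps)
qed (auto simp: base_ring_def algebra_simps)

lemma coord_poly_ring_simps [simp]:
  "mult (coord_poly_ring n) = (*)" "one (coord_poly_ring n) = 1"
  "zero (coord_poly_ring n) = 0" "add (coord_poly_ring n) = (+)"
  by (simp_all add: coord_poly_ring_def)

lemma mem_coord_poly_ring:
  "p \<in> carrier (coord_poly_ring n) \<longleftrightarrow>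
     (\<forall>m\<in>Poly_Mapping.keys p. Poly_Mapping.keys m \<subseteq> coords n)"
  by (simp add: coord_poly_ring_def)

lemma coord_poly_ring_add:
  "p \<in> carrier (coord_poly_ring n) \<Longrightarrow> q \<in> carrier (coord_poly_ring n) \<Longrightarrow>
     p + q \<in> carrier (coord_poly_ring n)"
  unfolding mem_coord_poly_ring using Poly_Mapping.keys_add[of p q] by blast

lemma coord_poly_ring_mult:
  assumes "p \<in> carrier (coord_poly_ring n)" "q \<in> carrier (coord_poly_ring n)"
  shows "p * q \<in> carrier (coord_poly_ring n)"
  unfolding mem_coord_poly_ring
proof
  fix m assume "m \<in> Poly_Mapping.keys (p * q)"
  then obtain a b where "m = a + b" "a \<in> Poly_Mapping.keys p" "b \<in> Poly_Mapping.keys q"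
    using keys_mult[of p q] by blast
  then show "Poly_Mapping.keys m \<subseteq> coords n"
    using assms Poly_Mapping.keys_add[of a b] unfolding mem_coord_poly_ring by blast
qed

lemma coord_poly_ring_uminus:
  "p \<in> carrier (coord_poly_ring n) \<Longrightarrow> - p \<in> carrier (coord_poly_ring n)"
  by (auto simp: mem_coord_poly_ring in_keys_iff)

lemma coord_poly_ring_diff:
  "p \<in> carrier (coord_poly_ring n) \<Longrightarrow> q \<in> carrier (coord_poly_ring n) \<Longrightarrow>
     p - q \<in> carrier (coord_poly_ring n)"
  using coord_poly_ring_add[OF _ coord_poly_ring_uminus, of p n q] by simp

lemma coord_const_mem: "coord_const a \<in> carrier (coord_poly_ring n)"
  by (auto simp: mem_coord_poly_ring coord_const_def)

lemma coord_var_mem: "x \<in> coords n \<Longrightarrow> coord_var x \<in> carrier (coord_poly_ring n)"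
  by (auto simp: mem_coord_poly_ring coord_var_def)

lemma coord_poly_ring_0: "0 \<in> carrier (coord_poly_ring n)"
  and coord_poly_ring_1: "1 \<in> carrier (coord_poly_ring n)"
  by (auto simp: mem_coord_poly_ring)

lemma coord_poly_ring_sum:
  "(\<And>i. i \<in> I \<Longrightarrow> f i \<in> carrier (coord_poly_ring n)) \<Longrightarrow>
     sum f I \<in> carrier (coord_poly_ring n)"
  by (induction I rule: infinite_finite_induct)
    (auto intro: coord_poly_ring_0 coord_poly_ring_add)

lemma cring_coord_poly_ring: "cring (coord_poly_ring n :: 'k::comm_ring_1 coord_poly ring)"
proof (rule cringI)
  show "abelian_group (coord_poly_ring n :: 'k coord_poly ring)"
  proof (rule abelian_groupI)
    fix x :: "'k coord_poly" assume "x \<in> carrier (coord_poly_ring n)"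
    then show "\<exists>y\<in>carrier (coord_poly_ring n). y \<oplus>\<^bsub>coord_poly_ring n\<^esub> x = \<zero>\<^bsub>coord_poly_ring n\<^esub>"
      by (intro bexI[of _ "- x"]) (auto intro: coord_poly_ring_uminus)
  qed (auto simp: algebra_simps intro: coord_poly_ring_0 coord_poly_ring_add)
  show "comm_monoid (coord_poly_ring n :: 'k coord_poly ring)"
    by (rule comm_monoidI) (auto simp: algebra_simps intro: coord_poly_ring_1 coord_poly_ring_mult)
qed (auto simp: algebra_simps)

lemma relations_subset:
  "comm_relations n \<union> assoc_relations n \<union> unit_relations n \<subseteq> carrier (coord_poly_ring n)"
  unfolding comm_relations_def assoc_relations_def unit_relations_def
  by (auto intro!: coord_poly_ring_diff coord_poly_ring_sum coord_poly_ring_mult coord_var_mem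
      coord_poly_ring_0 coord_poly_ring_1 simp: coords_def)

lemma ideal_based_algebra_ideal: "ideal (based_algebra_ideal n) (coord_poly_ring n)"
  unfolding based_algebra_ideal_def
  by (intro ring.genideal_ideal cring.axioms(1)[OF cring_coord_poly_ring] relations_subset)

lemma cring_based_algebra_ring: "cring (based_algebra_ring n)"
  unfolding based_algebra_ring_def
  by (intro ideal.quotient_is_cring ideal_based_algebra_ideal cring_coord_poly_ring)

definition coord_class :: "nat \<Rightarrow> 'k::comm_ring_1 coord_poly \<Rightarrow> 'k coord_poly set" where
  "coord_class n p = based_algebra_ideal n +>\<^bsub>coord_poly_ring n\<^esub> p"

lemma coord_class_hom: "coord_class n \<in> ring_hom (coord_poly_ring n) (based_algebra_ring n)"
  unfolding coord_class_def[abs_def] based_algebra_ring_def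
  by (intro ideal.rcos_ring_hom ideal_based_algebra_ideal)

lemma carrier_based_algebra_ring:
  "carrier (based_algebra_ring n) = coord_class n ` carrier (coord_poly_ring n)"
  by (auto simp: based_algebra_ring_def FactRing_def A_RCOSETS_def' coord_class_def)

lemma update_eq_add_single:
  assumes "a \<notin> Poly_Mapping.keys f"
  shows "Poly_Mapping.update a b f = f + Poly_Mapping.single a b"
  using assms by (intro poly_mapping_eqI) (auto simp: lookup_update lookup_add lookup_single in_keys_iff when_def)

lemma keys_add_single:
  assumes "a \<notin> Poly_Mapping.keys f" "b \<noteq> 0"
  shows "Poly_Mapping.keys (f + Poly_Mapping.single a b) = insert a (Poly_Mapping.keys f)"
  using assms by (simp add: keys_update flip: update_eq_add_single)

lemma poly_mapping_add_induct [case_names zero add]: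
  assumes "P 0"
    and "\<And>f a b. a \<notin> Poly_Mapping.keys f \<Longrightarrow> b \<noteq> 0 \<Longrightarrow> P f \<Longrightarrow> P (f + Poly_Mapping.single a b)"
  shows "P f"
  by (induction f rule: update_induct) (auto simp: assms update_eq_add_single)

locale coord_eval =
  S?: cring S for S :: "('s, 'm) ring_scheme" (structure) +
  fixes h :: "'k::comm_ring_1 \<Rightarrow> 's" and s :: "coord \<Rightarrow> 's"
  assumes h: "h \<in> ring_hom base_ring S" and s: "\<And>x. s x \<in> carrier S"
begin

lemma h_simps [simp]:
  "h a \<in> carrier S" "h 1 = \<one>" "h (a + b) = h a \<oplus> h b" "h (a * b) = h a \<otimes> h b" "h 0 = \<zero>"
proof -
  interpret H: ring_hom_cring base_ring S h
    by (intro ring_hom_cring.intro ring_hom_cring_axioms.intro cring_base_ring S.is_cring h)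
  show "h a \<in> carrier S" "h 1 = \<one>" "h (a + b) = h a \<oplus> h b" "h (a * b) = h a \<otimes> h b" "h 0 = \<zero>"
    using H.hom_closed[of a] H.hom_one H.hom_add[of a b] H.hom_mult[of a b] H.hom_zero
    by (simp_all add: base_ring_def)
qed

definition ev_monom :: "(coord \<Rightarrow>\<^sub>0 nat) \<Rightarrow> 's" where
  "ev_monom m = (\<Otimes>x\<in>Poly_Mapping.keys m. s x [^] Poly_Mapping.lookup m x)"

definition ev :: "'k coord_poly \<Rightarrow> 's" where
  "ev p = (\<Oplus>m\<in>Poly_Mapping.keys p. h (Poly_Mapping.lookup p m) \<otimes> ev_monom m)"

lemma ev_monom_closed [simp]: "ev_monom m \<in> carrier S"
  unfolding ev_monom_def by (intro finprod_closed) (auto simp: s)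

lemma ev_monom_superset:
  assumes "finite X" "Poly_Mapping.keys m \<subseteq> X"
  shows "ev_monom m = (\<Otimes>x\<in>X. s x [^] Poly_Mapping.lookup m x)"
  unfolding ev_monom_def
  by (rule finprod_mono_neutral_cong_left) (use assms s in \<open>auto simp: in_keys_iff\<close>)

lemma ev_monom_add: "ev_monom (a + b) = ev_monom a \<otimes> ev_monom b"
proof -
  let ?X = "Poly_Mapping.keys a \<union> Poly_Mapping.keys b"
  have "ev_monom (a + b) = (\<Otimes>x\<in>?X. s x [^] Poly_Mapping.lookup (a + b) x)"
    by (rule ev_monom_superset) (auto simp: Poly_Mapping.keys_add)
  also have "\<dots> = (\<Otimes>x\<in>?X. s x [^] Poly_Mapping.lookup a x \<otimes> s x [^] Poly_Mapping.lookup b x)"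
    by (rule finprod_cong') (auto simp: lookup_add nat_pow_mult s)
  also have "\<dots> = (\<Otimes>x\<in>?X. s x [^] Poly_Mapping.lookup a x) \<otimes> (\<Otimes>x\<in>?X. s x [^] Poly_Mapping.lookup b x)"
    by (rule finprod_multf) (auto simp: s)
  also have "\<dots> = ev_monom a \<otimes> ev_monom b"
    by (subst (1 2) ev_monom_superset[of ?X]) auto
  finally show ?thesis .
qed

lemma ev_closed [simp]: "ev p \<in> carrier S"
  unfolding ev_def by (intro finsum_closed) auto

lemma ev_superset:
  assumes "finite X" "Poly_Mapping.keys p \<subseteq> X"
  shows "ev p = (\<Oplus>m\<in>X. h (Poly_Mapping.lookup p m) \<otimes> ev_monom m)"
  unfolding ev_def
  by (rule add.finprod_mono_neutral_cong_left) (use assms in \<open>auto simp: in_keys_iff\<close>)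

lemma ev_add: "ev (p + q) = ev p \<oplus> ev q"
proof -
  let ?X = "Poly_Mapping.keys p \<union> Poly_Mapping.keys q"
  have "ev (p + q) = (\<Oplus>m\<in>?X. h (Poly_Mapping.lookup (p + q) m) \<otimes> ev_monom m)"
    by (rule ev_superset) (auto simp: Poly_Mapping.keys_add)
  also have "\<dots> = (\<Oplus>m\<in>?X. h (Poly_Mapping.lookup p m) \<otimes> ev_monom m \<oplus> h (Poly_Mapping.lookup q m) \<otimes> ev_monom m)"
    by (rule add.finprod_cong') (auto simp: lookup_add l_distr)
  also have "\<dots> = (\<Oplus>m\<in>?X. h (Poly_Mapping.lookup p m) \<otimes> ev_monom m) \<oplus> (\<Oplus>m\<in>?X. h (Poly_Mapping.lookup q m) \<otimes> ev_monom m)"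
    by (rule finsum_addf) auto
  also have "\<dots> = ev p \<oplus> ev q"
    by (subst (1 2) ev_superset[of ?X]) auto
  finally show ?thesis .
qed

lemma ev_0 [simp]: "ev 0 = \<zero>"
  by (simp add: ev_def)

lemma ev_single: "ev (Poly_Mapping.single m v) = h v \<otimes> ev_monom m"
  by (subst ev_superset[of "{m}"]) auto

lemma ev_single_mult: "ev (Poly_Mapping.single m v * q) = ev (Poly_Mapping.single m v) \<otimes> ev q"
proof (induction q rule: poly_mapping_add_induct)
  case (add f a b)
  have "ev (Poly_Mapping.single m v * Poly_Mapping.single a b) =
          ev (Poly_Mapping.single m v) \<otimes> ev (Poly_Mapping.single a b)"
    by (simp add: mult_single ev_single ev_monom_add m_ac)
  then show ?case by (simp add: distrib_left ev_add add.IH r_distr)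
qed simp

lemma ev_mult: "ev (p * q) = ev p \<otimes> ev q"
  by (induction p rule: poly_mapping_add_induct)
    (simp_all add: distrib_right ev_add ev_single_mult l_distr)

lemma ev_monom_0 [simp]: "ev_monom 0 = \<one>"
  by (simp add: ev_monom_def)

lemma ev_const [simp]: "ev (coord_const a) = h a"
  by (simp add: coord_const_def ev_single)

lemma ev_1 [simp]: "ev 1 = \<one>"
  using ev_const[of 1] by (simp add: coord_const_def)

lemma ev_var [simp]: "ev (coord_var x) = s x"
  by (simp add: coord_var_def ev_single ev_monom_def s)

lemma ev_hom: "ev \<in> ring_hom (coord_poly_ring n) S"
  by (rule ring_hom_memI) (auto simp: ev_mult ev_add)

end

lemma coord_poly_ring_induct [consumes 1, case_names const var add mult]:
  fixes P :: "'k::comm_ring_1 coord_poly \<Rightarrow> bool"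
  assumes p: "p \<in> carrier (coord_poly_ring n)"
    and const: "\<And>a. P (coord_const a)" and var: "\<And>x. x \<in> coords n \<Longrightarrow> P (coord_var x)"
    and add: "\<And>p q. p \<in> carrier (coord_poly_ring n) \<Longrightarrow> q \<in> carrier (coord_poly_ring n) \<Longrightarrow>
                P p \<Longrightarrow> P q \<Longrightarrow> P (p + q)"
    and mult: "\<And>p q. p \<in> carrier (coord_poly_ring n) \<Longrightarrow> q \<in> carrier (coord_poly_ring n) \<Longrightarrow>
                P p \<Longrightarrow> P q \<Longrightarrow> P (p * q)"
  shows "P p"
proof -
  have pow: "Poly_Mapping.single (Poly_Mapping.single x k) (1::'k) \<in> carrier (coord_poly_ring n) \<and>
      P (Poly_Mapping.single (Poly_Mapping.single x k) 1)" if "x \<in> coords n" for x k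
  proof (induction k)
    case 0
    show ?case using const[of 1] coord_const_mem[of "1::'k" n] by (simp add: coord_const_def)
  next
    case (Suc k)
    have "Poly_Mapping.single (Poly_Mapping.single x (Suc k)) (1::'k) =
        coord_var x * Poly_Mapping.single (Poly_Mapping.single x k) (1::'k)"
      by (simp add: coord_var_def mult_single flip: single_add)
    then show ?case
      using Suc mult[OF coord_var_mem[OF that] conjunct1[OF Suc] var[OF that] conjunct2[OF Suc]]
        coord_poly_ring_mult[OF coord_var_mem[OF that] conjunct1[OF Suc]] by simp
  qed
  have monom: "Poly_Mapping.keys m \<subseteq> coords n \<Longrightarrow> Poly_Mapping.single m (1::'k) \<in> carrier (coord_poly_ring n) \<and>
      P (Poly_Mapping.single m 1)" for m
  proof (induction m rule: poly_mapping_add_induct)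
    case zero
    show ?case using const[of 1] coord_const_mem[of "1::'k" n] by (simp add: coord_const_def)
  next
    case (add f a b)
    have *: "a \<in> coords n" "Poly_Mapping.keys f \<subseteq> coords n"
      using add.prems keys_add_single[OF add.hyps] by simp_all
    have "Poly_Mapping.single (f + Poly_Mapping.single a b) 1 =
        Poly_Mapping.single f (1::'k) * Poly_Mapping.single (Poly_Mapping.single a b) 1"
      by (simp add: mult_single)
    then show ?case
      using add.IH[OF *(2)] pow[OF *(1), of b] mult coord_poly_ring_mult by metis
  qed
  show ?thesis using p
  proof (induction p rule: poly_mapping_add_induct)
    case zero
    show ?case using const[of 0] by (simp add: coord_const_def)
  next
    case (add f a b)
    have *: "Poly_Mapping.keys a \<subseteq> coords n" "f \<in> carrier (coord_poly_ring n)"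
      using add.prems keys_add_single[OF add.hyps] unfolding mem_coord_poly_ring by simp_all
    have "Poly_Mapping.single a b = coord_const b * Poly_Mapping.single a (1::'k)"
      by (simp add: coord_const_def mult_single)
    then show ?case
      using monom[OF *(1)] * add.IH[OF *(2)] assms(4) mult const coord_const_mem coord_poly_ring_mult
      by metis
  qed
qed

definition is_structure_constants ::
    "('s, 'm) ring_scheme \<Rightarrow> nat \<Rightarrow> (nat \<Rightarrow> nat \<Rightarrow> nat \<Rightarrow> 's) \<Rightarrow> (nat \<Rightarrow> 's) \<Rightarrow> bool" where
  "is_structure_constants S n c u \<longleftrightarrow>
     (\<forall>i<n. \<forall>j<n. \<forall>l<n. c i j l \<in> carrier S) \<and> (\<forall>i<n. u i \<in> carrier S) \<and>
     (\<forall>i<n. \<forall>j<n. \<forall>l<n. c i j l = c j i l) \<and>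
     (\<forall>i<n. \<forall>j<n. \<forall>l<n. \<forall>m<n.
        (\<Oplus>\<^bsub>S\<^esub>p\<in>{..<n}. c i j p \<otimes>\<^bsub>S\<^esub> c p l m) = (\<Oplus>\<^bsub>S\<^esub>p\<in>{..<n}. c j l p \<otimes>\<^bsub>S\<^esub> c i p m)) \<and>
     (\<forall>j<n. \<forall>l<n. (\<Oplus>\<^bsub>S\<^esub>i\<in>{..<n}. u i \<otimes>\<^bsub>S\<^esub> c i j l) = (if j = l then \<one>\<^bsub>S\<^esub> else \<zero>\<^bsub>S\<^esub>))"

lemma coords_mem [simp]:
  "StrC i j l \<in> coords n \<longleftrightarrow> i < n \<and> j < n \<and> l < n" "UnitC i \<in> coords n \<longleftrightarrow> i < n"
  by (auto simp: coords_def)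

lemma coord_poly_hom_sum:
  assumes "cring S" "f \<in> ring_hom (coord_poly_ring n) S"
    "\<And>i. i \<in> I \<Longrightarrow> g i \<in> carrier (coord_poly_ring n)"
  shows "f (sum g I) = (\<Oplus>\<^bsub>S\<^esub>i\<in>I. f (g i))"
proof -
  interpret S: cring S by fact
  interpret F: ring_hom_cring "coord_poly_ring n" S f
    by (intro ring_hom_cring.intro ring_hom_cring_axioms.intro cring_coord_poly_ring assms)
  show ?thesis using assms(3)
  proof (induction I rule: infinite_finite_induct)
    case (insert x J)
    then show ?case
      using F.hom_add[of "g x" "sum g J"] by (simp add: S.finsum_insert Pi_def coord_poly_ring_sum)
  qed (use F.hom_zero in simp_all)
qed

lemma coord_poly_hom_diff:
  assumes "cring S" "f \<in> ring_hom (coord_poly_ring n) S"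
    "p \<in> carrier (coord_poly_ring n)" "q \<in> carrier (coord_poly_ring n)"
  shows "f (p - q) = f p \<ominus>\<^bsub>S\<^esub> f q"
proof -
  interpret S: cring S by fact
  interpret F: ring_hom_cring "coord_poly_ring n" S f
    by (intro ring_hom_cring.intro ring_hom_cring_axioms.intro cring_coord_poly_ring assms)
  have "f (p - q) \<oplus>\<^bsub>S\<^esub> f q = f p"
    using F.hom_add[OF coord_poly_ring_diff[OF assms(3,4)] assms(4)] by simp
  moreover have "f (p - q) \<in> carrier S" "f p \<in> carrier S" "f q \<in> carrier S"
    using F.hom_closed assms(3,4) coord_poly_ring_diff by blast+
  ultimately show ?thesis
    by (metis S.add.inv_solve_right S.minus_eq)
qed

text \<open>A homomorphism kills the relations iff it maps the variables to structure constants.\<close>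

lemma relations_zero_iff:
  assumes "cring S" "f \<in> ring_hom (coord_poly_ring n) S"
  shows "(\<forall>p\<in>comm_relations n \<union> assoc_relations n \<union> unit_relations n. f p = \<zero>\<^bsub>S\<^esub>) \<longleftrightarrow>
     is_structure_constants S n (\<lambda>i j l. f (str_var i j l)) (\<lambda>i. f (unit_var i))"
proof -
  interpret S: cring S by fact
  interpret F: ring_hom_cring "coord_poly_ring n" S f
    by (intro ring_hom_cring.intro ring_hom_cring_axioms.intro cring_coord_poly_ring assms)
  have diff: "f (p - q) = \<zero>\<^bsub>S\<^esub> \<longleftrightarrow> f p = f q"
    if "p \<in> carrier (coord_poly_ring n)" "q \<in> carrier (coord_poly_ring n)" for p q
    unfolding coord_poly_hom_diff[OF assms that]
    using F.hom_closed[OF that(1)] F.hom_closed[OF that(2)]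
    by (metis S.add.inv_closed S.minus_equality S.minus_eq S.r_neg S.minus_minus)
  note mem = coord_poly_ring_mult coord_var_mem coord_poly_ring_sum coord_poly_ring_0 coord_poly_ring_1
  have str: "str_var i j l \<in> carrier (coord_poly_ring n)" if "i < n" "j < n" "l < n" for i j l
    using that by (simp add: coord_var_mem)
  have unit: "unit_var i \<in> carrier (coord_poly_ring n)" if "i < n" for i
    using that by (simp add: coord_var_mem)
  have mult: "f (p * q) = f p \<otimes>\<^bsub>S\<^esub> f q"
    if "p \<in> carrier (coord_poly_ring n)" "q \<in> carrier (coord_poly_ring n)" for p q
    using F.hom_mult[OF that] by simp
  have sum: "f (\<Sum>p<n. a p * b p) = (\<Oplus>\<^bsub>S\<^esub>p\<in>{..<n}. f (a p) \<otimes>\<^bsub>S\<^esub> f (b p))"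
    if "\<And>p. p < n \<Longrightarrow> a p \<in> carrier (coord_poly_ring n)" "\<And>p. p < n \<Longrightarrow> b p \<in> carrier (coord_poly_ring n)"
    for a b
  proof -
    have "f (\<Sum>p<n. a p * b p) = (\<Oplus>\<^bsub>S\<^esub>p\<in>{..<n}. f (a p * b p))"
      using that by (intro coord_poly_hom_sum[OF assms]) (simp add: coord_poly_ring_mult)
    also have "\<dots> = (\<Oplus>\<^bsub>S\<^esub>p\<in>{..<n}. f (a p) \<otimes>\<^bsub>S\<^esub> f (b p))"
      using that by (intro S.add.finprod_cong') (auto simp: mult)
    finally show ?thesis .
  qed
  have closed: "f p \<in> carrier S" if "p \<in> carrier (coord_poly_ring n)" for p
    using that by simp
  have C: "(\<forall>p\<in>comm_relations n. f p = \<zero>\<^bsub>S\<^esub>) \<longleftrightarrow>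
      (\<forall>i<n. \<forall>j<n. \<forall>l<n. f (str_var i j l) = f (str_var j i l))"
  proof -
    have "(\<forall>p\<in>comm_relations n. f p = \<zero>\<^bsub>S\<^esub>) \<longleftrightarrow>
        (\<forall>i<n. \<forall>j<n. \<forall>l<n. f (str_var i j l - str_var j i l) = \<zero>\<^bsub>S\<^esub>)"
      unfolding comm_relations_def by blast
    then show ?thesis by (simp add: diff str)
  qed
  have A: "(\<forall>p\<in>assoc_relations n. f p = \<zero>\<^bsub>S\<^esub>) \<longleftrightarrow>
      (\<forall>i<n. \<forall>j<n. \<forall>l<n. \<forall>m<n.
        (\<Oplus>\<^bsub>S\<^esub>p\<in>{..<n}. f (str_var i j p) \<otimes>\<^bsub>S\<^esub> f (str_var p l m)) =
        (\<Oplus>\<^bsub>S\<^esub>p\<in>{..<n}. f (str_var j l p) \<otimes>\<^bsub>S\<^esub> f (str_var i p m)))"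
  proof -
    have "(\<forall>p\<in>assoc_relations n. f p = \<zero>\<^bsub>S\<^esub>) \<longleftrightarrow> (\<forall>i<n. \<forall>j<n. \<forall>l<n. \<forall>m<n.
        f ((\<Sum>p<n. str_var i j p * str_var p l m) - (\<Sum>p<n. str_var j l p * str_var i p m)) = \<zero>\<^bsub>S\<^esub>)"
      unfolding assoc_relations_def by blast
    moreover have "f ((\<Sum>p<n. str_var i j p * str_var p l m) - (\<Sum>p<n. str_var j l p * str_var i p m)) = \<zero>\<^bsub>S\<^esub> \<longleftrightarrow>
        (\<Oplus>\<^bsub>S\<^esub>p\<in>{..<n}. f (str_var i j p) \<otimes>\<^bsub>S\<^esub> f (str_var p l m)) =
        (\<Oplus>\<^bsub>S\<^esub>p\<in>{..<n}. f (str_var j l p) \<otimes>\<^bsub>S\<^esub> f (str_var i p m))"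
      if "i < n" "j < n" "l < n" "m < n" for i j l m
    proof -
      have "f ((\<Sum>p<n. str_var i j p * str_var p l m) - (\<Sum>p<n. str_var j l p * str_var i p m)) = \<zero>\<^bsub>S\<^esub> \<longleftrightarrow>
        f (\<Sum>p<n. str_var i j p * str_var p l m) = f (\<Sum>p<n. str_var j l p * str_var i p m)"
        using that by (intro diff coord_poly_ring_sum coord_poly_ring_mult) (simp_all add: coord_var_mem)
      then show ?thesis
        using that by (simp add: sum str)
    qed
    ultimately show ?thesis by simp
  qed
  have U: "(\<forall>p\<in>unit_relations n. f p = \<zero>\<^bsub>S\<^esub>) \<longleftrightarrow>
      (\<forall>j<n. \<forall>l<n. (\<Oplus>\<^bsub>S\<^esub>i\<in>{..<n}. f (unit_var i) \<otimes>\<^bsub>S\<^esub> f (str_var i j l)) =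
        (if j = l then \<one>\<^bsub>S\<^esub> else \<zero>\<^bsub>S\<^esub>))"
  proof -
    have "(\<forall>p\<in>unit_relations n. f p = \<zero>\<^bsub>S\<^esub>) \<longleftrightarrow> (\<forall>j<n. \<forall>l<n.
        f ((\<Sum>i<n. unit_var i * str_var i j l) - (if j = l then 1 else 0)) = \<zero>\<^bsub>S\<^esub>)"
      unfolding unit_relations_def by blast
    moreover have "f ((\<Sum>i<n. unit_var i * str_var i j l) - (if j = l then 1 else 0)) = \<zero>\<^bsub>S\<^esub> \<longleftrightarrow>
        (\<Oplus>\<^bsub>S\<^esub>i\<in>{..<n}. f (unit_var i) \<otimes>\<^bsub>S\<^esub> f (str_var i j l)) =
          (if j = l then \<one>\<^bsub>S\<^esub> else \<zero>\<^bsub>S\<^esub>)"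
      if "j < n" "l < n" for j l
    proof -
      have "f ((\<Sum>i<n. unit_var i * str_var i j l) - (if j = l then 1 else 0)) = \<zero>\<^bsub>S\<^esub> \<longleftrightarrow>
        f (\<Sum>i<n. unit_var i * str_var i j l) = f (if j = l then 1 else 0)"
        using that by (intro diff coord_poly_ring_sum coord_poly_ring_mult)
          (simp_all add: coord_var_mem coord_poly_ring_0 coord_poly_ring_1)
      moreover have "f 1 = \<one>\<^bsub>S\<^esub>" "f 0 = \<zero>\<^bsub>S\<^esub>"
        using F.hom_one F.hom_zero by simp_all
      ultimately show ?thesis
        using that by (simp add: sum str unit)
    qed
    ultimately show ?thesis by simp
  qed
  have cs: "\<forall>i<n. \<forall>j<n. \<forall>l<n. f (str_var i j l) \<in> carrier S"
    using closed[OF str] by blast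
  have cu: "\<forall>i<n. f (unit_var i) \<in> carrier S"
    using closed[OF unit] by blast
  have "(\<forall>p\<in>comm_relations n \<union> assoc_relations n \<union> unit_relations n. f p = \<zero>\<^bsub>S\<^esub>) \<longleftrightarrow>
      (\<forall>p\<in>comm_relations n. f p = \<zero>\<^bsub>S\<^esub>) \<and> (\<forall>p\<in>assoc_relations n. f p = \<zero>\<^bsub>S\<^esub>) \<and>
      (\<forall>p\<in>unit_relations n. f p = \<zero>\<^bsub>S\<^esub>)"
    by blast
  also have "\<dots> \<longleftrightarrow> is_structure_constants S n (\<lambda>i j l. f (str_var i j l)) (\<lambda>i. f (unit_var i))"
    unfolding C A U is_structure_constants_def by (simp only: eqTrueI[OF cs] eqTrueI[OF cu] simp_thms)
  finally show ?thesis .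
qed

lemma coord_class_eq_zero:
  assumes "p \<in> based_algebra_ideal n"
  shows "coord_class n p = \<zero>\<^bsub>based_algebra_ring n\<^esub>"
proof -
  interpret ideal "based_algebra_ideal n" "coord_poly_ring n"
    by (rule ideal_based_algebra_ideal)
  show ?thesis
    using a_rcos_const[OF assms] by (simp add: coord_class_def based_algebra_ring_def FactRing_def)
qed

lemma structure_constants_of_hom:
  assumes "cring S" "g \<in> ring_hom (based_algebra_ring n) S"
  shows "is_structure_constants S n (\<lambda>i j l. g (coord_class n (str_var i j l)))
           (\<lambda>i. g (coord_class n (unit_var i)))"
proof -
  have hom: "g \<circ> coord_class n \<in> ring_hom (coord_poly_ring n) S"
    using ring_hom_trans[OF coord_class_hom assms(2)] .
  have "(g \<circ> coord_class n) p = \<zero>\<^bsub>S\<^esub>"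
    if "p \<in> comm_relations n \<union> assoc_relations n \<union> unit_relations n" for p
  proof -
    have "p \<in> based_algebra_ideal n"
      unfolding based_algebra_ideal_def
      using ring.genideal_self[OF cring.axioms(1)[OF cring_coord_poly_ring] relations_subset] that
      by blast
    then have "coord_class n p = \<zero>\<^bsub>based_algebra_ring n\<^esub>"
      by (rule coord_class_eq_zero)
    moreover have "g \<zero>\<^bsub>based_algebra_ring n\<^esub> = \<zero>\<^bsub>S\<^esub>"
      by (rule ring_hom_zero[OF assms(2) cring.axioms(1)[OF cring_based_algebra_ring]
            cring.axioms(1)[OF assms(1)]])
    ultimately show ?thesis by simp
  qed
  with relations_zero_iff[OF assms(1) hom] show ?thesis by simp
qed

lemma hom_of_structure_constants:
  fixes h :: "'k::comm_ring_1 \<Rightarrow> 's" and S :: "('s, 'm) ring_scheme"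
  assumes "cring S" "h \<in> ring_hom base_ring S" "is_structure_constants S n c u"
  shows "\<exists>g. g \<in> ring_hom (based_algebra_ring n) S \<and>
     (\<forall>a. g (coord_class n (coord_const a)) = h a) \<and>
     (\<forall>i<n. \<forall>j<n. \<forall>l<n. g (coord_class n (str_var i j l)) = c i j l) \<and>
     (\<forall>i<n. g (coord_class n (unit_var i)) = u i)"
proof -
  interpret S: cring S by fact
  define s where "s x = (if x \<in> coords n then (case x of StrC i j l \<Rightarrow> c i j l | UnitC i \<Rightarrow> u i) else \<zero>\<^bsub>S\<^esub>)"
    for x
  interpret coord_eval S h s
  proof
    show "h \<in> ring_hom base_ring S" by fact
    show "s x \<in> carrier S" for x
      using assms(3) by (cases x) (simp_all add: s_def is_structure_constants_def)
  qed
  have hom: "ev \<in> ring_hom (coord_poly_ring n) S"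
    by (rule ev_hom)
  have "is_structure_constants S n (\<lambda>i j l. s (StrC i j l)) (\<lambda>i. s (UnitC i))"
  proof -
    have sum: "(\<Oplus>\<^bsub>S\<^esub>p\<in>{..<n}. f p) = (\<Oplus>\<^bsub>S\<^esub>p\<in>{..<n}. f' p)"
      if "\<And>p. p < n \<Longrightarrow> f p = f' p" "\<And>p. p < n \<Longrightarrow> f' p \<in> carrier S" for f f'
      by (rule S.add.finprod_cong') (use that in auto)
    have c: "c i j l \<in> carrier S" if "i < n" "j < n" "l < n" for i j l
      using assms(3) that by (auto simp: is_structure_constants_def)
    have u: "u i \<in> carrier S" if "i < n" for i
      using assms(3) that by (auto simp: is_structure_constants_def)
    have [simp]: "s (StrC i j l) = c i j l" if "i < n" "j < n" "l < n" for i j l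
      using that by (simp add: s_def)
    have [simp]: "s (UnitC i) = u i" if "i < n" for i
      using that by (simp add: s_def)
    have 1: "(\<Oplus>\<^bsub>S\<^esub>p\<in>{..<n}. s (StrC i j p) \<otimes>\<^bsub>S\<^esub> s (StrC p l m)) = (\<Oplus>\<^bsub>S\<^esub>p\<in>{..<n}. c i j p \<otimes>\<^bsub>S\<^esub> c p l m)"
      "(\<Oplus>\<^bsub>S\<^esub>p\<in>{..<n}. s (StrC j l p) \<otimes>\<^bsub>S\<^esub> s (StrC i p m)) = (\<Oplus>\<^bsub>S\<^esub>p\<in>{..<n}. c j l p \<otimes>\<^bsub>S\<^esub> c i p m)"
      if "i < n" "j < n" "l < n" "m < n" for i j l m
      using that by (intro sum; simp add: c)+
    have 2: "(\<Oplus>\<^bsub>S\<^esub>i\<in>{..<n}. s (UnitC i) \<otimes>\<^bsub>S\<^esub> s (StrC i j l)) = (\<Oplus>\<^bsub>S\<^esub>i\<in>{..<n}. u i \<otimes>\<^bsub>S\<^esub> c i j l)"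
      if "j < n" "l < n" for j l
      using that by (intro sum) (simp_all add: c u)
    show ?thesis
      using assms(3) unfolding is_structure_constants_def by (simp add: 1 2)
  qed
  then have rel: "\<forall>p\<in>comm_relations n \<union> assoc_relations n \<union> unit_relations n. ev p = \<zero>\<^bsub>S\<^esub>"
    using relations_zero_iff[OF assms(1) hom] by simp
  interpret E: ring_hom_ring "coord_poly_ring n" S ev
    by (intro ring_hom_ringI2 cring.axioms(1)[OF cring_coord_poly_ring] S.ring_axioms hom)
  have "comm_relations n \<union> assoc_relations n \<union> unit_relations n \<subseteq> a_kernel (coord_poly_ring n) S ev"
    unfolding a_kernel_def' using relations_subset[of n] rel by blast
  then have "based_algebra_ideal n \<subseteq> a_kernel (coord_poly_ring n) S ev"
    unfolding based_algebra_ideal_def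
    by (rule ring.genideal_minimal[OF E.R.ring_axioms E.kernel_is_ideal])
  then have zero: "ev p = \<zero>\<^bsub>S\<^esub>" if "p \<in> based_algebra_ideal n" for p
    using that unfolding a_kernel_def' by blast
  define g where "g X = the_elem (ev ` X)" for X
  have g: "g (coord_class n p) = ev p" if "p \<in> carrier (coord_poly_ring n)" for p
  proof -
    interpret I: ideal "based_algebra_ideal n" "coord_poly_ring n"
      by (rule ideal_based_algebra_ideal)
    have "ev q = ev p" if "q \<in> coord_class n p" for q
    proof -
      obtain a where "a \<in> based_algebra_ideal n" "q = a + p"
        using \<open>q \<in> coord_class n p\<close>
        unfolding coord_class_def a_r_coset_def' coord_poly_ring_simps by blast
      then show ?thesis by (simp add: ev_add zero)
    qed
    moreover have "p \<in> coord_class n p"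
      unfolding coord_class_def using that by (rule I.a_rcos_self)
    ultimately have "ev ` coord_class n p = {ev p}" by blast
    then show ?thesis by (simp add: g_def)
  qed
  have "g \<in> ring_hom (based_algebra_ring n) S"
  proof (rule ring_hom_memI)
    fix x :: "'k coord_poly set"
    assume "x \<in> carrier (based_algebra_ring n)"
    then obtain p where "p \<in> carrier (coord_poly_ring n)" "x = coord_class n p"
      unfolding carrier_based_algebra_ring by (rule imageE) (rule that)
    then show "g x \<in> carrier S" by (simp add: g)
  next
    fix x y :: "'k coord_poly set"
    assume x: "x \<in> carrier (based_algebra_ring n)" and y: "y \<in> carrier (based_algebra_ring n)"
    obtain p where p: "p \<in> carrier (coord_poly_ring n)" "x = coord_class n p"
      using x unfolding carrier_based_algebra_ring by (rule imageE) (rule that)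
    obtain q where q: "q \<in> carrier (coord_poly_ring n)" "y = coord_class n q"
      using y unfolding carrier_based_algebra_ring by (rule imageE) (rule that)
    have "x \<otimes>\<^bsub>based_algebra_ring n\<^esub> y = coord_class n (p * q)"
      using ring_hom_mult[OF coord_class_hom p(1) q(1)] p q by simp
    then show "g (x \<otimes>\<^bsub>based_algebra_ring n\<^esub> y) = g x \<otimes>\<^bsub>S\<^esub> g y"
      using p q by (simp add: g coord_poly_ring_mult ev_mult)
    have "x \<oplus>\<^bsub>based_algebra_ring n\<^esub> y = coord_class n (p + q)"
      using ring_hom_add[OF coord_class_hom p(1) q(1)] p q by simp
    then show "g (x \<oplus>\<^bsub>based_algebra_ring n\<^esub> y) = g x \<oplus>\<^bsub>S\<^esub> g y"
      using p q by (simp add: g coord_poly_ring_add ev_add)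
  next
    have "coord_class n (1 :: 'k coord_poly) = \<one>\<^bsub>based_algebra_ring n\<^esub>"
      using ring_hom_one[OF coord_class_hom] by simp
    from this[symmetric] show "g \<one>\<^bsub>based_algebra_ring n\<^esub> = \<one>\<^bsub>S\<^esub>"
      by (simp add: g coord_poly_ring_1)
  qed
  moreover have "g (coord_class n (coord_const a)) = h a" for a
    by (simp add: g coord_const_mem)
  moreover have "g (coord_class n (str_var i j l)) = c i j l" if "i < n" "j < n" "l < n" for i j l
    using that by (simp add: g coord_var_mem s_def)
  moreover have "g (coord_class n (unit_var i)) = u i" if "i < n" for i
    using that by (simp add: g coord_var_mem s_def)
  ultimately show ?thesis by blast
qed

lemma hom_unique:
  fixes g g' :: "'k::comm_ring_1 coord_poly set \<Rightarrow> 's" and S :: "('s, 'm) ring_scheme"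
  assumes "g \<in> ring_hom (based_algebra_ring n) S" "g' \<in> ring_hom (based_algebra_ring n) S"
    and "\<And>a. g (coord_class n (coord_const a)) = g' (coord_class n (coord_const a))"
    and "\<And>y. y \<in> coords n \<Longrightarrow> g (coord_class n (coord_var y)) = g' (coord_class n (coord_var y))"
    and "x \<in> carrier (based_algebra_ring n :: 'k coord_poly set ring)"
  shows "g x = g' x"
proof -
  have hom: "f \<circ> coord_class n \<in> ring_hom (coord_poly_ring n) S"
    if "f \<in> ring_hom (based_algebra_ring n) S" for f :: "'k coord_poly set \<Rightarrow> 's"
    using ring_hom_trans[OF coord_class_hom that] .
  note * = ring_hom_add[OF hom] ring_hom_mult[OF hom]
  have "g (coord_class n p) = g' (coord_class n p)" if "p \<in> carrier (coord_poly_ring n)" for p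
    using that
  proof (induction p rule: coord_poly_ring_induct)
    case (add p q)
    then show ?case using *(1)[OF assms(1) add(1,2)] *(1)[OF assms(2) add(1,2)] by simp
  next
    case (mult p q)
    then show ?case using *(2)[OF assms(1) mult(1,2)] *(2)[OF assms(2) mult(1,2)] by simp
  qed (fact assms(3), rule assms(4))
  moreover obtain p where "p \<in> carrier (coord_poly_ring n)" "x = coord_class n p"
    using assms(5) unfolding carrier_based_algebra_ring by (rule imageE) (rule that)
  ultimately show ?thesis by simp
qed

section \<open>The functor of based algebras\<close>

text \<open>
  A pair of an algebra \<open>A\<close> over \<open>S\<close> and a module isomorphism \<open>\<phi>\<close> from \<open>A\<close> to \<open>S\<^sup>n\<close>, where the
  elements of \<open>S\<^sup>n\<close> are the extensional functions on \<open>{..<n}\<close>.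
\<close>

definition based_algebra ::
    "('s, 'm) ring_scheme \<Rightarrow> nat \<Rightarrow> ('s, 'a, 'e) module_scheme \<Rightarrow> ('a \<Rightarrow> nat \<Rightarrow> 's) \<Rightarrow> bool" where
  "based_algebra S n A \<phi> \<longleftrightarrow>
     algebra S A \<and>
     bij_betw \<phi> (carrier A) ({..<n} \<rightarrow>\<^sub>E carrier S) \<and>
     (\<forall>x\<in>carrier A. \<forall>y\<in>carrier A. \<forall>i<n. \<phi> (x \<oplus>\<^bsub>A\<^esub> y) i = \<phi> x i \<oplus>\<^bsub>S\<^esub> \<phi> y i) \<and>
     (\<forall>a\<in>carrier S. \<forall>x\<in>carrier A. \<forall>i<n. \<phi> (a \<odot>\<^bsub>A\<^esub> x) i = a \<otimes>\<^bsub>S\<^esub> \<phi> x i)"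

definition basis_vector ::
    "('s, 'm) ring_scheme \<Rightarrow> nat \<Rightarrow> ('s, 'a, 'e) module_scheme \<Rightarrow> ('a \<Rightarrow> nat \<Rightarrow> 's) \<Rightarrow> nat \<Rightarrow> 'a" where
  "basis_vector S n A \<phi> i =
     inv_into (carrier A) \<phi> (\<lambda>j\<in>{..<n}. if j = i then \<one>\<^bsub>S\<^esub> else \<zero>\<^bsub>S\<^esub>)"

definition classifies ::
    "('s, 'm) ring_scheme \<Rightarrow> nat \<Rightarrow> ('s, 'a, 'e) module_scheme \<Rightarrow> ('a \<Rightarrow> nat \<Rightarrow> 's) \<Rightarrow>
     ('k::comm_ring_1 coord_poly set \<Rightarrow> 's) \<Rightarrow> bool" where
  "classifies S n A \<phi> g \<longleftrightarrow>
     (\<forall>i<n. \<forall>j<n. \<forall>l<n. g (coord_class n (str_var i j l)) =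
        \<phi> (basis_vector S n A \<phi> i \<otimes>\<^bsub>A\<^esub> basis_vector S n A \<phi> j) l) \<and>
     (\<forall>i<n. g (coord_class n (unit_var i)) = \<phi> \<one>\<^bsub>A\<^esub> i)"

lemma (in abelian_monoid) finsum_swap:
  assumes "finite I" "finite J" "\<And>i j. i \<in> I \<Longrightarrow> j \<in> J \<Longrightarrow> f i j \<in> carrier G"
  shows "(\<Oplus>i\<in>I. \<Oplus>j\<in>J. f i j) = (\<Oplus>j\<in>J. \<Oplus>i\<in>I. f i j)"
  using assms(1,3)
proof (induction I)
  case empty
  show ?case by simp
next
  case (insert x F)
  have x: "(\<lambda>j. f x j) \<in> J \<rightarrow> carrier G" using insert.prems by blast
  have F: "(\<lambda>j. \<Oplus>i\<in>F. f i j) \<in> J \<rightarrow> carrier G"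
    using insert.prems by (intro Pi_I finsum_closed) blast
  have F': "(\<lambda>i. \<Oplus>j\<in>J. f i j) \<in> F \<rightarrow> carrier G"
    using insert.prems by (intro Pi_I finsum_closed) blast
  have "(\<Oplus>i\<in>insert x F. \<Oplus>j\<in>J. f i j) = (\<Oplus>j\<in>J. f x j) \<oplus> (\<Oplus>i\<in>F. \<Oplus>j\<in>J. f i j)"
    using insert.hyps F' finsum_closed[OF x] by (intro finsum_insert) auto
  also have "(\<Oplus>i\<in>F. \<Oplus>j\<in>J. f i j) = (\<Oplus>j\<in>J. \<Oplus>i\<in>F. f i j)"
    using insert.prems by (intro insert.IH) blast
  also have "(\<Oplus>j\<in>J. f x j) \<oplus> (\<Oplus>j\<in>J. \<Oplus>i\<in>F. f i j) = (\<Oplus>j\<in>J. f x j \<oplus> (\<Oplus>i\<in>F. f i j))"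
    by (rule finsum_addf[OF x F, symmetric])
  also have "\<dots> = (\<Oplus>j\<in>J. \<Oplus>i\<in>insert x F. f i j)"
  proof (rule add.finprod_cong'[OF refl])
    show "(\<lambda>j. \<Oplus>i\<in>insert x F. f i j) \<in> J \<rightarrow> carrier G"
      using insert.prems by (intro Pi_I finsum_closed) blast
    fix j assume "j \<in> J"
    then show "f x j \<oplus> (\<Oplus>i\<in>F. f i j) = (\<Oplus>i\<in>insert x F. f i j)"
      using insert.hyps insert.prems by (intro finsum_insert[symmetric]) auto
  qed
  finally show ?case .
qed

locale based_algebra_on =
  fixes S :: "('s, 'm) ring_scheme" (structure) and n :: nat
    and A :: "('s, 'a, 'e) module_scheme" and \<phi> :: "'a \<Rightarrow> nat \<Rightarrow> 's"
  assumes based: "based_algebra S n A \<phi>"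
begin

sublocale A: algebra S A
  using based unfolding based_algebra_def by blast

abbreviation e :: "nat \<Rightarrow> 'a" where "e \<equiv> basis_vector S n A \<phi>"

abbreviation c :: "nat \<Rightarrow> nat \<Rightarrow> nat \<Rightarrow> 's" where "c i j l \<equiv> \<phi> (e i \<otimes>\<^bsub>A\<^esub> e j) l"

lemma bij: "bij_betw \<phi> (carrier A) ({..<n} \<rightarrow>\<^sub>E carrier S)"
  using based unfolding based_algebra_def by blast

lemma add: "x \<in> carrier A \<Longrightarrow> y \<in> carrier A \<Longrightarrow> i < n \<Longrightarrow> \<phi> (x \<oplus>\<^bsub>A\<^esub> y) i = \<phi> x i \<oplus> \<phi> y i"
  using based unfolding based_algebra_def by blast

lemma smult: "a \<in> carrier S \<Longrightarrow> x \<in> carrier A \<Longrightarrow> i < n \<Longrightarrow> \<phi> (a \<odot>\<^bsub>A\<^esub> x) i = a \<otimes> \<phi> x i"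
  using based unfolding based_algebra_def by blast

lemma phi_PiE: "x \<in> carrier A \<Longrightarrow> \<phi> x \<in> {..<n} \<rightarrow>\<^sub>E carrier S"
  using bij by (rule bij_betw_apply)

lemma phi_closed [simp]: "x \<in> carrier A \<Longrightarrow> i < n \<Longrightarrow> \<phi> x i \<in> carrier S"
  using phi_PiE[of x] by (auto dest: PiE_mem)

lemma eqI:
  assumes "x \<in> carrier A" "y \<in> carrier A" "\<And>i. i < n \<Longrightarrow> \<phi> x i = \<phi> y i"
  shows "x = y"
proof -
  have "\<phi> x = \<phi> y"
    by (rule PiE_ext[OF phi_PiE[OF assms(1)] phi_PiE[OF assms(2)]]) (use assms(3) in simp)
  then show ?thesis
    by (rule inj_onD[OF bij_betw_imp_inj_on[OF bij] _ assms(1,2)])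
qed

lemma zero: "i < n \<Longrightarrow> \<phi> \<zero>\<^bsub>A\<^esub> i = \<zero>"
  using smult[of "\<zero>" "\<zero>\<^bsub>A\<^esub>" i] A.smult_l_null[of "\<zero>\<^bsub>A\<^esub>"] by simp

lemma finsum:
  assumes "finite I" "\<And>i. i \<in> I \<Longrightarrow> f i \<in> carrier A" "l < n"
  shows "\<phi> (\<Oplus>\<^bsub>A\<^esub>i\<in>I. f i) l = (\<Oplus>i\<in>I. \<phi> (f i) l)"
  using assms(1,2)
proof (induction I)
  case empty
  show ?case using assms(3) by (simp add: zero)
next
  case (insert x F)
  have "(\<Oplus>\<^bsub>A\<^esub>i\<in>insert x F. f i) = f x \<oplus>\<^bsub>A\<^esub> (\<Oplus>\<^bsub>A\<^esub>i\<in>F. f i)"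
    using insert by (intro A.M.finsum_insert) auto
  moreover have "(\<Oplus>i\<in>insert x F. \<phi> (f i) l) = \<phi> (f x) l \<oplus> (\<Oplus>i\<in>F. \<phi> (f i) l)"
    using insert assms(3) by (intro A.R.finsum_insert) auto
  moreover have "(\<Oplus>\<^bsub>A\<^esub>i\<in>F. f i) \<in> carrier A"
    using insert by (intro A.M.finsum_closed) auto
  ultimately show ?case
    using insert assms(3) by (simp add: add)
qed

lemma sum_cong:
  "(\<And>i. i < n \<Longrightarrow> f i = g i) \<Longrightarrow> (\<And>i. i < n \<Longrightarrow> g i \<in> carrier S) \<Longrightarrow>
     (\<Oplus>i\<in>{..<n}. f i) = (\<Oplus>i\<in>{..<n}. g i)"
  by (rule A.R.add.finprod_cong') auto

lemma sum_closed: "(\<And>i. i < n \<Longrightarrow> f i \<in> carrier S) \<Longrightarrow> (\<Oplus>i\<in>{..<n}. f i) \<in> carrier S"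
  by (intro A.R.finsum_closed) auto

lemma mult_closed: "a \<in> carrier S \<Longrightarrow> b \<in> carrier S \<Longrightarrow> a \<otimes> b \<in> carrier S"
  by simp

lemma delta_PiE: "(\<lambda>j\<in>{..<n}. if j = i then \<one> else \<zero>) \<in> {..<n} \<rightarrow>\<^sub>E carrier S"
  by auto

lemma delta_image:
  "(\<lambda>j\<in>{..<n}. if j = i then \<one> else \<zero>) \<in> \<phi> ` carrier A"
  unfolding bij_betw_imp_surj_on[OF bij] by (rule delta_PiE)

lemma e_closed [simp]: "e i \<in> carrier A"
  unfolding basis_vector_def by (rule inv_into_into[OF delta_image])

lemma phi_e: "j < n \<Longrightarrow> \<phi> (e i) j = (if j = i then \<one> else \<zero>)"
  unfolding basis_vector_def f_inv_into_f[OF delta_image] by simp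

lemma finsum_delta:
  assumes "i < n" "\<And>j. j < n \<Longrightarrow> f j \<in> carrier S"
  shows "(\<Oplus>j\<in>{..<n}. f j \<otimes> (if i = j then \<one> else \<zero>)) = f i"
proof -
  have "(\<Oplus>j\<in>{..<n}. f j \<otimes> (if i = j then \<one> else \<zero>)) = (\<Oplus>j\<in>{..<n}. if i = j then f j else \<zero>)"
    by (rule A.R.add.finprod_cong') (use assms in auto)
  also have "\<dots> = f i"
    by (rule A.R.add.finprod_singleton) (use assms in auto)
  finally show ?thesis .
qed

lemma expand:
  assumes "x \<in> carrier A"
  shows "x = (\<Oplus>\<^bsub>A\<^esub>i\<in>{..<n}. \<phi> x i \<odot>\<^bsub>A\<^esub> e i)"
proof (rule eqI)
  have closed: "\<phi> x i \<odot>\<^bsub>A\<^esub> e i \<in> carrier A" if "i < n" for i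
    using that assms by simp
  show "(\<Oplus>\<^bsub>A\<^esub>i\<in>{..<n}. \<phi> x i \<odot>\<^bsub>A\<^esub> e i) \<in> carrier A"
    using closed by (intro A.M.finsum_closed) auto
  fix l assume l: "l < n"
  have "\<phi> (\<Oplus>\<^bsub>A\<^esub>i\<in>{..<n}. \<phi> x i \<odot>\<^bsub>A\<^esub> e i) l = (\<Oplus>i\<in>{..<n}. \<phi> (\<phi> x i \<odot>\<^bsub>A\<^esub> e i) l)"
    using closed l by (intro finsum) auto
  also have "\<dots> = (\<Oplus>i\<in>{..<n}. \<phi> x i \<otimes> (if l = i then \<one> else \<zero>))"
    by (rule A.R.add.finprod_cong') (use assms l in \<open>auto simp: smult phi_e\<close>)
  also have "\<dots> = \<phi> x l"
    using l assms by (intro finsum_delta) auto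
  finally show "\<phi> x l = \<phi> (\<Oplus>\<^bsub>A\<^esub>i\<in>{..<n}. \<phi> x i \<odot>\<^bsub>A\<^esub> e i) l" ..
qed (rule assms)

lemma mult_left:
  assumes "x \<in> carrier A" "y \<in> carrier A" "l < n"
  shows "\<phi> (x \<otimes>\<^bsub>A\<^esub> y) l = (\<Oplus>i\<in>{..<n}. \<phi> x i \<otimes> \<phi> (e i \<otimes>\<^bsub>A\<^esub> y) l)"
proof -
  have "x \<otimes>\<^bsub>A\<^esub> y = (\<Oplus>\<^bsub>A\<^esub>i\<in>{..<n}. \<phi> x i \<odot>\<^bsub>A\<^esub> e i) \<otimes>\<^bsub>A\<^esub> y"
    using expand[OF assms(1)] by simp
  also have "\<dots> = (\<Oplus>\<^bsub>A\<^esub>i\<in>{..<n}. (\<phi> x i \<odot>\<^bsub>A\<^esub> e i) \<otimes>\<^bsub>A\<^esub> y)"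
    using assms by (intro A.finsum_ldistr) auto
  also have "\<phi> \<dots> l = (\<Oplus>i\<in>{..<n}. \<phi> ((\<phi> x i \<odot>\<^bsub>A\<^esub> e i) \<otimes>\<^bsub>A\<^esub> y) l)"
    using assms by (intro finsum) auto
  also have "\<dots> = (\<Oplus>i\<in>{..<n}. \<phi> x i \<otimes> \<phi> (e i \<otimes>\<^bsub>A\<^esub> y) l)"
    by (rule A.R.add.finprod_cong') (use assms in \<open>auto simp: A.smult_assoc2 smult\<close>)
  finally show ?thesis .
qed

lemma mult:
  assumes "x \<in> carrier A" "y \<in> carrier A" "l < n"
  shows "\<phi> (x \<otimes>\<^bsub>A\<^esub> y) l = (\<Oplus>i\<in>{..<n}. \<phi> x i \<otimes> (\<Oplus>j\<in>{..<n}. \<phi> y j \<otimes> c j i l))"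
proof -
  have "\<phi> (e i \<otimes>\<^bsub>A\<^esub> y) l = (\<Oplus>j\<in>{..<n}. \<phi> y j \<otimes> c j i l)" for i
    using mult_left[OF assms(2) e_closed assms(3), of i] A.m_comm[OF e_closed assms(2), of i] by simp
  then show ?thesis
    using mult_left[OF assms] by simp
qed

lemma is_structure_constants: "is_structure_constants S n c (\<lambda>i. \<phi> \<one>\<^bsub>A\<^esub> i)"
  unfolding is_structure_constants_def
proof (intro conjI allI impI)
  fix i j l m assume m: "i < n" "j < n" "l < n" "m < n"
  have "(\<Oplus>p\<in>{..<n}. c i j p \<otimes> c p l m) = \<phi> ((e i \<otimes>\<^bsub>A\<^esub> e j) \<otimes>\<^bsub>A\<^esub> e l) m"
    using m by (intro mult_left[symmetric]) auto
  also have "(e i \<otimes>\<^bsub>A\<^esub> e j) \<otimes>\<^bsub>A\<^esub> e l = (e j \<otimes>\<^bsub>A\<^esub> e l) \<otimes>\<^bsub>A\<^esub> e i"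
    by (simp add: A.m_ac)
  also have "\<phi> \<dots> m = (\<Oplus>p\<in>{..<n}. c j l p \<otimes> c p i m)"
    using m by (intro mult_left) auto
  also have "\<dots> = (\<Oplus>p\<in>{..<n}. c j l p \<otimes> c i p m)"
    by (rule A.R.add.finprod_cong') (use m in \<open>auto simp: A.m_comm\<close>)
  finally show "(\<Oplus>p\<in>{..<n}. c i j p \<otimes> c p l m) = (\<Oplus>p\<in>{..<n}. c j l p \<otimes> c i p m)" .
next
  fix j l assume l: "j < n" "l < n"
  have "(\<Oplus>i\<in>{..<n}. \<phi> \<one>\<^bsub>A\<^esub> i \<otimes> c i j l) = \<phi> (\<one>\<^bsub>A\<^esub> \<otimes>\<^bsub>A\<^esub> e j) l"
    using l by (intro mult_left[symmetric]) auto
  also have "\<dots> = (if j = l then \<one> else \<zero>)"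
    using l by (simp add: phi_e)
  finally show "(\<Oplus>i\<in>{..<n}. \<phi> \<one>\<^bsub>A\<^esub> i \<otimes> c i j l) = (if j = l then \<one> else \<zero>)" .
qed (simp_all add: A.m_comm)

end

definition model_algebra ::
    "('s, 'm) ring_scheme \<Rightarrow> nat \<Rightarrow> (nat \<Rightarrow> nat \<Rightarrow> nat \<Rightarrow> 's) \<Rightarrow> (nat \<Rightarrow> 's) \<Rightarrow>
     ('s, nat \<Rightarrow> 's) module" where
  "model_algebra S n c u =
     \<lparr>carrier = {..<n} \<rightarrow>\<^sub>E carrier S,
      mult = (\<lambda>x y. \<lambda>l\<in>{..<n}. \<Oplus>\<^bsub>S\<^esub>i\<in>{..<n}. \<Oplus>\<^bsub>S\<^esub>j\<in>{..<n}. x i \<otimes>\<^bsub>S\<^esub> y j \<otimes>\<^bsub>S\<^esub> c i j l),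
      one = (\<lambda>l\<in>{..<n}. u l),
      zero = (\<lambda>l\<in>{..<n}. \<zero>\<^bsub>S\<^esub>),
      add = (\<lambda>x y. \<lambda>l\<in>{..<n}. x l \<oplus>\<^bsub>S\<^esub> y l),
      smult = (\<lambda>a x. \<lambda>l\<in>{..<n}. a \<otimes>\<^bsub>S\<^esub> x l)\<rparr>"

locale model_algebra_on =
  S?: cring S for S :: "('s, 'm) ring_scheme" (structure) +
  fixes n :: nat and c :: "nat \<Rightarrow> nat \<Rightarrow> nat \<Rightarrow> 's" and u :: "nat \<Rightarrow> 's"
  assumes sc: "is_structure_constants S n c u"
begin

abbreviation M :: "('s, nat \<Rightarrow> 's) module" where "M \<equiv> model_algebra S n c u"
abbreviation I :: "nat set" where "I \<equiv> {..<n}"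

lemma c_closed [simp]: "i < n \<Longrightarrow> j < n \<Longrightarrow> l < n \<Longrightarrow> c i j l \<in> carrier S"
  by (rule sc[unfolded is_structure_constants_def,
        THEN conjunct1, rule_format])

lemma u_closed [simp]: "i < n \<Longrightarrow> u i \<in> carrier S"
  by (rule sc[unfolded is_structure_constants_def,
        THEN conjunct2, THEN conjunct1, rule_format])

lemma c_comm: "i < n \<Longrightarrow> j < n \<Longrightarrow> l < n \<Longrightarrow> c i j l = c j i l"
  by (rule sc[unfolded is_structure_constants_def,
        THEN conjunct2, THEN conjunct2, THEN conjunct1, rule_format])

lemma c_assoc: "i < n \<Longrightarrow> j < n \<Longrightarrow> l < n \<Longrightarrow> m < n \<Longrightarrow>
    (\<Oplus>p\<in>I. c i j p \<otimes> c p l m) = (\<Oplus>p\<in>I. c j l p \<otimes> c i p m)"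
  by (rule sc[unfolded is_structure_constants_def,
        THEN conjunct2, THEN conjunct2, THEN conjunct2, THEN conjunct1, rule_format])

lemma c_unit: "j < n \<Longrightarrow> l < n \<Longrightarrow> (\<Oplus>i\<in>I. u i \<otimes> c i j l) = (if j = l then \<one> else \<zero>)"
  by (rule sc[unfolded is_structure_constants_def,
        THEN conjunct2, THEN conjunct2, THEN conjunct2, THEN conjunct2, rule_format])

lemma sum_closed [simp]: "(\<And>i. i < n \<Longrightarrow> f i \<in> carrier S) \<Longrightarrow> (\<Oplus>i\<in>I. f i) \<in> carrier S"
  by (intro finsum_closed) auto

lemma sum_cong:
  "(\<And>i. i < n \<Longrightarrow> f i = g i) \<Longrightarrow> (\<And>i. i < n \<Longrightarrow> g i \<in> carrier S) \<Longrightarrow>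
     (\<Oplus>i\<in>I. f i) = (\<Oplus>i\<in>I. g i)"
  by (rule add.finprod_cong') auto

lemma sum_swap:
  "(\<And>i j. i < n \<Longrightarrow> j < n \<Longrightarrow> f i j \<in> carrier S) \<Longrightarrow>
     (\<Oplus>i\<in>I. \<Oplus>j\<in>I. f i j) = (\<Oplus>j\<in>I. \<Oplus>i\<in>I. f i j)"
  by (rule finsum_swap) auto

lemma sum_l: "(\<And>i. i < n \<Longrightarrow> f i \<in> carrier S) \<Longrightarrow> a \<in> carrier S \<Longrightarrow>
    (\<Oplus>i\<in>I. f i) \<otimes> a = (\<Oplus>i\<in>I. f i \<otimes> a)"
  by (rule finsum_ldistr) auto

lemma sum_r: "(\<And>i. i < n \<Longrightarrow> f i \<in> carrier S) \<Longrightarrow> a \<in> carrier S \<Longrightarrow>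
    a \<otimes> (\<Oplus>i\<in>I. f i) = (\<Oplus>i\<in>I. a \<otimes> f i)"
  by (rule finsum_rdistr) auto

lemma sum_add: "(\<And>i. i < n \<Longrightarrow> f i \<in> carrier S) \<Longrightarrow> (\<And>i. i < n \<Longrightarrow> g i \<in> carrier S) \<Longrightarrow>
    (\<Oplus>i\<in>I. f i \<oplus> g i) = (\<Oplus>i\<in>I. f i) \<oplus> (\<Oplus>i\<in>I. g i)"
  by (rule finsum_addf) auto

lemma sum_delta:
  assumes "i < n" "\<And>j. j < n \<Longrightarrow> f j \<in> carrier S"
  shows "(\<Oplus>j\<in>I. f j \<otimes> (if j = i then \<one> else \<zero>)) = f i"
proof -
  have "(\<Oplus>j\<in>I. f j \<otimes> (if j = i then \<one> else \<zero>)) = (\<Oplus>j\<in>I. if j = i then f j else \<zero>)"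
    by (rule sum_cong) (use assms in auto)
  also have "\<dots> = f i"
    by (rule add.finprod_singleton_swap) (use assms in auto)
  finally show ?thesis .
qed

lemma carrier_M: "carrier M = I \<rightarrow>\<^sub>E carrier S"
  by (simp add: model_algebra_def)

lemma M_closed [simp]: "x \<in> carrier M \<Longrightarrow> i < n \<Longrightarrow> x i \<in> carrier S"
  unfolding carrier_M by (erule PiE_mem) simp

lemma M_memI: "(\<And>i. i < n \<Longrightarrow> f i \<in> carrier S) \<Longrightarrow> (\<lambda>i\<in>I. f i) \<in> carrier M"
  unfolding carrier_M by (rule restrict_PiE_iff[THEN iffD2]) simp

lemma M_eqI: "x \<in> carrier M \<Longrightarrow> y \<in> carrier M \<Longrightarrow> (\<And>i. i < n \<Longrightarrow> x i = y i) \<Longrightarrow> x = y"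
  unfolding carrier_M by (erule PiE_ext) auto

lemma M_mult: "l < n \<Longrightarrow> (x \<otimes>\<^bsub>M\<^esub> y) l = (\<Oplus>i\<in>I. \<Oplus>j\<in>I. x i \<otimes> y j \<otimes> c i j l)"
  and M_one: "l < n \<Longrightarrow> \<one>\<^bsub>M\<^esub> l = u l"
  and M_zero: "l < n \<Longrightarrow> \<zero>\<^bsub>M\<^esub> l = \<zero>"
  and M_add: "l < n \<Longrightarrow> (x \<oplus>\<^bsub>M\<^esub> y) l = x l \<oplus> y l"
  and M_smult: "l < n \<Longrightarrow> (a \<odot>\<^bsub>M\<^esub> x) l = a \<otimes> x l"
  by (simp_all add: model_algebra_def)

lemma M_mult_closed: "x \<in> carrier M \<Longrightarrow> y \<in> carrier M \<Longrightarrow> x \<otimes>\<^bsub>M\<^esub> y \<in> carrier M"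
proof -
  assume "x \<in> carrier M" "y \<in> carrier M"
  then have "(\<lambda>l\<in>I. \<Oplus>i\<in>I. \<Oplus>j\<in>I. x i \<otimes> y j \<otimes> c i j l) \<in> carrier M"
    by (intro M_memI) simp
  then show ?thesis by (simp add: model_algebra_def)
qed

lemma M_one_closed: "\<one>\<^bsub>M\<^esub> \<in> carrier M"
  using M_memI[of u] by (simp add: model_algebra_def)

lemma M_zero_closed: "\<zero>\<^bsub>M\<^esub> \<in> carrier M"
  using M_memI[of "\<lambda>_. \<zero>"] by (simp add: model_algebra_def)

lemma M_add_closed: "x \<in> carrier M \<Longrightarrow> y \<in> carrier M \<Longrightarrow> x \<oplus>\<^bsub>M\<^esub> y \<in> carrier M"
proof -
  assume "x \<in> carrier M" "y \<in> carrier M"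
  then have "(\<lambda>l\<in>I. x l \<oplus> y l) \<in> carrier M"
    by (intro M_memI) simp
  then show ?thesis by (simp add: model_algebra_def)
qed

lemma M_smult_closed: "a \<in> carrier S \<Longrightarrow> x \<in> carrier M \<Longrightarrow> a \<odot>\<^bsub>M\<^esub> x \<in> carrier M"
proof -
  assume "a \<in> carrier S" "x \<in> carrier M"
  then have "(\<lambda>l\<in>I. a \<otimes> x l) \<in> carrier M"
    by (intro M_memI) simp
  then show ?thesis by (simp add: model_algebra_def)
qed

lemmas M_closed' = M_mult_closed M_one_closed M_zero_closed M_add_closed M_smult_closed

lemma M_comm:
  assumes "x \<in> carrier M" "y \<in> carrier M"
  shows "x \<otimes>\<^bsub>M\<^esub> y = y \<otimes>\<^bsub>M\<^esub> x"
proof (rule M_eqI)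
  fix l assume l: "l < n"
  have "(x \<otimes>\<^bsub>M\<^esub> y) l = (\<Oplus>j\<in>I. \<Oplus>i\<in>I. x i \<otimes> y j \<otimes> c i j l)"
    unfolding M_mult[OF l] by (rule sum_swap) (use assms l in simp)
  also have "\<dots> = (\<Oplus>j\<in>I. \<Oplus>i\<in>I. y j \<otimes> x i \<otimes> c j i l)"
    by (intro sum_cong sum_closed) (use assms l in \<open>simp_all add: m_comm c_comm\<close>)
  also have "\<dots> = (y \<otimes>\<^bsub>M\<^esub> x) l"
    unfolding M_mult[OF l] ..
  finally show "(x \<otimes>\<^bsub>M\<^esub> y) l = (y \<otimes>\<^bsub>M\<^esub> x) l" .
qed (intro M_closed' assms)+

lemma M_distr:
  assumes "x \<in> carrier M" "y \<in> carrier M" "z \<in> carrier M"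
  shows "(x \<oplus>\<^bsub>M\<^esub> y) \<otimes>\<^bsub>M\<^esub> z = x \<otimes>\<^bsub>M\<^esub> z \<oplus>\<^bsub>M\<^esub> y \<otimes>\<^bsub>M\<^esub> z"
proof (rule M_eqI)
  fix l assume l: "l < n"
  have "((x \<oplus>\<^bsub>M\<^esub> y) \<otimes>\<^bsub>M\<^esub> z) l =
      (\<Oplus>i\<in>I. (\<Oplus>j\<in>I. x i \<otimes> z j \<otimes> c i j l) \<oplus> (\<Oplus>j\<in>I. y i \<otimes> z j \<otimes> c i j l))"
    unfolding M_mult[OF l]
  proof (rule sum_cong)
    fix i assume i: "i < n"
    have "(\<Oplus>j\<in>I. (x \<oplus>\<^bsub>M\<^esub> y) i \<otimes> z j \<otimes> c i j l) = (\<Oplus>j\<in>I. x i \<otimes> z j \<otimes> c i j l \<oplus> y i \<otimes> z j \<otimes> c i j l)"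
      by (rule sum_cong) (use assms l i in \<open>simp_all add: M_add l_distr\<close>)
    also have "\<dots> = (\<Oplus>j\<in>I. x i \<otimes> z j \<otimes> c i j l) \<oplus> (\<Oplus>j\<in>I. y i \<otimes> z j \<otimes> c i j l)"
      by (rule sum_add) (use assms l i in simp_all)
    finally show "(\<Oplus>j\<in>I. (x \<oplus>\<^bsub>M\<^esub> y) i \<otimes> z j \<otimes> c i j l) = \<dots>" .
  qed (use assms l in simp)
  also have "\<dots> = (x \<otimes>\<^bsub>M\<^esub> z) l \<oplus> (y \<otimes>\<^bsub>M\<^esub> z) l"
    unfolding M_mult[OF l] by (rule sum_add) (use assms l in simp_all)
  finally show "((x \<oplus>\<^bsub>M\<^esub> y) \<otimes>\<^bsub>M\<^esub> z) l = (x \<otimes>\<^bsub>M\<^esub> z \<oplus>\<^bsub>M\<^esub> y \<otimes>\<^bsub>M\<^esub> z) l"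
    using l by (simp add: M_add)
qed (intro M_closed' assms)+

lemma M_smult_mult:
  assumes "a \<in> carrier S" "x \<in> carrier M" "y \<in> carrier M"
  shows "(a \<odot>\<^bsub>M\<^esub> x) \<otimes>\<^bsub>M\<^esub> y = a \<odot>\<^bsub>M\<^esub> (x \<otimes>\<^bsub>M\<^esub> y)"
proof (rule M_eqI)
  fix l assume l: "l < n"
  have "a \<otimes> (x \<otimes>\<^bsub>M\<^esub> y) l = (\<Oplus>i\<in>I. a \<otimes> (\<Oplus>j\<in>I. x i \<otimes> y j \<otimes> c i j l))"
    unfolding M_mult[OF l] by (rule sum_r) (use assms l in simp_all)
  also have "\<dots> = (\<Oplus>i\<in>I. \<Oplus>j\<in>I. a \<otimes> (x i \<otimes> y j \<otimes> c i j l))"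
    by (intro sum_cong sum_closed sum_r) (use assms l in simp_all)
  also have "\<dots> = (\<Oplus>i\<in>I. \<Oplus>j\<in>I. (a \<odot>\<^bsub>M\<^esub> x) i \<otimes> y j \<otimes> c i j l)"
    by (intro sum_cong sum_closed) (use assms l in \<open>simp_all add: M_smult m_assoc\<close>)
  also have "\<dots> = ((a \<odot>\<^bsub>M\<^esub> x) \<otimes>\<^bsub>M\<^esub> y) l"
    unfolding M_mult[OF l] ..
  finally show "((a \<odot>\<^bsub>M\<^esub> x) \<otimes>\<^bsub>M\<^esub> y) l = (a \<odot>\<^bsub>M\<^esub> (x \<otimes>\<^bsub>M\<^esub> y)) l"
    using l by (simp add: M_smult)
qed (intro M_closed' assms)+

lemma M_mult_left3:
  assumes "x \<in> carrier M" "y \<in> carrier M" "z \<in> carrier M" "m < n"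
  shows "((x \<otimes>\<^bsub>M\<^esub> y) \<otimes>\<^bsub>M\<^esub> z) m =
    (\<Oplus>i\<in>I. \<Oplus>j\<in>I. \<Oplus>l\<in>I. (x i \<otimes> y j \<otimes> z l) \<otimes> (\<Oplus>p\<in>I. c i j p \<otimes> c p l m))"
proof -
  note [simp] = assms
  have "((x \<otimes>\<^bsub>M\<^esub> y) \<otimes>\<^bsub>M\<^esub> z) m = (\<Oplus>p\<in>I. \<Oplus>l\<in>I. (x \<otimes>\<^bsub>M\<^esub> y) p \<otimes> z l \<otimes> c p l m)"
    by (simp add: M_mult)
  also have "\<dots> = (\<Oplus>p\<in>I. \<Oplus>l\<in>I. \<Oplus>i\<in>I. \<Oplus>j\<in>I. (x i \<otimes> y j \<otimes> z l) \<otimes> (c i j p \<otimes> c p l m))"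
  proof (intro sum_cong sum_closed)
    fix p l assume [simp]: "p < n" "l < n"
    have "(x \<otimes>\<^bsub>M\<^esub> y) p \<otimes> z l \<otimes> c p l m =
        (\<Oplus>i\<in>I. \<Oplus>j\<in>I. x i \<otimes> y j \<otimes> c i j p) \<otimes> (z l \<otimes> c p l m)"
      by (simp add: M_mult m_assoc)
    also have "\<dots> = (\<Oplus>i\<in>I. (\<Oplus>j\<in>I. x i \<otimes> y j \<otimes> c i j p) \<otimes> (z l \<otimes> c p l m))"
      by (rule sum_l) simp_all
    also have "\<dots> = (\<Oplus>i\<in>I. \<Oplus>j\<in>I. x i \<otimes> y j \<otimes> c i j p \<otimes> (z l \<otimes> c p l m))"
      by (intro sum_cong sum_closed sum_l) simp_all
    also have "\<dots> = (\<Oplus>i\<in>I. \<Oplus>j\<in>I. (x i \<otimes> y j \<otimes> z l) \<otimes> (c i j p \<otimes> c p l m))"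
      by (intro sum_cong sum_closed) (simp_all add: m_ac)
    finally show "(x \<otimes>\<^bsub>M\<^esub> y) p \<otimes> z l \<otimes> c p l m = \<dots>" .
  qed simp_all
  also have "\<dots> = (\<Oplus>p\<in>I. \<Oplus>i\<in>I. \<Oplus>l\<in>I. \<Oplus>j\<in>I. (x i \<otimes> y j \<otimes> z l) \<otimes> (c i j p \<otimes> c p l m))"
    by (intro sum_cong sum_closed sum_swap) simp_all
  also have "\<dots> = (\<Oplus>i\<in>I. \<Oplus>p\<in>I. \<Oplus>l\<in>I. \<Oplus>j\<in>I. (x i \<otimes> y j \<otimes> z l) \<otimes> (c i j p \<otimes> c p l m))"
    by (intro sum_swap sum_closed) simp_all
  also have "\<dots> = (\<Oplus>i\<in>I. \<Oplus>p\<in>I. \<Oplus>j\<in>I. \<Oplus>l\<in>I. (x i \<otimes> y j \<otimes> z l) \<otimes> (c i j p \<otimes> c p l m))"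
    by (intro sum_cong sum_closed sum_swap) simp_all
  also have "\<dots> = (\<Oplus>i\<in>I. \<Oplus>j\<in>I. \<Oplus>p\<in>I. \<Oplus>l\<in>I. (x i \<otimes> y j \<otimes> z l) \<otimes> (c i j p \<otimes> c p l m))"
    by (intro sum_cong sum_closed sum_swap) simp_all
  also have "\<dots> = (\<Oplus>i\<in>I. \<Oplus>j\<in>I. \<Oplus>l\<in>I. \<Oplus>p\<in>I. (x i \<otimes> y j \<otimes> z l) \<otimes> (c i j p \<otimes> c p l m))"
    by (intro sum_cong sum_closed sum_swap) simp_all
  also have "\<dots> = (\<Oplus>i\<in>I. \<Oplus>j\<in>I. \<Oplus>l\<in>I. (x i \<otimes> y j \<otimes> z l) \<otimes> (\<Oplus>p\<in>I. c i j p \<otimes> c p l m))"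
    by (intro sum_cong sum_closed sum_r[symmetric]) simp_all
  finally show ?thesis .
qed

lemma M_assoc:
  assumes "x \<in> carrier M" "y \<in> carrier M" "z \<in> carrier M"
  shows "(x \<otimes>\<^bsub>M\<^esub> y) \<otimes>\<^bsub>M\<^esub> z = x \<otimes>\<^bsub>M\<^esub> (y \<otimes>\<^bsub>M\<^esub> z)"
proof (rule M_eqI)
  fix m assume m: "m < n"
  note [simp] = assms m
  have "((x \<otimes>\<^bsub>M\<^esub> y) \<otimes>\<^bsub>M\<^esub> z) m =
    (\<Oplus>i\<in>I. \<Oplus>j\<in>I. \<Oplus>l\<in>I. (x i \<otimes> y j \<otimes> z l) \<otimes> (\<Oplus>p\<in>I. c i j p \<otimes> c p l m))"
    by (rule M_mult_left3) simp_all
  also have "\<dots> = (\<Oplus>i\<in>I. \<Oplus>j\<in>I. \<Oplus>l\<in>I. (y j \<otimes> z l \<otimes> x i) \<otimes> (\<Oplus>p\<in>I. c j l p \<otimes> c p i m))"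
  proof (intro sum_cong sum_closed)
    fix i j l assume [simp]: "i < n" "j < n" "l < n"
    have "(\<Oplus>p\<in>I. c i j p \<otimes> c p l m) = (\<Oplus>p\<in>I. c j l p \<otimes> c i p m)"
      by (rule c_assoc) simp_all
    also have "\<dots> = (\<Oplus>p\<in>I. c j l p \<otimes> c p i m)"
      by (rule sum_cong) (simp_all add: c_comm[of i])
    finally show "(x i \<otimes> y j \<otimes> z l) \<otimes> (\<Oplus>p\<in>I. c i j p \<otimes> c p l m) =
        (y j \<otimes> z l \<otimes> x i) \<otimes> (\<Oplus>p\<in>I. c j l p \<otimes> c p i m)"
      by (simp add: m_ac)
  qed simp_all
  also have "\<dots> = (\<Oplus>j\<in>I. \<Oplus>i\<in>I. \<Oplus>l\<in>I. (y j \<otimes> z l \<otimes> x i) \<otimes> (\<Oplus>p\<in>I. c j l p \<otimes> c p i m))"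
    by (intro sum_swap sum_closed) simp_all
  also have "\<dots> = (\<Oplus>j\<in>I. \<Oplus>l\<in>I. \<Oplus>i\<in>I. (y j \<otimes> z l \<otimes> x i) \<otimes> (\<Oplus>p\<in>I. c j l p \<otimes> c p i m))"
    by (intro sum_cong sum_swap sum_closed) simp_all
  also have "\<dots> = ((y \<otimes>\<^bsub>M\<^esub> z) \<otimes>\<^bsub>M\<^esub> x) m"
    by (rule M_mult_left3[symmetric]) simp_all
  also have "(y \<otimes>\<^bsub>M\<^esub> z) \<otimes>\<^bsub>M\<^esub> x = x \<otimes>\<^bsub>M\<^esub> (y \<otimes>\<^bsub>M\<^esub> z)"
    by (rule M_comm) (simp_all add: M_mult_closed)
  finally show "((x \<otimes>\<^bsub>M\<^esub> y) \<otimes>\<^bsub>M\<^esub> z) m = (x \<otimes>\<^bsub>M\<^esub> (y \<otimes>\<^bsub>M\<^esub> z)) m" .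
qed (intro M_closed' assms)+

lemma M_l_one:
  assumes "x \<in> carrier M"
  shows "\<one>\<^bsub>M\<^esub> \<otimes>\<^bsub>M\<^esub> x = x"
proof (rule M_eqI)
  fix l assume l: "l < n"
  note [simp] = assms l
  have "(\<one>\<^bsub>M\<^esub> \<otimes>\<^bsub>M\<^esub> x) l = (\<Oplus>j\<in>I. \<Oplus>i\<in>I. \<one>\<^bsub>M\<^esub> i \<otimes> x j \<otimes> c i j l)"
    unfolding M_mult[OF l] by (rule sum_swap) (simp add: M_one)
  also have "\<dots> = (\<Oplus>j\<in>I. \<Oplus>i\<in>I. x j \<otimes> (u i \<otimes> c i j l))"
    by (intro sum_cong sum_closed) (simp_all add: M_one m_ac)
  also have "\<dots> = (\<Oplus>j\<in>I. x j \<otimes> (\<Oplus>i\<in>I. u i \<otimes> c i j l))"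
    by (intro sum_cong sum_closed sum_r[symmetric]) simp_all
  also have "\<dots> = (\<Oplus>j\<in>I. x j \<otimes> (if j = l then \<one> else \<zero>))"
    by (rule sum_cong) (simp_all add: c_unit)
  also have "\<dots> = x l"
    by (rule sum_delta) simp_all
  finally show "(\<one>\<^bsub>M\<^esub> \<otimes>\<^bsub>M\<^esub> x) l = x l" .
qed (intro M_closed' assms)+

lemma algebra_M: "algebra S M"
proof (rule algebraI)
  show "cring M"
  proof (rule cringI)
    show "abelian_group M"
    proof (rule abelian_groupI)
      fix x y z assume "x \<in> carrier M" "y \<in> carrier M" "z \<in> carrier M"
      then show "x \<oplus>\<^bsub>M\<^esub> y \<oplus>\<^bsub>M\<^esub> z = x \<oplus>\<^bsub>M\<^esub> (y \<oplus>\<^bsub>M\<^esub> z)"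
        by (intro M_eqI M_add_closed) (simp_all add: M_add a_assoc)
    next
      fix x y assume "x \<in> carrier M" "y \<in> carrier M"
      then show "x \<oplus>\<^bsub>M\<^esub> y = y \<oplus>\<^bsub>M\<^esub> x"
        by (intro M_eqI M_add_closed) (simp_all add: M_add a_comm)
    next
      fix x assume x: "x \<in> carrier M"
      then show "\<zero>\<^bsub>M\<^esub> \<oplus>\<^bsub>M\<^esub> x = x"
        by (intro M_eqI M_add_closed M_zero_closed) (simp_all add: M_add M_zero)
      have "(\<lambda>i\<in>I. \<ominus> x i) \<oplus>\<^bsub>M\<^esub> x = \<zero>\<^bsub>M\<^esub>"
        using x by (intro M_eqI M_add_closed M_zero_closed M_memI) (simp_all add: M_add M_zero l_neg)
      moreover have "(\<lambda>i\<in>I. \<ominus> x i) \<in> carrier M"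
        using x by (intro M_memI) simp
      ultimately show "\<exists>y\<in>carrier M. y \<oplus>\<^bsub>M\<^esub> x = \<zero>\<^bsub>M\<^esub>" by blast
    qed (simp_all add: M_closed')
    show "comm_monoid M"
      by (rule comm_monoidI) (erule (1) M_mult_closed, rule M_one_closed, erule (2) M_assoc,
          erule M_l_one, erule (1) M_comm)
  qed (rule M_distr)
next
  fix a b x assume "a \<in> carrier S" "b \<in> carrier S" "x \<in> carrier M"
  then show "(a \<oplus> b) \<odot>\<^bsub>M\<^esub> x = (a \<odot>\<^bsub>M\<^esub> x) \<oplus>\<^bsub>M\<^esub> (b \<odot>\<^bsub>M\<^esub> x)"
    by (intro M_eqI) (simp_all add: M_closed' M_add M_smult l_distr)
next
  fix a x y assume "a \<in> carrier S" "x \<in> carrier M" "y \<in> carrier M"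
  then show "a \<odot>\<^bsub>M\<^esub> (x \<oplus>\<^bsub>M\<^esub> y) = (a \<odot>\<^bsub>M\<^esub> x) \<oplus>\<^bsub>M\<^esub> (a \<odot>\<^bsub>M\<^esub> y)"
    by (intro M_eqI) (simp_all add: M_closed' M_add M_smult r_distr)
next
  fix a b x assume "a \<in> carrier S" "b \<in> carrier S" "x \<in> carrier M"
  then show "(a \<otimes> b) \<odot>\<^bsub>M\<^esub> x = a \<odot>\<^bsub>M\<^esub> (b \<odot>\<^bsub>M\<^esub> x)"
    by (intro M_eqI) (simp_all add: M_closed' M_smult m_assoc)
next
  fix x assume "x \<in> carrier M"
  then show "\<one> \<odot>\<^bsub>M\<^esub> x = x"
    by (intro M_eqI) (simp_all add: M_smult_closed M_smult)
qed (simp_all add: S.is_cring M_smult_closed M_smult_mult)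

lemma based_M: "based_algebra S n M (\<lambda>x. x)"
  unfolding based_algebra_def
  using algebra_M by (simp add: M_add M_smult carrier_M bij_betw_def)

lemma M_mult_basis:
  assumes "i < n" "j < n" "l < n"
  shows "(basis_vector S n M (\<lambda>x. x) i \<otimes>\<^bsub>M\<^esub> basis_vector S n M (\<lambda>x. x) j) l = c i j l"
proof -
  interpret B: based_algebra_on S n M "\<lambda>x. x"
    by (rule based_algebra_on.intro[OF based_M])
  note [simp] = assms
  have "(B.e i \<otimes>\<^bsub>M\<^esub> B.e j) l = (\<Oplus>p\<in>I. \<Oplus>q\<in>I. B.e i p \<otimes> B.e j q \<otimes> c p q l)"
    by (simp add: M_mult)
  also have "\<dots> = (\<Oplus>p\<in>I. \<Oplus>q\<in>I. (B.e i p \<otimes> c p q l) \<otimes> (if q = j then \<one> else \<zero>))"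
    by (intro sum_cong sum_closed) (simp_all add: B.phi_e)
  also have "\<dots> = (\<Oplus>p\<in>I. B.e i p \<otimes> c p j l)"
    by (intro sum_cong sum_delta) simp_all
  also have "\<dots> = (\<Oplus>p\<in>I. c p j l \<otimes> (if p = i then \<one> else \<zero>))"
    by (intro sum_cong) (simp_all add: B.phi_e)
  also have "\<dots> = c i j l"
    by (rule sum_delta) simp_all
  finally show ?thesis .
qed

end

section \<open>Representability\<close>

text \<open>
  Let \<open>S\<close> be a commutative ring with a \<open>'k\<close>-algebra structure \<open>h\<close>. By the following theorems,
  \<open>classifies\<close> induces a bijection between the \<open>'k\<close>-algebra homomorphisms from the
  coordinate ring to \<open>S\<close> and the isomorphism classes of based algebras of rank \<open>n\<close> over \<open>S\<close>,
  and this bijection is natural in \<open>S\<close>. In \<open>classifies_base_change\<close>, the hypotheses on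
  \<open>B\<close>, \<open>\<psi>\<close> and \<open>\<alpha>\<close> say that \<open>(B, \<psi>)\<close> is the base change of \<open>(A, \<phi>)\<close> along \<open>f\<close>.
\<close>

theorem based_algebra_ring_classifies:
  fixes h :: "'k::comm_ring_1 \<Rightarrow> 's" and S :: "('s, 'm) ring_scheme"
    and A :: "('s, 'a, 'e) module_scheme"
  assumes S: "cring S" and h: "h \<in> ring_hom base_ring S" and A: "based_algebra S n A \<phi>"
  shows "\<exists>!g. g \<in> ring_hom (based_algebra_ring n) S \<and>
     g \<in> extensional (carrier (based_algebra_ring n)) \<and>
     (\<forall>a. g (coord_class n (coord_const a)) = h a) \<and> classifies S n A \<phi> g"
proof -
  let ?O = "based_algebra_ring n :: 'k coord_poly set ring"
  interpret A: based_algebra_on S n A \<phi>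
    by (rule based_algebra_on.intro[OF A])
  have mem: "coord_class n p \<in> carrier ?O" if "p \<in> carrier (coord_poly_ring n)" for p
    unfolding carrier_based_algebra_ring using that by (rule imageI)
  have cl: "classifies S n A \<phi> g \<longleftrightarrow>
      (\<forall>i<n. \<forall>j<n. \<forall>l<n. g (coord_class n (str_var i j l)) = A.c i j l) \<and>
      (\<forall>i<n. g (coord_class n (unit_var i)) = \<phi> \<one>\<^bsub>A\<^esub> i)" for g :: "'k coord_poly set \<Rightarrow> 's"
    unfolding classifies_def ..
  from hom_of_structure_constants[OF S h A.is_structure_constants]
  obtain g where g0: "g \<in> ring_hom ?O S \<and> (\<forall>a. g (coord_class n (coord_const a)) = h a) \<and>
      (\<forall>i<n. \<forall>j<n. \<forall>l<n. g (coord_class n (str_var i j l)) = A.c i j l) \<and>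
      (\<forall>i<n. g (coord_class n (unit_var i)) = \<phi> \<one>\<^bsub>A\<^esub> i)"
    by (rule exE)
  have g: "g \<in> ring_hom ?O S" "\<forall>a. g (coord_class n (coord_const a)) = h a" "classifies S n A \<phi> g"
    unfolding cl using g0 by - (elim conjE, (intro conjI)?, assumption+)+
  show ?thesis
  proof (rule ex1I[of _ "restrict g (carrier ?O)"], intro conjI)
    show "restrict g (carrier ?O) \<in> ring_hom ?O S"
      by (rule ring.ring_hom_restrict[OF cring.axioms(1)[OF cring_based_algebra_ring] g(1)]) simp
    show "restrict g (carrier ?O) \<in> extensional (carrier ?O)"
      by (rule restrict_extensional)
    show "\<forall>a. restrict g (carrier ?O) (coord_class n (coord_const a)) = h a"
      using g(2) by (simp add: mem coord_const_mem)
    show "classifies S n A \<phi> (restrict g (carrier ?O))"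
      using g(3) unfolding cl by (simp add: mem coord_var_mem)
  next
    fix g' assume g': "g' \<in> ring_hom ?O S \<and> g' \<in> extensional (carrier ?O) \<and>
      (\<forall>a. g' (coord_class n (coord_const a)) = h a) \<and> classifies S n A \<phi> g'"
    have "g' x = g x" if "x \<in> carrier ?O" for x
    proof (rule hom_unique[OF _ g(1) _ _ that])
      show "g' \<in> ring_hom ?O S" using g' by (elim conjE)
      show "g' (coord_class n (coord_const a)) = g (coord_class n (coord_const a))" for a
        using g' g(2) by simp
      fix y assume "y \<in> coords n"
      then show "g' (coord_class n (coord_var y)) = g (coord_class n (coord_var y))"
        using g' g(3) unfolding cl by (cases y) simp_all
    qed
    then show "g' = restrict g (carrier ?O)"
      using g' by (intro extensionalityI[of _ "carrier ?O"]) simp_all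
  qed
qed

theorem based_algebra_ring_realizes:
  fixes g :: "'k::comm_ring_1 coord_poly set \<Rightarrow> 's" and S :: "('s, 'm) ring_scheme"
  assumes S: "cring S" and g: "g \<in> ring_hom (based_algebra_ring n) S"
  shows "\<exists>(A :: ('s, nat \<Rightarrow> 's) module) \<phi>. based_algebra S n A \<phi> \<and> classifies S n A \<phi> g"
proof -
  let ?c = "\<lambda>i j l. g (coord_class n (str_var i j l))"
  let ?u = "\<lambda>i. g (coord_class n (unit_var i))"
  interpret model_algebra_on S n ?c ?u
    by (intro model_algebra_on.intro model_algebra_on_axioms.intro S structure_constants_of_hom[OF S g])
  have "classifies S n M (\<lambda>x. x) g"
    unfolding classifies_def by (simp add: M_mult_basis M_one)
  with based_M show ?thesis by (intro exI conjI)
qed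

theorem classifies_base_change:
  fixes g :: "'k::comm_ring_1 coord_poly set \<Rightarrow> 's"
  assumes S: "cring S" and T: "cring T" and f: "f \<in> ring_hom S T"
    and A: "based_algebra S n A \<phi>" and B: "based_algebra T n B \<psi>"
    and \<alpha>: "\<alpha> \<in> ring_hom A B" "\<And>x i. x \<in> carrier A \<Longrightarrow> i < n \<Longrightarrow> \<psi> (\<alpha> x) i = f (\<phi> x i)"
    and g: "classifies S n A \<phi> g"
  shows "classifies T n B \<psi> (f \<circ> g)"
proof -
  interpret A: based_algebra_on S n A \<phi>
    by (rule based_algebra_on.intro[OF A])
  interpret B: based_algebra_on T n B \<psi>
    by (rule based_algebra_on.intro[OF B])
  have f0: "f \<zero>\<^bsub>S\<^esub> = \<zero>\<^bsub>T\<^esub>"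
    by (rule ring_hom_zero[OF f cring.axioms(1)[OF S] cring.axioms(1)[OF T]])
  have e: "\<alpha> (A.e i) = B.e i" for i
    by (rule B.eqI)
      (simp_all add: ring_hom_closed[OF \<alpha>(1)] \<alpha>(2) A.phi_e B.phi_e f0 ring_hom_one[OF f])
  have mult: "\<psi> (B.e i \<otimes>\<^bsub>B\<^esub> B.e j) l = f (\<phi> (A.e i \<otimes>\<^bsub>A\<^esub> A.e j) l)" if "l < n" for i j l
    using \<alpha>(2)[of "A.e i \<otimes>\<^bsub>A\<^esub> A.e j" l] that
    by (simp add: ring_hom_mult[OF \<alpha>(1)] e)
  have one: "\<psi> \<one>\<^bsub>B\<^esub> i = f (\<phi> \<one>\<^bsub>A\<^esub> i)" if "i < n" for i
    using \<alpha>(2)[of "\<one>\<^bsub>A\<^esub>" i] that by (simp add: ring_hom_one[OF \<alpha>(1)])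
  show ?thesis
    using g unfolding classifies_def by (simp add: mult one)
qed

theorem classifies_iff_isomorphic:
  fixes g :: "'k::comm_ring_1 coord_poly set \<Rightarrow> 's" and S :: "('s, 'm) ring_scheme"
    and A :: "('s, 'a, 'e) module_scheme" and B :: "('s, 'b, 'f) module_scheme"
  assumes S: "cring S" and A: "based_algebra S n A \<phi>" and B: "based_algebra S n B \<psi>"
    and g: "classifies S n A \<phi> g"
  shows "classifies S n B \<psi> g \<longleftrightarrow>
     (\<exists>\<alpha>\<in>ring_iso A B. (\<forall>a\<in>carrier S. \<forall>x\<in>carrier A. \<alpha> (a \<odot>\<^bsub>A\<^esub> x) = a \<odot>\<^bsub>B\<^esub> \<alpha> x) \<and>
        (\<forall>x\<in>carrier A. \<psi> (\<alpha> x) = \<phi> x))"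
proof
  interpret A: based_algebra_on S n A \<phi>
    by (rule based_algebra_on.intro[OF A])
  interpret B: based_algebra_on S n B \<psi>
    by (rule based_algebra_on.intro[OF B])
  assume g': "classifies S n B \<psi> g"
  have c: "A.c i j l = B.c i j l" if "i < n" "j < n" "l < n" for i j l
    using g g' that unfolding classifies_def by simp
  have u: "\<phi> \<one>\<^bsub>A\<^esub> i = \<psi> \<one>\<^bsub>B\<^esub> i" if "i < n" for i
    using g g' that unfolding classifies_def by simp
  define \<alpha> where "\<alpha> x = inv_into (carrier B) \<psi> (\<phi> x)" for x
  have im: "\<phi> x \<in> \<psi> ` carrier B" if "x \<in> carrier A" for x
    unfolding bij_betw_imp_surj_on[OF B.bij] using A.phi_PiE[OF that] .
  have \<alpha>_closed [simp]: "\<alpha> x \<in> carrier B" if "x \<in> carrier A" for x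
    unfolding \<alpha>_def by (rule inv_into_into[OF im[OF that]])
  have \<alpha>: "\<psi> (\<alpha> x) = \<phi> x" if "x \<in> carrier A" for x
    unfolding \<alpha>_def by (rule f_inv_into_f[OF im[OF that]])
  have "\<alpha> \<in> ring_hom A B"
  proof (rule ring_hom_memI)
    fix x y assume xy: "x \<in> carrier A" "y \<in> carrier A"
    show "\<alpha> (x \<otimes>\<^bsub>A\<^esub> y) = \<alpha> x \<otimes>\<^bsub>B\<^esub> \<alpha> y"
    proof (rule B.eqI)
      fix l assume l: "l < n"
      have "\<psi> (\<alpha> (x \<otimes>\<^bsub>A\<^esub> y)) l =
          (\<Oplus>\<^bsub>S\<^esub>i\<in>{..<n}. \<phi> x i \<otimes>\<^bsub>S\<^esub> (\<Oplus>\<^bsub>S\<^esub>j\<in>{..<n}. \<phi> y j \<otimes>\<^bsub>S\<^esub> A.c j i l))"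
      proof -
        have "x \<otimes>\<^bsub>A\<^esub> y \<in> carrier A" using xy by simp
        then show ?thesis unfolding \<alpha>[OF \<open>x \<otimes>\<^bsub>A\<^esub> y \<in> carrier A\<close>] by (intro A.mult[OF xy l])
      qed
      also have "\<dots> = (\<Oplus>\<^bsub>S\<^esub>i\<in>{..<n}. \<psi> (\<alpha> x) i \<otimes>\<^bsub>S\<^esub> (\<Oplus>\<^bsub>S\<^esub>j\<in>{..<n}. \<psi> (\<alpha> y) j \<otimes>\<^bsub>S\<^esub> B.c j i l))"
      proof (intro A.sum_cong A.sum_closed A.mult_closed arg_cong2[of _ _ _ _ "mult S"])
        fix i assume i: "i < n"
        show "\<phi> x i = \<psi> (\<alpha> x) i" using xy by (simp add: \<alpha>)
        show "\<psi> (\<alpha> x) i \<in> carrier S" using xy i by simp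
        fix j assume j: "j < n"
        show "\<phi> y j = \<psi> (\<alpha> y) j" using xy by (simp add: \<alpha>)
        show "A.c j i l = B.c j i l" by (rule c[OF j i l])
        show "\<psi> (\<alpha> y) j \<in> carrier S" "\<psi> (\<alpha> y) j \<in> carrier S" using xy j by simp_all
        show "B.c j i l \<in> carrier S" "B.c j i l \<in> carrier S" using l by simp_all
      qed
      also have "\<dots> = \<psi> (\<alpha> x \<otimes>\<^bsub>B\<^esub> \<alpha> y) l"
        using xy l by (intro B.mult[symmetric]) simp_all
      finally show "\<psi> (\<alpha> (x \<otimes>\<^bsub>A\<^esub> y)) l = \<psi> (\<alpha> x \<otimes>\<^bsub>B\<^esub> \<alpha> y) l" .
    qed (use xy in simp_all)
    show "\<alpha> (x \<oplus>\<^bsub>A\<^esub> y) = \<alpha> x \<oplus>\<^bsub>B\<^esub> \<alpha> y"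
      by (rule B.eqI) (use xy in \<open>simp_all add: \<alpha> A.add B.add\<close>)
  next
    show "\<alpha> \<one>\<^bsub>A\<^esub> = \<one>\<^bsub>B\<^esub>"
      by (rule B.eqI) (simp_all add: \<alpha> u)
  qed (rule \<alpha>_closed)
  moreover have "bij_betw \<alpha> (carrier A) (carrier B)"
  proof -
    have "bij_betw (inv_into (carrier B) \<psi> \<circ> \<phi>) (carrier A) (carrier B)"
      by (rule bij_betw_trans[OF A.bij bij_betw_inv_into[OF B.bij]])
    moreover have "inv_into (carrier B) \<psi> \<circ> \<phi> = \<alpha>"
      by (simp add: fun_eq_iff \<alpha>_def)
    ultimately show ?thesis by simp
  qed
  ultimately have "\<alpha> \<in> ring_iso A B"
    by (simp add: ring_iso_def)
  moreover have "\<alpha> (a \<odot>\<^bsub>A\<^esub> x) = a \<odot>\<^bsub>B\<^esub> \<alpha> x" if "a \<in> carrier S" "x \<in> carrier A" for a x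
    by (rule B.eqI) (use that in \<open>simp_all add: \<alpha> A.smult B.smult\<close>)
  ultimately show "\<exists>\<alpha>\<in>ring_iso A B.
      (\<forall>a\<in>carrier S. \<forall>x\<in>carrier A. \<alpha> (a \<odot>\<^bsub>A\<^esub> x) = a \<odot>\<^bsub>B\<^esub> \<alpha> x) \<and> (\<forall>x\<in>carrier A. \<psi> (\<alpha> x) = \<phi> x)"
    using \<alpha> by (intro bexI[of _ \<alpha>]) simp_all
next
  assume "\<exists>\<alpha>\<in>ring_iso A B.
      (\<forall>a\<in>carrier S. \<forall>x\<in>carrier A. \<alpha> (a \<odot>\<^bsub>A\<^esub> x) = a \<odot>\<^bsub>B\<^esub> \<alpha> x) \<and> (\<forall>x\<in>carrier A. \<psi> (\<alpha> x) = \<phi> x)"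
  then obtain \<alpha> where \<alpha>: "\<alpha> \<in> ring_iso A B" "\<forall>x\<in>carrier A. \<psi> (\<alpha> x) = \<phi> x"
    by (elim bexE conjE)
  have "classifies S n B \<psi> (id \<circ> g)"
    by (rule classifies_base_change[OF S S id_ring_hom A B _ _ g, of \<alpha>])
      (use \<alpha> in \<open>simp_all add: ring_iso_def\<close>)
  then show "classifies S n B \<psi> g" by simp
qed

end

theory Submission
  imports Defs "Jordan_Normal_Form.Determinant" "HOL-Library.Function_Algebras"
begin

text \<open>
  The tangent space at a based algebra \<open>A\<close> is the space of symmetric Hochschild 2-cocycles of \<open>A\<close>. If
  \<open>A\<close> has no derivations, it contains the \<open>n\<^sup>2\<close>-dimensional space of coboundaries. This happens
  at \<open>k\<^sup>n\<close>, hence on a nonempty open set. On the other hand, the product of \<open>k\<^sup>n\<^sup>-\<^sup>8\<close> with a suitable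
  graded algebra with Hilbert function \<open>(1, 4, 3)\<close> has a tangent space of dimension \<open>n\<^sup>2 - 7\<close>. The
  condition that the tangent space has dimension less than \<open>n\<^sup>2\<close> is open, so there are two disjoint
  nonempty open sets. Concretely, determinants \<open>f\<close> and \<open>g\<close> of matrices of polynomials witness the two
  conditions at the two points, and a power of \<open>f\<close> times \<open>g\<close> lies in the ideal of relations.
\<close>

section \<open>Determinants modulo an ideal\<close>

text \<open>Determinants are formed over a whole type, so the ideal is taken in a type-class ring
  and not in a ring with a carrier.\<close>

locale comm_ring_ideal =
  fixes J :: "'a::comm_ring_1 set"
  assumes zero_mem: "0 \<in> J"
    and add_mem: "a \<in> J \<Longrightarrow> b \<in> J \<Longrightarrow> a + b \<in> J"
    and mult_mem: "a \<in> J \<Longrightarrow> r * a \<in> J"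
begin

lemma uminus_mem: "a \<in> J \<Longrightarrow> - a \<in> J"
  using mult_mem[of a "- 1"] by simp

lemma sum_mem: "(\<And>i. i \<in> I \<Longrightarrow> f i \<in> J) \<Longrightarrow> sum f I \<in> J"
  by (induction I rule: infinite_finite_induct) (auto intro: zero_mem add_mem)

lemma prod_cong_mod: "(\<And>i. i \<in> I \<Longrightarrow> f i - g i \<in> J) \<Longrightarrow> prod f I - prod g I \<in> J"
proof (induction I rule: infinite_finite_induct)
  case (insert x F)
  have "prod f (insert x F) - prod g (insert x F) =
      f x * (prod f F - prod g F) + prod g F * (f x - g x)"
    using insert.hyps by (simp add: algebra_simps)
  also have "\<dots> \<in> J"
    using insert.IH insert.prems by (auto intro!: add_mem mult_mem)
  finally show ?case .
qed (simp_all add: zero_mem)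

lemma det_cong_mod:
  assumes P: "P \<in> carrier_mat m m" and Q: "Q \<in> carrier_mat m m"
    and PQ: "\<And>i j. i < m \<Longrightarrow> j < m \<Longrightarrow> P $$ (i, j) - Q $$ (i, j) \<in> J"
  shows "det P - det Q \<in> J"
proof -
  have "det P - det Q = (\<Sum>p\<in>{p. p permutes {0..<m}}.
      signof p * ((\<Prod>i = 0..<m. P $$ (i, p i)) - (\<Prod>i = 0..<m. Q $$ (i, p i))))"
    unfolding det_def'[OF P] det_def'[OF Q] by (simp add: sum_subtractf right_diff_distrib)
  also have "\<dots> \<in> J"
    by (intro sum_mem mult_mem prod_cong_mod PQ) (auto simp: permutes_in_image)
  finally show ?thesis .
qed

end

text \<open>Padding both factors with zeros makes them square, and the padded \<open>Q\<close> has a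
  zero row. This works over every commutative ring.\<close>

lemma det_mult_thin:
  fixes P Q :: "'a::comm_ring_1 mat"
  assumes P: "P \<in> carrier_mat m s" and Q: "Q \<in> carrier_mat s m" and s: "s < m"
  shows "det (P * Q) = 0"
proof -
  define P' where "P' = mat m m (\<lambda>(i, j). if j < s then P $$ (i, j) else 0)"
  define Q' where "Q' = mat m m (\<lambda>(i, j). if i < s then Q $$ (i, j) else 0)"
  have [simp]: "P' \<in> carrier_mat m m" "Q' \<in> carrier_mat m m"
    by (simp_all add: P'_def Q'_def)
  have "P * Q = P' * Q'"
  proof (rule eq_matI)
    fix i j assume "i < dim_row (P' * Q')" "j < dim_col (P' * Q')"
    then have ij: "i < m" "j < m" by (simp_all add: P'_def Q'_def)
    have "(P' * Q') $$ (i, j) = (\<Sum>k = 0..<m. if k < s then P $$ (i, k) * Q $$ (k, j) else 0)"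
      using ij by (auto simp: P'_def Q'_def scalar_prod_def intro!: sum.cong)
    also have "\<dots> = (\<Sum>k = 0..<s. P $$ (i, k) * Q $$ (k, j))"
      using s by (intro sum.mono_neutral_cong_right) auto
    also have "\<dots> = (P * Q) $$ (i, j)"
      using ij P Q by (simp add: scalar_prod_def)
    finally show "(P * Q) $$ (i, j) = (P' * Q') $$ (i, j)" ..
  qed (use P Q in \<open>simp_all add: P'_def Q'_def\<close>)
  moreover have "det Q' = 0"
    unfolding det_def'[OF \<open>Q' \<in> carrier_mat m m\<close>]
  proof (intro sum.neutral ballI)
    fix p assume "p \<in> {p. p permutes {0..<m}}"
    then have p: "p s < m" using s permutes_in_image[of p "{0..<m}" s] by simp
    have "(\<Prod>i = 0..<m. Q' $$ (i, p i)) = 0"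
      by (rule prod_zero[OF _ bexI[of _ s]]) (use p s in \<open>simp_all add: Q'_def\<close>)
    then show "signof p * (\<Prod>i = 0..<m. Q' $$ (i, p i)) = 0" by simp
  qed
  ultimately show ?thesis
    by (simp add: det_mult[of P' m Q'])
qed

text \<open>Lists enumerate the index sets, so that rows and columns can be indexed by pairs and
  triples.\<close>

definition mat_on :: "'t list \<Rightarrow> 'e list \<Rightarrow> ('t \<Rightarrow> 'e \<Rightarrow> 'a) \<Rightarrow> 'a mat" where
  "mat_on ts es A = mat (length ts) (length es) (\<lambda>(i, j). A (ts ! i) (es ! j))"

lemma mat_on_carrier [simp]: "mat_on ts es A \<in> carrier_mat (length ts) (length es)"
  by (simp add: mat_on_def)

lemma mat_on_mult:
  assumes "distinct es"
  shows "mat_on ts es A * mat_on es us B = mat_on ts us (\<lambda>t u. \<Sum>e\<in>set es. A t e * B e u)"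
proof (rule eq_matI)
  fix i j assume "i < dim_row (mat_on ts us (\<lambda>t u. \<Sum>e\<in>set es. A t e * B e u))"
    "j < dim_col (mat_on ts us (\<lambda>t u. \<Sum>e\<in>set es. A t e * B e u))"
  then have ij: "i < length ts" "j < length us" by (simp_all add: mat_on_def)
  have "(\<Sum>e\<in>set es. A (ts ! i) e * B e (us ! j)) =
      (\<Sum>k = 0..<length es. A (ts ! i) (es ! k) * B (es ! k) (us ! j))"
    using sum.reindex_bij_betw[OF bij_betw_nth[OF assms refl refl],
        of "\<lambda>e. A (ts ! i) e * B e (us ! j)"] by (simp add: atLeast0LessThan)
  then show "(mat_on ts es A * mat_on es us B) $$ (i, j) =
      mat_on ts us (\<lambda>t u. \<Sum>e\<in>set es. A t e * B e u) $$ (i, j)"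
    using ij by (simp add: mat_on_def scalar_prod_def)
qed (simp_all add: mat_on_def)

text \<open>
  Over a field: if \<open>A\<close> and \<open>G B\<close> are invertible, then \<open>A B\<close> is injective and cannot factor through
  a space of smaller dimension. The adjugate of \<open>A\<close> turns this into a statement over any ring.
\<close>

lemma (in comm_ring_ideal) det_power_mult_det_mem:
  fixes A :: "'t \<Rightarrow> 't \<Rightarrow> 'a" and B :: "'t \<Rightarrow> 'e \<Rightarrow> 'a" and G :: "'e \<Rightarrow> 't \<Rightarrow> 'a"
    and X :: "'t \<Rightarrow> 's \<Rightarrow> 'a" and Y :: "'s \<Rightarrow> 'e \<Rightarrow> 'a"
  assumes ts: "distinct ts" and es: "distinct es" and ss: "distinct ss"
    and less: "length ss < length es"
    and AB: "\<And>t e. t \<in> set ts \<Longrightarrow> e \<in> set es \<Longrightarrow>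
       (\<Sum>t'\<in>set ts. A t t' * B t' e) - (\<Sum>s\<in>set ss. X t s * Y s e) \<in> J"
  shows "det (mat_on ts ts A) ^ length es *
     det (mat_on es es (\<lambda>e e'. \<Sum>t\<in>set ts. G e t * B t e')) \<in> J"
proof -
  let ?N = "length ts" and ?E = "length es" and ?S = "length ss"
  define A' B' G' X' Y' where "A' = mat_on ts ts A" and "B' = mat_on ts es B"
    and "G' = mat_on es ts G" and "X' = mat_on ts ss X" and "Y' = mat_on ss es Y"
  note mats = A'_def B'_def G'_def X'_def Y'_def
  have [simp]: "A' \<in> carrier_mat ?N ?N" "B' \<in> carrier_mat ?N ?E" "G' \<in> carrier_mat ?E ?N"
    "X' \<in> carrier_mat ?N ?S" "Y' \<in> carrier_mat ?S ?E"
    by (simp_all add: mats)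
  have adj [simp]: "adj_mat A' \<in> carrier_mat ?N ?N" "adj_mat A' * A' = det A' \<cdot>\<^sub>m 1\<^sub>m ?N"
    by (simp_all add: adj_mat)
  \<comment> \<open>Up to the factor \<open>det A'\<close>, this is \<open>G'\<close> times the
    inverse of \<open>A'\<close>. It sends \<open>A' * B'\<close> to a multiple of
    \<open>G' * B'\<close>, while its product with \<open>X' * Y'\<close> still factors through
    \<open>ss\<close>.\<close>
  define K where "K = G' * adj_mat A'"
  have K [simp]: "K \<in> carrier_mat ?E ?N"
    unfolding K_def by (rule mult_carrier_mat[of _ _ ?N]) simp_all
  have XY: "(A' * B') $$ (i, j) - (X' * Y') $$ (i, j) \<in> J" if "i < ?N" "j < ?E" for i j
    using that AB[of "ts ! i" "es ! j"] unfolding mats mat_on_mult[OF ts] mat_on_mult[OF ss]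
    by (simp add: mat_on_def)
  have AB': "A' * B' \<in> carrier_mat ?N ?E" "X' * Y' \<in> carrier_mat ?N ?E"
    by (rule mult_carrier_mat[of _ _ ?N] mult_carrier_mat[of _ _ ?S]; simp)+
  have KAB: "K * (A' * B') = det A' \<cdot>\<^sub>m (G' * B')"
  proof -
    have "K * (A' * B') = G' * (adj_mat A' * A' * B')"
      unfolding K_def
      using assoc_mult_mat[of G' ?E ?N "adj_mat A'" ?N "A' * B'" ?E]
        assoc_mult_mat[of "adj_mat A'" ?N ?N A' ?N B' ?E] AB'(1)
      by (simp del: adj(2))
    also have "\<dots> = G' * (det A' \<cdot>\<^sub>m B')"
      by (simp add: mult_smult_assoc_mat[of _ ?N ?N _ ?E] left_mult_one_mat[of _ ?N ?E])
    also have "\<dots> = det A' \<cdot>\<^sub>m (G' * B')"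
      by (rule mult_smult_distrib[of _ ?E ?N _ ?E]) simp_all
    finally show ?thesis .
  qed
  have entry: "(K * M) $$ (i, j) = (\<Sum>k = 0..<?N. K $$ (i, k) * M $$ (k, j))"
    if "M \<in> carrier_mat ?N ?E" "i < ?E" "j < ?E" for M i j
    using that carrier_matD[OF K] by (simp add: scalar_prod_def)
  have "det (K * (A' * B')) - det (K * (X' * Y')) \<in> J"
  proof (rule det_cong_mod)
    fix i j assume ij: "i < ?E" "j < ?E"
    have "(K * (A' * B')) $$ (i, j) - (K * (X' * Y')) $$ (i, j) =
        (\<Sum>k = 0..<?N. K $$ (i, k) * ((A' * B') $$ (k, j) - (X' * Y') $$ (k, j)))"
      by (simp add: entry[OF AB'(1) ij] entry[OF AB'(2) ij] sum_subtractf right_diff_distrib)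
    also have "\<dots> \<in> J"
      using ij by (intro sum_mem mult_mem XY) auto
    finally show "(K * (A' * B')) $$ (i, j) - (K * (X' * Y')) $$ (i, j) \<in> J" .
  qed (use AB' in \<open>auto intro!: mult_carrier_mat[of _ _ ?N]\<close>)
  moreover have "det (K * (X' * Y')) = 0"
  proof -
    have "K * (X' * Y') = (K * X') * Y'"
      by (rule assoc_mult_mat[symmetric, of _ ?E ?N _ ?S _ ?E]) simp_all
    also have "det \<dots> = 0"
      by (rule det_mult_thin[OF _ _ less]) (auto intro: mult_carrier_mat[of _ _ ?N])
    finally show ?thesis .
  qed
  \<comment> \<open>The power comes from pulling the scalar \<open>det A'\<close> out of a matrix of
    size \<open>?E\<close>.\<close>
  moreover have "det (K * (A' * B')) = det A' ^ ?E * det (G' * B')"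
    unfolding KAB det_smult by (simp add: mats mat_on_def)
  moreover have "G' * B' = mat_on es es (\<lambda>e e'. \<Sum>t\<in>set ts. G e t * B t e')"
    unfolding mats by (rule mat_on_mult[OF ts])
  ultimately show ?thesis by (simp add: A'_def)
qed

section \<open>Left inverses of injective matrices over a field\<close>

lemma sum_apply: "(sum f I) x = (\<Sum>i\<in>I. f i x)" for f :: "'i \<Rightarrow> 'b \<Rightarrow> 'a::comm_monoid_add"
  by (induction I rule: infinite_finite_induct) simp_all

text \<open>By duality: if the rows did not span, a functional vanishing on them would yield a
  nonzero kernel vector. So every unit vector is a combination of rows, and the coefficients form
  \<open>L\<close>.\<close>

lemma left_inverse_of_injective:
  fixes A :: "'r \<Rightarrow> 't \<Rightarrow> 'k::field"
  assumes R: "finite R" and T: "finite T"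
    and inj: "\<And>x. (\<And>r. r \<in> R \<Longrightarrow> (\<Sum>t\<in>T. A r t * x t) = 0) \<Longrightarrow> \<forall>t\<in>T. x t = 0"
  obtains L where "\<And>t t'. t \<in> T \<Longrightarrow> t' \<in> T \<Longrightarrow>
    (\<Sum>r\<in>R. L t r * A r t') = (if t = t' then 1 else 0)"
proof -
  define scale where "scale = (\<lambda>(c::'k) (f :: 't \<Rightarrow> 'k) t. c * f t)"
  interpret V: vector_space scale
    by unfold_locales (auto simp: scale_def fun_eq_iff algebra_simps)
  interpret K: vector_space "(*) :: 'k \<Rightarrow> 'k \<Rightarrow> 'k"
    by unfold_locales (auto simp: algebra_simps)
  interpret VK: vector_space_pair scale "(*) :: 'k \<Rightarrow> 'k \<Rightarrow> 'k"
    by unfold_locales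
  \<comment> \<open>Cutting off outside \<open>T\<close> makes each row a finite combination of the
    unit vectors of \<open>T\<close>.\<close>
  define row where "row r = (\<lambda>t. if t \<in> T then A r t else 0)" for r
  define unit where "unit t = (\<lambda>t'::'t. if t' = t then 1 else (0::'k))" for t
  have span: "unit t \<in> V.span (row ` R)" if t: "t \<in> T" for t
  proof (rule ccontr)
    assume nt: "unit t \<notin> V.span (row ` R)"
    obtain B where B: "B \<subseteq> row ` R" "V.independent B" "V.span B = V.span (row ` R)"
      using V.maximal_independent_subset[of "row ` R"] V.span_subspace[of _ "V.span (row ` R)"]
      by (metis V.span_mono V.span_span subset_antisym)
    have ind: "V.independent (insert (unit t) B)"
      using B nt by (simp add: V.independent_insert)
    \<comment> \<open>This functional is 1 at \<open>unit t\<close> and 0 on all rows; its values on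
      the unit vectors form the forbidden kernel vector.\<close>
    define h where "h = VK.construct (insert (unit t) B) (\<lambda>v. if v = unit t then 1 else 0)"
    have lin: "Vector_Spaces.linear scale (*) h"
      unfolding h_def by (rule VK.linear_construct[OF ind])
    interpret h: Vector_Spaces.linear scale "(*)" h by (rule lin)
    have h1: "h (unit t) = 1"
      unfolding h_def by (simp add: VK.construct_basis[OF ind])
    have hB: "h b = 0" if "b \<in> B" for b
      using that nt B(1) V.span_base[of b "row ` R"]
      by (auto simp: h_def VK.construct_basis[OF ind])
    have h0: "h v = 0" if "v \<in> V.span (row ` R)" for v
      using that unfolding B(3)[symmetric]
      by (induction rule: V.span_induct_alt) (simp_all only: hB h.add h.scale h.zero mult_zero_right add_0)
    have expand: "row r = (\<Sum>t\<in>T. scale (A r t) (unit t))" for r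
      using T by (simp add: fun_eq_iff row_def scale_def unit_def sum_apply if_distrib[of "(*) _"] cong: if_cong)
    have "(\<Sum>t\<in>T. A r t * h (unit t)) = 0" if "r \<in> R" for r
      using h0[OF V.span_base[of "row r"]] that
      by (simp add: expand h.sum h.scale)
    from inj[OF this] t have "h (unit t) = 0" by blast
    with h1 show False by simp
  qed
  have "\<exists>l. unit t = (\<Sum>r\<in>R. scale (l r) (row r))" if "t \<in> T" for t
    using span[OF that]
  proof (induction rule: V.span_induct_alt)
    case base
    show ?case by (rule exI[of _ "\<lambda>_. 0"]) (simp add: scale_def fun_eq_iff sum_apply)
  next
    case (step c v w)
    then obtain r l where r: "r \<in> R" "v = row r" and l: "w = (\<Sum>r\<in>R. scale (l r) (row r))" by blast
    have "scale c v + w = (\<Sum>r'\<in>R. scale (l r' + (if r' = r then c else 0)) (row r'))"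
      using r R by (simp add: l V.scale_left_distrib sum.distrib if_distrib[of "\<lambda>c. scale c _"] cong: if_cong)
    then show ?case by (rule exI[of _ "\<lambda>r'. l r' + (if r' = r then c else 0)"])
  qed
  then obtain L where L: "\<And>t. t \<in> T \<Longrightarrow> unit t = (\<Sum>r\<in>R. scale (L t r) (row r))" by metis
  show thesis
  proof (rule that)
    fix t t' assume t: "t \<in> T" "t' \<in> T"
    have "(\<Sum>r\<in>R. L t r * A r t') = (\<Sum>r\<in>R. scale (L t r) (row r)) t'"
      using t by (simp add: sum_apply scale_def row_def)
    also have "\<dots> = (if t = t' then 1 else 0)"
      unfolding L[OF t(1), symmetric] by (simp add: unit_def)
    finally show "(\<Sum>r\<in>R. L t r * A r t') = (if t = t' then 1 else 0)" .
  qed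
qed

section \<open>Cocycles and coboundaries\<close>

text \<open>
  The derivative at \<open>c\<close> of the action of \<open>GL\<^sub>n\<close> on structure constants, where \<open>D e\<^sub>i = (\<Sum>p. D\<^sub>i\<^sub>p e\<^sub>p)\<close>.
  It vanishes iff \<open>D\<close> is a derivation.
\<close>

definition coboundary ::
    "nat \<Rightarrow> (nat \<Rightarrow> nat \<Rightarrow> nat \<Rightarrow> 'a::comm_ring_1) \<Rightarrow> (nat \<times> nat \<Rightarrow> 'a) \<Rightarrow> nat \<times> nat \<times> nat \<Rightarrow> 'a" where
  "coboundary n c D = (\<lambda>(i, j, l).
     (\<Sum>p<n. D (i, p) * c p j l + D (j, p) * c i p l - c i j p * D (p, l)))"

text \<open>The derivative of the associator at \<open>c\<close> in the direction \<open>\<phi>\<close>.\<close>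

definition cocycle_defect ::
    "nat \<Rightarrow> (nat \<Rightarrow> nat \<Rightarrow> nat \<Rightarrow> 'a::comm_ring_1) \<Rightarrow> (nat \<times> nat \<times> nat \<Rightarrow> 'a) \<Rightarrow>
     nat \<Rightarrow> nat \<Rightarrow> nat \<Rightarrow> nat \<Rightarrow> 'a" where
  "cocycle_defect n c \<phi> i j l m =
     (\<Sum>p<n. c i j p * \<phi> (p, l, m) + \<phi> (i, j, p) * c p l m
        - c j l p * \<phi> (i, p, m) - \<phi> (j, l, p) * c i p m)"

definition associator ::
    "nat \<Rightarrow> (nat \<Rightarrow> nat \<Rightarrow> nat \<Rightarrow> 'a::comm_ring_1) \<Rightarrow> nat \<Rightarrow> nat \<Rightarrow> nat \<Rightarrow> nat \<Rightarrow> 'a" where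
  "associator n c i j l m = (\<Sum>p<n. c i j p * c p l m) - (\<Sum>p<n. c j l p * c i p m)"

text \<open>An exact identity, because the universal structure constants are commutative only modulo
  the relations: the right-hand side visibly lies in any ideal that contains the differences
  \<open>c i j l - c j i l\<close>.\<close>

lemma coboundary_symmetric:
  "coboundary n c D (i, j, l) - coboundary n c D (j, i, l) =
     (\<Sum>p<n. D (i, p) * (c p j l - c j p l) + D (j, p) * (c i p l - c p i l) -
        (c i j p - c j i p) * D (p, l))"
  unfolding coboundary_def by (simp add: sum_subtractf[symmetric] algebra_simps)

text \<open>The associator is \<open>GL\<^sub>n\<close>-equivariant; this is the derivative of that equivariance.\<close>

lemma cocycle_defect_coboundary:
  "cocycle_defect n c (coboundary n c D) i j l m =
     (\<Sum>p<n. D (i, p) * associator n c p j l m + D (j, p) * associator n c i p l m +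
        D (l, p) * associator n c i j p m - D (p, m) * associator n c i j l p)"
proof -
  note distribs = sum.distrib sum_subtractf sum_distrib_left sum_distrib_right distrib_left
    distrib_right left_diff_distrib right_diff_distrib
  have L: "cocycle_defect n c (coboundary n c D) i j l m =
    (\<Sum>p<n. \<Sum>q<n. c i j p * (D (p, q) * c q l m)) + (\<Sum>p<n. \<Sum>q<n. c i j p * (D (l, q) * c p q m))
     - (\<Sum>p<n. \<Sum>q<n. c i j p * (c p l q * D (q, m)))
     + ((\<Sum>p<n. \<Sum>q<n. (D (i, q) * c q j p) * c p l m) + (\<Sum>p<n. \<Sum>q<n. (D (j, q) * c i q p) * c p l m)
     - (\<Sum>p<n. \<Sum>q<n. (c i j q * D (q, p)) * c p l m))
     - ((\<Sum>p<n. \<Sum>q<n. c j l p * (D (i, q) * c q p m)) + (\<Sum>p<n. \<Sum>q<n. c j l p * (D (p, q) * c i q m))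
     - (\<Sum>p<n. \<Sum>q<n. c j l p * (c i p q * D (q, m))))
     - ((\<Sum>p<n. \<Sum>q<n. (D (j, q) * c q l p) * c i p m) + (\<Sum>p<n. \<Sum>q<n. (D (l, q) * c j q p) * c i p m)
     - (\<Sum>p<n. \<Sum>q<n. (c j l q * D (q, p)) * c i p m))"
    unfolding cocycle_defect_def coboundary_def prod.case by (simp only: distribs)
  have R: "(\<Sum>p<n. D (i, p) * associator n c p j l m + D (j, p) * associator n c i p l m +
        D (l, p) * associator n c i j p m - D (p, m) * associator n c i j l p) =
    (\<Sum>q<n. \<Sum>p<n. D (i, q) * (c q j p * c p l m)) - (\<Sum>q<n. \<Sum>p<n. D (i, q) * (c j l p * c q p m))
     + ((\<Sum>q<n. \<Sum>p<n. D (j, q) * (c i q p * c p l m)) - (\<Sum>q<n. \<Sum>p<n. D (j, q) * (c q l p * c i p m)))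
     + ((\<Sum>q<n. \<Sum>p<n. D (l, q) * (c i j p * c p q m)) - (\<Sum>q<n. \<Sum>p<n. D (l, q) * (c j q p * c i p m)))
     - ((\<Sum>q<n. \<Sum>p<n. D (q, m) * (c i j p * c p l q)) - (\<Sum>q<n. \<Sum>p<n. D (q, m) * (c j l p * c i p q)))"
    unfolding associator_def by (simp only: distribs)
  have swap: "(\<Sum>p<n. \<Sum>q<n. f p q) = (\<Sum>q<n. \<Sum>p<n. g q p)"
    if "\<And>p q. f p q = g q p" for f g :: "nat \<Rightarrow> nat \<Rightarrow> 'a"
    unfolding that by (rule sum.swap)
  \<comment> \<open>The first two identities cancel four of the twelve double sums in
    \<open>L\<close>; the other eight match the remaining sums with those of
    \<open>R\<close>.\<close>
  have e: "(\<Sum>p<n. \<Sum>q<n. (c i j q * D (q, p)) * c p l m) = (\<Sum>p<n. \<Sum>q<n. c i j p * (D (p, q) * c q l m))"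
    "(\<Sum>p<n. \<Sum>q<n. (c j l q * D (q, p)) * c i p m) = (\<Sum>p<n. \<Sum>q<n. c j l p * (D (p, q) * c i q m))"
    "(\<Sum>p<n. \<Sum>q<n. c i j p * (D (l, q) * c p q m)) = (\<Sum>q<n. \<Sum>p<n. D (l, q) * (c i j p * c p q m))"
    "(\<Sum>p<n. \<Sum>q<n. c i j p * (c p l q * D (q, m))) = (\<Sum>q<n. \<Sum>p<n. D (q, m) * (c i j p * c p l q))"
    "(\<Sum>p<n. \<Sum>q<n. c j l p * (D (i, q) * c q p m)) = (\<Sum>q<n. \<Sum>p<n. D (i, q) * (c j l p * c q p m))"
    "(\<Sum>p<n. \<Sum>q<n. c j l p * (c i p q * D (q, m))) = (\<Sum>q<n. \<Sum>p<n. D (q, m) * (c j l p * c i p q))"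
    "(\<Sum>p<n. \<Sum>q<n. (D (i, q) * c q j p) * c p l m) = (\<Sum>q<n. \<Sum>p<n. D (i, q) * (c q j p * c p l m))"
    "(\<Sum>p<n. \<Sum>q<n. (D (j, q) * c i q p) * c p l m) = (\<Sum>q<n. \<Sum>p<n. D (j, q) * (c i q p * c p l m))"
    "(\<Sum>p<n. \<Sum>q<n. (D (j, q) * c q l p) * c i p m) = (\<Sum>q<n. \<Sum>p<n. D (j, q) * (c q l p * c i p m))"
    "(\<Sum>p<n. \<Sum>q<n. (D (l, q) * c j q p) * c i p m) = (\<Sum>q<n. \<Sum>p<n. D (l, q) * (c j q p * c i p m))"
    by (rule swap, simp only: mult_ac)+
  show ?thesis
    unfolding L R e by (simp only: algebra_simps)
qed

section \<open>Evaluation of the coordinate ring\<close>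

text \<open>Sending the variables outside \<open>coords n\<close> to zero extends the class map from
  the carrier to all polynomials, which allows its application to determinants over the polynomial
  type.\<close>

lemma coord_class_extension:
  obtains \<pi> :: "'k::comm_ring_1 coord_poly \<Rightarrow> 'k coord_poly set"
  where "\<And>p. \<pi> p \<in> carrier (based_algebra_ring n)"
    and "\<pi> 0 = \<zero>\<^bsub>based_algebra_ring n\<^esub>" and "\<pi> 1 = \<one>\<^bsub>based_algebra_ring n\<^esub>"
    and "\<And>p q. \<pi> (p + q) = \<pi> p \<oplus>\<^bsub>based_algebra_ring n\<^esub> \<pi> q"
    and "\<And>p q. \<pi> (p * q) = \<pi> p \<otimes>\<^bsub>based_algebra_ring n\<^esub> \<pi> q"
    and "\<And>p. p \<in> carrier (coord_poly_ring n) \<Longrightarrow> \<pi> p = coord_class n p"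
proof -
  let ?O = "based_algebra_ring n :: 'k coord_poly set ring"
  have closed: "coord_class n p \<in> carrier ?O" if "p \<in> carrier (coord_poly_ring n)" for p
    using that unfolding carrier_based_algebra_ring by (rule imageI)
  define s where "s x = (if x \<in> coords n then coord_class n (coord_var x :: 'k coord_poly)
    else \<zero>\<^bsub>?O\<^esub>)" for x
  interpret O: cring ?O by (rule cring_based_algebra_ring)
  have h: "(\<lambda>a. coord_class n (coord_const a :: 'k coord_poly)) \<in> Ring.ring_hom base_ring ?O"
  proof -
    have "coord_const \<in> Ring.ring_hom base_ring (coord_poly_ring n :: 'k coord_poly ring)"
      by (rule ring_hom_memI)
        (simp_all add: coord_const_mem base_ring_def, simp_all add: coord_const_def mult_single single_add)
    from ring_hom_trans[OF this coord_class_hom] show ?thesis by (simp add: comp_def)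
  qed
  interpret coord_eval ?O "\<lambda>a. coord_class n (coord_const a)" s
    by unfold_locales (auto simp: s_def h closed coord_var_mem)
  show thesis
  proof (rule that[of ev])
    fix p :: "'k coord_poly" assume "p \<in> carrier (coord_poly_ring n)"
    then show "ev p = coord_class n p"
    proof (induction rule: coord_poly_ring_induct)
      case (add p q)
      then show ?case using ring_hom_add[OF coord_class_hom add(1,2)] by (simp add: ev_add)
    next
      case (mult p q)
      then show ?case using ring_hom_mult[OF coord_class_hom mult(1,2)] by (simp add: ev_mult)
    next
      case (var x)
      then show ?case unfolding ev_var by (simp add: s_def)
    qed simp
  qed (simp_all add: ev_add ev_mult)
qed

lemma linear_functional_expand:
  fixes F :: "('t \<Rightarrow> 'a::comm_ring_1) \<Rightarrow> 'a"
  assumes T: "finite T"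
    and add: "\<And>x y. F (\<lambda>t. x t + y t) = F x + F y"
    and scale: "\<And>a x. F (\<lambda>t. a * x t) = a * F x"
    and cong: "\<And>x y. (\<And>t. t \<in> T \<Longrightarrow> x t = y t) \<Longrightarrow> F x = F y"
  shows "F x = (\<Sum>t\<in>T. F (\<lambda>t'. of_bool (t' = t)) * x t)"
proof -
  have "F (\<lambda>t'. \<Sum>t\<in>U. x t * of_bool (t' = t)) = (\<Sum>t\<in>U. F (\<lambda>t'. of_bool (t' = t)) * x t)"
    if "finite U" for U
    using that
  proof (induction U)
    case empty
    show ?case using scale[of 0 x] by simp
  next
    case (insert u U)
    show ?case
      unfolding sum.insert[OF insert.hyps] add scale insert.IH by (simp only: mult.commute)
  qed
  moreover have "F x = F (\<lambda>t'. \<Sum>t\<in>T. x t * of_bool (t' = t))"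
    by (rule cong) (use T in \<open>simp add: of_bool_def if_distrib[of "(*) _"] cong: if_cong\<close>)
  ultimately show ?thesis using T by simp
qed

section \<open>Linear forms on cochains and their specialization at a point\<close>

abbreviation triples :: "nat \<Rightarrow> (nat \<times> nat \<times> nat) set" where
  "triples n \<equiv> {..<n} \<times> {..<n} \<times> {..<n}"

text \<open>
  Linear forms on cochains: the left hand sides of the linearized associativity and commutativity
  equations, and the coordinates.
\<close>

datatype cochain_row = Assoc nat nat nat nat | Comm nat nat nat | Coord "nat \<times> nat \<times> nat"

definition row_value ::
    "nat \<Rightarrow> (nat \<Rightarrow> nat \<Rightarrow> nat \<Rightarrow> 'a::comm_ring_1) \<Rightarrow> (nat \<times> nat \<times> nat \<Rightarrow> 'a) \<Rightarrow> cochain_row \<Rightarrow> 'a" where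
  "row_value n c \<phi> r = (case r of Assoc i j l m \<Rightarrow> cocycle_defect n c \<phi> i j l m
     | Comm i j l \<Rightarrow> \<phi> (i, j, l) - \<phi> (j, i, l) | Coord t \<Rightarrow> \<phi> t)"

definition relation_rows :: "nat \<Rightarrow> cochain_row set" where
  "relation_rows n = (\<lambda>(i, j, l, m). Assoc i j l m) ` ({..<n} \<times> {..<n} \<times> {..<n} \<times> {..<n}) \<union>
     (\<lambda>(i, j, l). Comm i j l) ` triples n"

lemma finite_relation_rows [simp]: "finite (relation_rows n)"
  by (simp add: relation_rows_def)

lemma mem_relation_rows [simp]:
  "Assoc i j l m \<in> relation_rows n \<longleftrightarrow> i < n \<and> j < n \<and> l < n \<and> m < n"
  "Comm i j l \<in> relation_rows n \<longleftrightarrow> i < n \<and> j < n \<and> l < n"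
  "Coord t \<notin> relation_rows n"
  unfolding relation_rows_def by force+

lemma row_value_expand:
  fixes \<phi> :: "nat \<times> nat \<times> nat \<Rightarrow> 'a::comm_ring_1"
  assumes "S \<subseteq> triples n" "r \<in> relation_rows n \<union> Coord ` S"
  shows "row_value n c \<phi> r =
    (\<Sum>t\<in>triples n. row_value n c (\<lambda>t'. of_bool (t' = t)) r * \<phi> t)"
proof (rule linear_functional_expand)
  fix x y :: "nat \<times> nat \<times> nat \<Rightarrow> 'a" and a
  show "row_value n c (\<lambda>t. x t + y t) r = row_value n c x r + row_value n c y r"
    by (cases r) (simp_all add: row_value_def cocycle_defect_def sum.distrib[symmetric] algebra_simps)
  show "row_value n c (\<lambda>t. a * x t) r = a * row_value n c x r"
    by (cases r) (simp_all add: row_value_def cocycle_defect_def sum_distrib_left algebra_simps)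
  assume "\<And>t. t \<in> triples n \<Longrightarrow> x t = y t"
  with assms show "row_value n c x r = row_value n c y r"
    by (cases r) (auto simp: row_value_def cocycle_defect_def intro!: sum.cong)
qed simp

lemma coboundary_expand:
  fixes D :: "nat \<times> nat \<Rightarrow> 'a::comm_ring_1"
  assumes "t \<in> triples n"
  shows "coboundary n c D t =
    (\<Sum>e\<in>{..<n} \<times> {..<n}. coboundary n c (\<lambda>e'. of_bool (e' = e)) t * D e)"
proof (rule linear_functional_expand)
  obtain i j l where t: "t = (i, j, l)" "i < n" "j < n" "l < n"
    using assms by (cases t) auto
  fix x y :: "nat \<times> nat \<Rightarrow> 'a" and a
  show "coboundary n c (\<lambda>e. x e + y e) t = coboundary n c x t + coboundary n c y t"
    by (simp add: t coboundary_def sum.distrib[symmetric] algebra_simps)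
  show "coboundary n c (\<lambda>e. a * x e) t = a * coboundary n c x t"
    by (simp add: t coboundary_def sum_distrib_left algebra_simps)
  assume "\<And>e. e \<in> {..<n} \<times> {..<n} \<Longrightarrow> x e = y e"
  with t show "coboundary n c x t = coboundary n c y t"
    by (auto simp: coboundary_def intro!: sum.cong)
qed simp

text \<open>With evaluation at a point as \<open>hom\<close>, this and \<open>hom_coboundary\<close>
  specialize the universal matrices to those of the algebra with structure constants
  \<open>c\<close>.\<close>

lemma (in comm_ring_hom) hom_row_value:
  assumes "\<And>i j l. i < n \<Longrightarrow> j < n \<Longrightarrow> l < n \<Longrightarrow> hom (v i j l) = c i j l" "r \<in> relation_rows n \<union> Coord ` S"
  shows "hom (row_value n v (\<lambda>t'. of_bool (t' = t)) r) = row_value n c (\<lambda>t'. of_bool (t' = t)) r"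
  using assms
  by (cases r) (auto simp: row_value_def cocycle_defect_def hom_distribs of_bool_def intro!: sum.cong)

lemma (in comm_ring_hom) hom_coboundary:
  assumes "\<And>i j l. i < n \<Longrightarrow> j < n \<Longrightarrow> l < n \<Longrightarrow> hom (v i j l) = c i j l" "t \<in> triples n"
  shows "hom (coboundary n v (\<lambda>e'. of_bool (e' = e)) t) = coboundary n c (\<lambda>e'. of_bool (e' = e)) t"
  using assms
  by (cases t) (auto simp: coboundary_def hom_distribs of_bool_def intro!: sum.cong)

text \<open>Supplies the points of the spectrum that show closed subsets to be proper.\<close>

lemma prime_kernel:
  fixes S :: "('s, 'm) ring_scheme" and \<gamma> :: "'s \<Rightarrow> 'k::field"
  assumes S: "cring S" and \<gamma>: "\<gamma> \<in> Ring.ring_hom S base_ring"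
  shows "primeideal {x \<in> carrier S. \<gamma> x = 0} S"
proof -
  interpret B: cring "base_ring :: 'k ring" by (rule cring_base_ring)
  interpret B: domain "base_ring :: 'k ring"
    by unfold_locales (auto simp: base_ring_def)
  interpret S: cring S by (rule S)
  interpret \<gamma>: ring_hom_ring S base_ring \<gamma>
    by (intro ring_hom_ringI2 S.ring_axioms B.ring_axioms \<gamma>)
  have "primeideal {r \<in> carrier S. \<gamma> r \<in> {\<zero>\<^bsub>base_ring\<^esub>}} S"
    by (rule \<gamma>.primeideal_vimage[OF S B.zeroprimeideal])
  then show ?thesis by (simp add: base_ring_def)
qed

section \<open>A criterion for reducibility\<close>

lemma det_mat_on_delta:
  assumes "distinct ts" "\<And>t t'. t \<in> set ts \<Longrightarrow> t' \<in> set ts \<Longrightarrow> M t t' = (if t = t' then 1 else 0)"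
  shows "det (mat_on ts ts M) = (1 :: 'a::comm_ring_1)"
proof -
  have "mat_on ts ts M = 1\<^sub>m (length ts)"
    by (rule eq_matI) (use assms in \<open>auto simp: mat_on_def nth_eq_iff_index_eq\<close>)
  then show ?thesis by simp
qed

lemma (in comm_ring_hom) hom_det_mat_on:
  "hom (det (mat_on ts ts M)) = det (mat_on ts ts (\<lambda>t t'. hom (M t t')))"
proof -
  have "map_mat hom (mat_on ts ts M) = mat_on ts ts (\<lambda>t t'. hom (M t t'))"
    by (rule eq_matI) (simp_all add: mat_on_def)
  then show ?thesis by (simp flip: hom_det)
qed

text \<open>
  At the first point the orbit map of \<open>GL\<^sub>n\<close> is an immersion, so nearby the tangent spaces have
  dimension at least \<open>n\<^sup>2\<close>; at the second point the tangent space has smaller dimension.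
\<close>

theorem reducible_criterion:
  fixes c\<^sub>1 c\<^sub>2 :: "nat \<Rightarrow> nat \<Rightarrow> nat \<Rightarrow> 'k::field"
  assumes sc1: "is_structure_constants (base_ring :: 'k ring) n c\<^sub>1 u\<^sub>1"
    and no_derivation: "\<And>D. (\<And>t. t \<in> triples n \<Longrightarrow> coboundary n c\<^sub>1 D t = 0) \<Longrightarrow> \<forall>e\<in>{..<n} \<times> {..<n}. D e = 0"
    and sc2: "is_structure_constants (base_ring :: 'k ring) n c\<^sub>2 u\<^sub>2"
    and S: "S \<subseteq> triples n" "card S < n * n"
    and cocycle_zero: "\<And>\<phi>. (\<And>r. r \<in> relation_rows n \<union> Coord ` S \<Longrightarrow> row_value n c\<^sub>2 \<phi> r = 0) \<Longrightarrow>
      \<forall>t\<in>triples n. \<phi> t = 0"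
  shows "reducible_space (based_algebra_scheme TYPE('k) n)"
proof -
  let ?O = "based_algebra_ring n :: 'k coord_poly set ring"
  let ?E = "{..<n} \<times> {..<n}"
  let ?R = "relation_rows n \<union> Coord ` S"
  interpret O: cring ?O by (rule cring_based_algebra_ring)
  obtain \<pi> where \<pi>: "\<And>p. \<pi> p \<in> carrier ?O" "\<pi> 0 = \<zero>\<^bsub>?O\<^esub>" "\<pi> 1 = \<one>\<^bsub>?O\<^esub>"
    "\<And>p q. \<pi> (p + q) = \<pi> p \<oplus>\<^bsub>?O\<^esub> \<pi> q" "\<And>p q. \<pi> (p * q) = \<pi> p \<otimes>\<^bsub>?O\<^esub> \<pi> q"
    and \<pi>_class: "\<And>p. p \<in> carrier (coord_poly_ring n) \<Longrightarrow> \<pi> p = coord_class n p"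
    by (rule coord_class_extension[of n]) (rule that)
  note [simp] = \<pi>(1)
  \<comment> \<open>Congruence modulo this kernel is equality in the coordinate ring.\<close>
  define J where "J = {p. \<pi> p = \<zero>\<^bsub>?O\<^esub>}"
  interpret comm_ring_ideal J
    by unfold_locales (simp_all add: J_def \<pi>)
  have rel: "p \<in> J" if "p \<in> comm_relations n \<union> assoc_relations n \<union> unit_relations n" for p
  proof -
    have "p \<in> based_algebra_ideal n"
      unfolding based_algebra_ideal_def
      using ring.genideal_self[OF cring.axioms(1)[OF cring_coord_poly_ring] relations_subset] that
      by blast
    then show ?thesis
      using relations_subset[of n] that by (auto simp: J_def \<pi>_class coord_class_eq_zero)
  qed
  define v :: "nat \<Rightarrow> nat \<Rightarrow> nat \<Rightarrow> 'k coord_poly" where "v i j l = str_var i j l" for i j l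
  have assoc: "associator n v i j l m \<in> J" if "i < n" "j < n" "l < n" "m < n" for i j l m
    by (rule rel) (use that in \<open>auto simp: associator_def v_def assoc_relations_def\<close>)
  have comm: "v i j l - v j i l \<in> J" if "i < n" "j < n" "l < n" for i j l
    by (rule rel) (use that in \<open>auto simp: v_def comm_relations_def\<close>)
  have diff: "a - b \<in> J" if "a \<in> J" "b \<in> J" for a b
    using add_mem[OF that(1) uminus_mem[OF that(2)]] by simp
  have mult': "a * r \<in> J" if "a \<in> J" for a r
    using mult_mem[OF that, of r] by (simp add: mult.commute)
  \<comment> \<open>Coboundaries for the universal structure constants \<open>v\<close> are
    symmetric cocycles modulo the relations.\<close>
  have rows: "row_value n v (coboundary n v D) r \<in> J" if "r \<in> relation_rows n" for r D
    using that
    by (cases r) (auto simp: row_value_def cocycle_defect_coboundary coboundary_symmetric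
        intro!: sum_mem diff add_mem mult_mem[OF assoc] mult_mem[OF comm] mult'[OF comm])

  have finT: "finite (triples n)" by simp
  have finS: "finite S" by (rule finite_subset[OF S(1) finT])
  \<comment> \<open>At the second point the forms in \<open>?R\<close> separate cochains, so their
    matrix has a left inverse.\<close>
  obtain L where L: "\<And>t t'. t \<in> triples n \<Longrightarrow> t' \<in> triples n \<Longrightarrow>
      (\<Sum>r\<in>?R. L t r * row_value n c\<^sub>2 (\<lambda>t. of_bool (t = t')) r) = (if t = t' then 1 else 0)"
  proof (rule left_inverse_of_injective[where R = ?R and T = "triples n" and A = "\<lambda>r t'. row_value n c\<^sub>2 (\<lambda>t. of_bool (t = t')) r"])
    fix x :: "_ \<Rightarrow> 'k" assume "\<And>r. r \<in> ?R \<Longrightarrow> (\<Sum>t\<in>triples n. row_value n c\<^sub>2 (\<lambda>t'. of_bool (t' = t)) r * x t) = 0"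
    then have "row_value n c\<^sub>2 x r = 0" if "r \<in> ?R" for r
      using row_value_expand[OF S(1) that, of c\<^sub>2 x] that by simp
    then show "\<forall>t\<in>triples n. x t = 0" by (rule cocycle_zero)
  qed (use finT finS in auto)
  \<comment> \<open>At the first point the coboundary map is injective, so its matrix has a left
    inverse.\<close>
  obtain G where G: "\<And>e e'. e \<in> ?E \<Longrightarrow> e' \<in> ?E \<Longrightarrow>
      (\<Sum>t\<in>triples n. G e t * coboundary n c\<^sub>1 (\<lambda>e. of_bool (e = e')) t) = (if e = e' then 1 else 0)"
  proof (rule left_inverse_of_injective[where R = "triples n" and T = ?E and A = "\<lambda>t e'. coboundary n c\<^sub>1 (\<lambda>e. of_bool (e = e')) t"])
    fix x :: "_ \<Rightarrow> 'k" assume "\<And>t. t \<in> triples n \<Longrightarrow> (\<Sum>e\<in>?E. coboundary n c\<^sub>1 (\<lambda>e'. of_bool (e' = e)) t * x e) = 0"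
    then have "coboundary n c\<^sub>1 x t = 0" if "t \<in> triples n" for t
      using coboundary_expand[OF that, of c\<^sub>1 x] that by simp
    then show "\<forall>e\<in>?E. x e = 0" by (rule no_derivation)
  qed (use finT in auto)

  obtain ts where ts: "distinct ts" "set ts = triples n" using finite_distinct_list[OF finT] by blast
  obtain es where es: "distinct es" "set es = ?E" using finite_distinct_list[of ?E] by auto
  obtain ss where ss: "distinct ss" "set ss = S" using finite_distinct_list[OF finS] by blast
  \<comment> \<open>With the constants \<open>L\<close> and \<open>G\<close> as left factors,
    \<open>\<Phi>\<close> becomes the identity at the second point and the matrix of
    \<open>g\<close> becomes the identity at the first.\<close>
  define \<Phi> where "\<Phi> t t' = (\<Sum>r\<in>?R. coord_const (L t r) * row_value n v (\<lambda>t. of_bool (t = t')) r)" for t t'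
  define B where "B t e' = coboundary n v (\<lambda>e. of_bool (e = e')) t" for t e'
  define f where "f = det (mat_on ts ts \<Phi>)"
  define g where "g = det (mat_on es es (\<lambda>e e'. \<Sum>t\<in>set ts. coord_const (G e t) * B t e'))"
  have "f ^ length es * g \<in> J"
    unfolding f_def g_def
  proof (rule det_power_mult_det_mem[OF ts(1) es(1) ss(1)])
    show "length ss < length es"
      using S(2) distinct_card[OF ss(1)] distinct_card[OF es(1)] ss(2) es(2) by simp
    fix t e assume "t \<in> set ts" "e \<in> set es"
    let ?c = "\<lambda>r. coord_const (L t r) :: 'k coord_poly"
    \<comment> \<open>Modulo \<open>J\<close> the relation rows annihilate the columns of
      \<open>B\<close>. Only the coordinate rows survive, so the product factors through
      \<open>S\<close>, which has fewer than \<open>n * n\<close> elements.\<close>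
    have "(\<Sum>t'\<in>set ts. \<Phi> t t' * B t' e) =
        (\<Sum>r\<in>?R. \<Sum>t'\<in>triples n. ?c r * (row_value n v (\<lambda>t. of_bool (t = t')) r * B t' e))"
      unfolding \<Phi>_def ts(2) sum_distrib_right mult.assoc by (rule sum.swap)
    also have "\<dots> = (\<Sum>r\<in>?R. ?c r * row_value n v (\<lambda>t. B t e) r)"
      unfolding sum_distrib_left[symmetric]
      by (intro sum.cong refl arg_cong2[of _ _ _ _ "(*)"])
        (rule row_value_expand[OF S(1), symmetric])
    also have "\<dots> = (\<Sum>r\<in>relation_rows n. ?c r * row_value n v (\<lambda>t. B t e) r) +
        (\<Sum>r\<in>Coord ` S. ?c r * row_value n v (\<lambda>t. B t e) r)"
      using finS by (intro sum.union_disjoint) auto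
    also have "(\<Sum>r\<in>Coord ` S. ?c r * row_value n v (\<lambda>t. B t e) r) =
        (\<Sum>s\<in>set ss. ?c (Coord s) * B s e)"
      by (subst sum.reindex) (auto simp: inj_on_def row_value_def ss(2))
    finally have "(\<Sum>t'\<in>set ts. \<Phi> t t' * B t' e) - (\<Sum>s\<in>set ss. ?c (Coord s) * B s e) =
        (\<Sum>r\<in>relation_rows n. ?c r * row_value n v (\<lambda>t. B t e) r)"
      by simp
    also have "\<dots> \<in> J"
      unfolding B_def by (intro sum_mem mult_mem rows)
    finally show "(\<Sum>t'\<in>set ts. \<Phi> t t' * B t' e) - (\<Sum>s\<in>set ss. ?c (Coord s) * B s e) \<in> J" .
  qed
  then have fg: "\<pi> (f ^ length es * g) = \<zero>\<^bsub>?O\<^esub>" by (simp add: J_def)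

  \<comment> \<open>Composed with \<open>\<pi>\<close>, a point of the coordinate ring becomes a
    type-class homomorphism and hence commutes with determinants.\<close>
  have point: "\<exists>\<gamma>. \<gamma> \<in> Ring.ring_hom ?O base_ring \<and> comm_ring_hom (\<lambda>p. \<gamma> (\<pi> p)) \<and>
      (\<forall>a. \<gamma> (\<pi> (coord_const a)) = a) \<and>
      (\<forall>i<n. \<forall>j<n. \<forall>l<n. \<gamma> (\<pi> (v i j l)) = c i j l)"
    if sc: "is_structure_constants (base_ring :: 'k ring) n c u" for c u
  proof -
    obtain \<gamma> where \<gamma>: "\<gamma> \<in> Ring.ring_hom ?O (base_ring :: 'k ring)"
      "\<forall>a. \<gamma> (coord_class n (coord_const a)) = a"
      "\<forall>i<n. \<forall>j<n. \<forall>l<n. \<gamma> (coord_class n (str_var i j l)) = c i j l"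
      using hom_of_structure_constants[OF cring_base_ring id_ring_hom sc] by auto
    interpret \<gamma>: ring_hom_ring ?O base_ring \<gamma>
      by (intro ring_hom_ringI2 O.ring_axioms cring.axioms(1)[OF cring_base_ring] \<gamma>(1))
    have "comm_ring_hom (\<lambda>p. \<gamma> (\<pi> p))"
      using \<gamma>.hom_add[OF \<pi>(1) \<pi>(1)] \<gamma>.hom_mult[OF \<pi>(1) \<pi>(1)] \<gamma>.hom_one \<gamma>.hom_zero
      by unfold_locales (simp_all add: \<pi>(2-5) base_ring_def)
    then show ?thesis
      using \<gamma> by (intro exI[of _ \<gamma>]) (simp add: \<pi>_class coord_const_mem coord_var_mem v_def)
  qed
  obtain \<gamma>\<^sub>1 where \<gamma>1: "\<gamma>\<^sub>1 \<in> Ring.ring_hom ?O base_ring" "comm_ring_hom (\<lambda>p. \<gamma>\<^sub>1 (\<pi> p))"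
    "\<And>a. \<gamma>\<^sub>1 (\<pi> (coord_const a)) = a"
    "\<And>i j l. i < n \<Longrightarrow> j < n \<Longrightarrow> l < n \<Longrightarrow> \<gamma>\<^sub>1 (\<pi> (v i j l)) = c\<^sub>1 i j l"
    using point[OF sc1] by auto
  obtain \<gamma>\<^sub>2 where \<gamma>2: "\<gamma>\<^sub>2 \<in> Ring.ring_hom ?O base_ring" "comm_ring_hom (\<lambda>p. \<gamma>\<^sub>2 (\<pi> p))"
    "\<And>a. \<gamma>\<^sub>2 (\<pi> (coord_const a)) = a"
    "\<And>i j l. i < n \<Longrightarrow> j < n \<Longrightarrow> l < n \<Longrightarrow> \<gamma>\<^sub>2 (\<pi> (v i j l)) = c\<^sub>2 i j l"
    using point[OF sc2] by auto
  interpret h1: comm_ring_hom "\<lambda>p. \<gamma>\<^sub>1 (\<pi> p)" by (rule \<gamma>1(2))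
  interpret h2: comm_ring_hom "\<lambda>p. \<gamma>\<^sub>2 (\<pi> p)" by (rule \<gamma>2(2))
  have g1: "\<gamma>\<^sub>1 (\<pi> g) = 1"
    unfolding g_def h1.hom_det_mat_on
  proof (rule det_mat_on_delta[OF es(1)])
    fix e e' assume "e \<in> set es" "e' \<in> set es"
    have "\<gamma>\<^sub>1 (\<pi> (\<Sum>t\<in>set ts. coord_const (G e t) * B t e')) =
        (\<Sum>t\<in>triples n. G e t * coboundary n c\<^sub>1 (\<lambda>e. of_bool (e = e')) t)"
      unfolding ts(2) h1.hom_sum h1.hom_mult \<gamma>1(3) B_def
      by (intro sum.cong refl arg_cong2[of _ _ _ _ "(*)"] h1.hom_coboundary \<gamma>1(4)) auto
    then show "\<gamma>\<^sub>1 (\<pi> (\<Sum>t\<in>set ts. coord_const (G e t) * B t e')) = (if e = e' then 1 else 0)"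
      using G \<open>e \<in> set es\<close> \<open>e' \<in> set es\<close> unfolding es(2) by simp
  qed
  have f2: "\<gamma>\<^sub>2 (\<pi> f) = 1"
    unfolding f_def h2.hom_det_mat_on
  proof (rule det_mat_on_delta[OF ts(1)])
    fix t t' assume "t \<in> set ts" "t' \<in> set ts"
    have "\<gamma>\<^sub>2 (\<pi> (\<Phi> t t')) = (\<Sum>r\<in>?R. L t r * row_value n c\<^sub>2 (\<lambda>t. of_bool (t = t')) r)"
      unfolding \<Phi>_def h2.hom_sum h2.hom_mult \<gamma>2(3)
      by (intro sum.cong refl arg_cong2[of _ _ _ _ "(*)"] h2.hom_row_value[where S = S] \<gamma>2(4)) auto
    then show "\<gamma>\<^sub>2 (\<pi> (\<Phi> t t')) = (if t = t' then 1 else 0)"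
      using L \<open>t \<in> set ts\<close> \<open>t' \<in> set ts\<close> unfolding ts(2) by simp
  qed

  have closed: "closedin (Spec ?O) (vanishing_set ?O {\<pi> p})" for p
    unfolding closedin_Spec by (intro exI[of _ "{\<pi> p}"]) simp
  have proper: "vanishing_set ?O {\<pi> p} \<noteq> topspace (Spec ?O)"
    if "\<gamma> \<in> Ring.ring_hom ?O (base_ring :: 'k ring)" "\<gamma> (\<pi> p) = 1" for \<gamma> p
  proof -
    have "{x \<in> carrier ?O. \<gamma> x = 0} \<in> topspace (Spec ?O)"
      using prime_kernel[OF O.is_cring that(1)] by simp
    moreover have "{x \<in> carrier ?O. \<gamma> x = 0} \<notin> vanishing_set ?O {\<pi> p}"
      using that(2) by (simp add: vanishing_set_def)
    ultimately show ?thesis by blast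
  qed
  have "\<pi> f \<in> P \<or> \<pi> g \<in> P" if "primeideal P ?O" for P
  proof -
    interpret P: primeideal P ?O by fact
    have "\<pi> f \<in> P \<or> \<pi> q \<in> P" if "\<pi> (f ^ N * q) \<in> P" for N q
      using that
    proof (induction N)
      case (Suc N)
      have "\<pi> f \<otimes>\<^bsub>?O\<^esub> \<pi> (f ^ N * q) \<in> P" using Suc.prems by (simp add: mult.assoc flip: \<pi>(5))
      from P.I_prime[OF \<pi>(1) \<pi>(1) this] show ?case using Suc.IH by blast
    qed simp
    then show ?thesis using fg P.zero_closed by metis
  qed
  then have "vanishing_set ?O {\<pi> f} \<union> vanishing_set ?O {\<pi> g} = topspace (Spec ?O)"
    by (auto simp: vanishing_set_def)
  then show ?thesis
    unfolding reducible_space_def based_algebra_scheme_def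
    using closed proper[OF \<gamma>1(1) g1] proper[OF \<gamma>2(1) f2] by blast
qed

section \<open>An algebra with a small tangent space\<close>

text \<open>
  The algebra \<open>B \<times> k\<^sup>n\<^sup>-\<^sup>8\<close>, where \<open>B\<close> has the basis \<open>1, a, b, c, d, ac, ad = bc, bd\<close> (with indices
  \<open>0, \<dots>, 7\<close>) and all other products of two of \<open>a, b, c, d\<close> and all products of three of them
  vanish. The indices from \<open>8\<close> on are orthogonal idempotents. A product of two basis vectors is a
  basis vector or \<open>0\<close>, which is encoded by \<open>None\<close>.
\<close>

definition sg_mult :: "nat \<Rightarrow> nat \<Rightarrow> nat option" where
  "sg_mult i j = (if 8 \<le> i \<or> 8 \<le> j then if i = j then Some i else None
     else if i = 0 then Some j else if j = 0 then Some i
     else map_of [((1, 3), 5), ((3, 1), 5), ((1, 4), 6), ((4, 1), 6), ((2, 3), 6), ((3, 2), 6),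
       ((2, 4), 7), ((4, 2), 7)] (i, j))"

text \<open>Partial division: for given \<open>l\<close> and \<open>m\<close>, at most one
  \<open>p\<close> has \<open>sg_mult p l = Some m\<close>. Sums over the output index of a cochain
  thus reduce to at most one term.\<close>

definition sg_quot :: "nat \<Rightarrow> nat \<Rightarrow> nat option" where
  "sg_quot m l = (if 8 \<le> m \<or> 8 \<le> l then if m = l then Some m else None
     else if l = 0 then Some m else if m = l then Some 0
     else map_of [((5, 1), 3), ((5, 3), 1), ((6, 1), 4), ((6, 4), 1), ((6, 2), 3), ((6, 3), 2),
       ((7, 2), 4), ((7, 4), 2)] (m, l))"

definition option_value :: "nat option \<Rightarrow> (nat \<Rightarrow> 'a::zero) \<Rightarrow> 'a" where
  "option_value x f = (case x of None \<Rightarrow> 0 | Some p \<Rightarrow> f p)"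

lemma option_value_simps [simp]: "option_value None f = 0" "option_value (Some p) f = f p"
  by (simp_all add: option_value_def)

text \<open>
  The cocycles that are normalized by \<open>\<phi>(1, x) = 0\<close> form a space of dimension 49 over any field.
  At most 55 coordinates are available to detect them, so this choice of 53 coordinates need not be
  minimal. It is made such that each further coordinate is the only unknown left in some instance
  of the cocycle equation.
\<close>

definition block_coords :: "((nat \<times> nat) \<times> nat) set" where
  "block_coords = {(1, 3), (1, 4), (2, 4)} \<times> {..7} \<union> {(1, 2), (3, 4)} \<times> {1..7} \<union>
     {(1, 1), (2, 2), (3, 3), (4, 4), (2, 3)} \<times> {5..7}"

lemma less_8_cases: "x < 8 \<Longrightarrow> x \<in> {0, 1, 2, 3, 4, 5, 6, 7}" for x :: nat
  by auto

lemma sg_mult_large: "8 \<le> i \<or> 8 \<le> j \<Longrightarrow> sg_mult i j = (if i = j then Some i else None)"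
  and sg_quot_large: "8 \<le> i \<or> 8 \<le> j \<Longrightarrow> sg_quot i j = (if i = j then Some i else None)"
  by (simp_all add: sg_mult_def sg_quot_def)

lemma sg_mult_zero: "sg_mult 0 j = (if j < 8 then Some j else None)"
  and sg_quot_zero: "sg_quot m 0 = (if m < 8 then Some m else None)"
  by (simp_all add: sg_mult_def sg_quot_def)

lemma sg_mult_commute: "sg_mult i j = sg_mult j i"
proof (cases "i < 8 \<and> j < 8")
  case True
  have "\<forall>i\<in>{0, 1, 2, 3, 4, 5, 6, 7}. \<forall>j\<in>{0, 1, 2, 3, 4, 5, 6, 7}. sg_mult i j = sg_mult j i"
    by (simp add: sg_mult_def)
  then show ?thesis using True less_8_cases[of i] less_8_cases[of j] by blast
qed (auto simp: sg_mult_large not_less)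

lemma sg_mult_less:
  assumes "sg_mult i j = Some p" "i < n" "j < n" "8 \<le> n"
  shows "p < n"
  using assms unfolding sg_mult_def
  by (auto split: if_splits dest!: map_of_SomeD simp del: map_of.simps map_of_Cons_code)

lemma sg_quot_less:
  assumes "sg_quot m l = Some p" "m < n" "8 \<le> n"
  shows "p < n"
  using assms unfolding sg_quot_def
  by (auto split: if_splits dest!: map_of_SomeD simp del: map_of.simps map_of_Cons_code)

text \<open>An exhaustive check of 512 triples; the quantifiers are expanded before the tables are
  unfolded.\<close>

lemma sg_mult_eq_Some_block:
  "\<forall>p\<in>{0, 1, 2, 3, 4, 5, 6, 7}. \<forall>l\<in>{0, 1, 2, 3, 4, 5, 6, 7}. \<forall>m\<in>{0, 1, 2, 3, 4, 5, 6, 7}.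
     sg_mult p l = Some m \<longleftrightarrow> sg_quot m l = Some p"
  by (simp only: ball_simps simp_thms) (simp add: sg_mult_def sg_quot_def)

lemma sg_mult_assoc_block:
  "\<forall>i\<in>{0, 1, 2, 3, 4, 5, 6, 7}. \<forall>j\<in>{0, 1, 2, 3, 4, 5, 6, 7}. \<forall>l\<in>{0, 1, 2, 3, 4, 5, 6, 7}.
     Option.bind (sg_mult i j) (\<lambda>p. sg_mult p l) = Option.bind (sg_mult j l) (sg_mult i)"
  by (simp only: ball_simps simp_thms) (simp add: sg_mult_def)
lemma sg_mult_eq_Some: "sg_mult p l = Some m \<longleftrightarrow> sg_quot m l = Some p"
proof (cases "p < 8 \<and> l < 8 \<and> m < 8")
  case True
  then show ?thesis
    using sg_mult_eq_Some_block less_8_cases[of p] less_8_cases[of l] less_8_cases[of m] by blast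
next
  case False
  show ?thesis
  proof (cases "8 \<le> l")
    case False
    with \<open>\<not> (p < 8 \<and> l < 8 \<and> m < 8)\<close> have "8 \<le> p \<or> 8 \<le> m" by auto
    then show ?thesis
      using sg_mult_less[of p l m 8] sg_quot_less[of m l p 8] False
      by (cases "p < 8"; cases "m < 8") (auto simp: sg_mult_large sg_quot_large)
  qed (auto simp: sg_mult_large sg_quot_large)
qed

lemma sg_mult_assoc:
  "Option.bind (sg_mult i j) (\<lambda>p. sg_mult p l) = Option.bind (sg_mult j l) (sg_mult i)"
proof -
  have less: "p < 8" if "sg_mult x y = Some p" "x < 8" "y < 8" for x y p
    using sg_mult_less[OF that(1), of 8] that by simp
  consider "i < 8" "j < 8" "l < 8" | "8 \<le> j" | "j < 8" "8 \<le> i" | "j < 8" "i < 8" "8 \<le> l"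
    by linarith
  then show ?thesis
  proof cases
    case 1
    then show ?thesis
      using sg_mult_assoc_block less_8_cases[of i] less_8_cases[of j] less_8_cases[of l] by blast
  next
    case 3
    then show ?thesis
      using less[of j l] by (cases "sg_mult j l"; cases "l < 8") (auto simp: sg_mult_large)
  next
    case 4
    then show ?thesis
      using less[of i j] by (cases "sg_mult i j") (auto simp: sg_mult_large)
  qed (simp add: sg_mult_large)
qed

text \<open>Values in an arbitrary abelian group make the argument independent of the
  characteristic.\<close>

lemma block_cocycle_zero:
  fixes \<phi> :: "nat \<times> nat \<times> nat \<Rightarrow> 'a::ab_group_add"
  assumes sym: "\<And>i j l. i < 8 \<Longrightarrow> j < 8 \<Longrightarrow> l < 8 \<Longrightarrow> \<phi> (i, j, l) = \<phi> (j, i, l)"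
    and cocycle: "\<And>i j l m. i < 8 \<Longrightarrow> j < 8 \<Longrightarrow> l < 8 \<Longrightarrow> m < 8 \<Longrightarrow>
      option_value (sg_mult i j) (\<lambda>p. \<phi> (p, l, m)) + option_value (sg_quot m l) (\<lambda>p. \<phi> (i, j, p)) =
      option_value (sg_mult j l) (\<lambda>p. \<phi> (i, p, m)) + option_value (sg_quot m i) (\<lambda>p. \<phi> (j, l, p))"
    and unit: "\<And>j l. j < 8 \<Longrightarrow> l < 8 \<Longrightarrow> \<phi> (0, j, l) = 0"
    and zero: "\<And>i j l. ((i, j), l) \<in> block_coords \<Longrightarrow> \<phi> (i, j, l) = 0"
    and "i < 8" "j < 8" "l < 8"
  shows "\<phi> (i, j, l) = 0"
proof -
  note table = sg_mult_def sg_quot_def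
  note E = cocycle
  \<comment> \<open>Sorting the two arguments merges \<open>\<phi> (i, j, l)\<close> and
    \<open>\<phi> (j, i, l)\<close> into a single unknown.\<close>
  define \<psi> where "\<psi> i j l = \<phi> (i, j, l)" for i j l
  have swap: "\<phi> (i, j, l) = \<psi> (min i j) (max i j) l" if "i < 8" "j < 8" "l < 8" for i j l
    using sym[OF that] by (simp add: \<psi>_def min_def max_def)
  have zeros: "l < 8 \<Longrightarrow> \<psi> 1 3 l = 0" "l < 8 \<Longrightarrow> \<psi> 1 4 l = 0" "l < 8 \<Longrightarrow> \<psi> 2 4 l = 0"
    "l \<in> {1, 2, 3, 4, 5, 6, 7} \<Longrightarrow> \<psi> 1 2 l = 0" "l \<in> {1, 2, 3, 4, 5, 6, 7} \<Longrightarrow> \<psi> 3 4 l = 0"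
    "l \<in> {5, 6, 7} \<Longrightarrow> \<psi> 1 1 l = 0" "l \<in> {5, 6, 7} \<Longrightarrow> \<psi> 2 2 l = 0" "l \<in> {5, 6, 7} \<Longrightarrow> \<psi> 3 3 l = 0"
    "l \<in> {5, 6, 7} \<Longrightarrow> \<psi> 4 4 l = 0" "l \<in> {5, 6, 7} \<Longrightarrow> \<psi> 2 3 l = 0" for l
    unfolding \<psi>_def by (rule zero, auto simp: block_coords_def)+
  \<comment> \<open>The equations are homogeneous for the grading of \<open>B\<close>, so the degrees of \<open>\<phi>\<close> from \<open>-4\<close> to \<open>-1\<close>
     can be treated separately. In each list every equation determines one new coordinate.\<close>
  have d4: "\<forall>i\<in>{5, 6, 7}. \<forall>j\<in>{5, 6, 7}. \<forall>l\<in>{0}. \<phi> (i, j, l) = 0"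
    using E[of 1 5 5 1] E[of 1 5 6 1] E[of 1 5 7 1] E[of 1 6 6 1] E[of 1 6 7 1] E[of 1 7 7 1]
    by (simp_all add: table swap zeros unit del: One_nat_def)
  have d3: "\<forall>i\<in>{1, 2, 3, 4}. \<forall>j\<in>{5, 6, 7}. \<forall>l\<in>{0}. \<phi> (i, j, l) = 0"
    "\<forall>i\<in>{5, 6, 7}. \<forall>j\<in>{5, 6, 7}. \<forall>l\<in>{1, 2, 3, 4}. \<phi> (i, j, l) = 0"
    using E[of 1 1 5 1] E[of 1 1 6 1] E[of 1 1 7 1] E[of 1 2 5 1] E[of 1 2 6 1] E[of 1 2 7 1]
        E[of 1 3 5 2] E[of 1 3 5 3] E[of 1 3 5 4] E[of 1 3 6 2] E[of 1 3 6 3] E[of 1 3 6 4]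
        E[of 1 3 7 2] E[of 1 3 7 3] E[of 1 3 7 4] E[of 1 4 6 2] E[of 1 4 6 3] E[of 1 4 6 4]
        E[of 1 4 7 2] E[of 1 4 7 3] E[of 1 4 7 4] E[of 1 5 3 1] E[of 1 5 4 1] E[of 1 6 3 1]
        E[of 1 6 4 1] E[of 1 7 3 1] E[of 1 7 4 1] E[of 1 7 7 5] E[of 1 7 7 6] E[of 2 3 5 1]
        E[of 2 3 6 1] E[of 2 3 7 1] E[of 2 4 5 1] E[of 2 4 7 1] E[of 2 4 7 2] E[of 3 1 5 1]
    by (simp_all add: table swap zeros unit del: One_nat_def)
  have d2: "\<forall>i\<in>{1, 2, 3, 4}. \<forall>j\<in>{1, 2, 3, 4}. \<forall>l\<in>{0}. \<phi> (i, j, l) = 0"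
    "\<forall>i\<in>{1, 2, 3, 4}. \<forall>j\<in>{5, 6, 7}. \<forall>l\<in>{1, 2, 3, 4}. \<phi> (i, j, l) = 0"
    "\<forall>i\<in>{5, 6, 7}. \<forall>j\<in>{5, 6, 7}. \<forall>l\<in>{5, 6, 7}. \<phi> (i, j, l) = 0"
    using E[of 1 1 2 1] E[of 1 1 2 2] E[of 1 1 3 1] E[of 1 1 3 2] E[of 1 1 3 3] E[of 1 1 3 4]
        E[of 1 1 4 1] E[of 1 1 4 2] E[of 1 1 4 3] E[of 1 1 4 4] E[of 1 1 7 5] E[of 1 1 7 6]
        E[of 1 2 2 1] E[of 1 2 3 1] E[of 1 2 4 1] E[of 1 2 4 2] E[of 1 2 5 5] E[of 1 2 5 6]
        E[of 1 2 6 5] E[of 1 2 6 6] E[of 1 2 7 5] E[of 1 2 7 6] E[of 1 3 2 1] E[of 1 3 2 2]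
        E[of 1 3 3 2] E[of 1 3 3 3] E[of 1 3 3 4] E[of 1 3 4 2] E[of 1 3 4 3] E[of 1 3 4 4]
        E[of 1 3 5 5] E[of 1 3 5 6] E[of 1 3 5 7] E[of 1 3 6 7] E[of 1 3 7 7] E[of 1 4 2 1]
        E[of 1 4 2 2] E[of 1 4 3 2] E[of 1 4 3 3] E[of 1 4 3 4] E[of 1 4 4 2] E[of 1 4 4 3]
        E[of 1 4 4 4] E[of 1 4 5 5] E[of 1 4 5 6] E[of 1 4 6 5] E[of 1 4 6 6] E[of 1 4 6 7]
        E[of 1 4 7 7] E[of 1 7 3 5] E[of 1 7 3 6] E[of 1 7 4 5] E[of 1 7 4 6] E[of 2 2 4 1]
        E[of 2 2 4 2] E[of 2 3 3 1] E[of 2 3 3 2] E[of 2 3 4 1] E[of 2 3 4 2] E[of 2 3 7 5]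
        E[of 2 3 7 6] E[of 2 4 3 1] E[of 2 4 3 2] E[of 2 4 4 1] E[of 2 4 5 5] E[of 2 4 5 6]
        E[of 2 4 7 5] E[of 2 4 7 6] E[of 2 4 7 7] E[of 3 1 4 1] E[of 3 3 1 1] E[of 3 4 4 3]
        E[of 3 4 7 6]
    by (simp_all add: table swap zeros unit del: One_nat_def)
  have d1: "\<forall>i\<in>{1, 2, 3, 4}. \<forall>j\<in>{1, 2, 3, 4}. \<forall>l\<in>{1, 2, 3, 4}. \<phi> (i, j, l) = 0"
    "\<forall>i\<in>{1, 2, 3, 4}. \<forall>j\<in>{5, 6, 7}. \<forall>l\<in>{5, 6, 7}. \<phi> (i, j, l) = 0"
    using E[of 1 1 2 6] E[of 1 1 2 7] E[of 1 1 3 7] E[of 1 1 4 5] E[of 1 2 2 5] E[of 1 2 2 6]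
        E[of 1 2 3 5] E[of 1 2 3 7] E[of 1 2 4 5] E[of 1 2 4 6] E[of 1 2 4 7] E[of 1 3 2 5]
        E[of 1 3 2 7] E[of 1 3 3 7] E[of 1 3 4 5] E[of 1 3 4 6] E[of 1 3 4 7] E[of 1 4 2 5]
        E[of 1 4 2 6] E[of 1 4 2 7] E[of 1 4 3 5] E[of 1 4 3 6] E[of 1 4 3 7] E[of 1 4 4 7]
        E[of 2 1 3 6] E[of 2 2 3 5] E[of 2 2 3 6] E[of 2 2 3 7] E[of 2 2 4 5] E[of 2 2 4 6]
        E[of 2 2 4 7] E[of 2 3 1 6] E[of 2 3 3 5] E[of 2 3 3 7] E[of 2 3 4 5] E[of 2 3 4 6]
        E[of 2 3 4 7] E[of 2 4 3 5] E[of 2 4 3 6] E[of 2 4 3 7] E[of 2 4 4 5] E[of 3 3 1 6]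
        E[of 3 3 2 6] E[of 3 3 4 6] E[of 3 3 4 7] E[of 3 4 4 5] E[of 3 4 4 6] E[of 4 1 1 6]
        E[of 4 1 1 7] E[of 4 4 1 5] E[of 4 4 1 6] E[of 4 4 2 6] E[of 4 4 2 7] E[of 1 1 3 5]
        E[of 1 1 3 6] E[of 1 3 3 5]
    by (simp_all add: table swap zeros unit del: One_nat_def)

  \<comment> \<open>In degree 0 all coordinates are among the prescribed zeros.\<close>
  have d0: "\<forall>i\<in>{1, 2, 3, 4}. \<forall>j\<in>{1, 2, 3, 4}. \<forall>l\<in>{5, 6, 7}. \<phi> (i, j, l) = 0"
    by (simp add: swap zeros del: One_nat_def)
  \<comment> \<open>The basis vectors of degree 1 and of degree 2.\<close>
  define V Q :: "nat set" where "V = {1, 2, 3, 4}" and "Q = {5, 6, 7}"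
  note d = d0 d1 d2 d3 d4
  have cases: "x = 0 \<or> x \<in> V \<or> x \<in> Q" if "x < 8" for x
    using that by (auto simp: V_def Q_def)
  have "\<phi> (x, y, l) = 0" if "x \<in> V" "y \<in> V \<or> y \<in> Q" for x y
    using cases[OF \<open>l < 8\<close>] that d[folded V_def Q_def] by (elim disjE) simp_all
  moreover have "\<phi> (x, y, l) = 0" if "x \<in> Q" "y \<in> Q" for x y
    using cases[OF \<open>l < 8\<close>] that d[folded V_def Q_def] by (elim disjE) simp_all
  ultimately show ?thesis
    using cases[OF \<open>i < 8\<close>] cases[OF \<open>j < 8\<close>] unit[OF \<open>i < 8\<close> \<open>l < 8\<close>] unit[OF \<open>j < 8\<close> \<open>l < 8\<close>]
      sym[OF assms(5-7)] by metis
qed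

section \<open>Structure constants and cocycle equations at the two points\<close>

lemma finsum_base_ring:
  assumes "finite I"
  shows "finsum (base_ring :: 'k::comm_ring_1 ring) f I = sum f I"
proof -
  interpret B: cring "base_ring :: 'k ring" by (rule cring_base_ring)
  show ?thesis
    using assms
  proof (induction I)
    case empty
    show ?case using B.finsum_empty[of f] by (simp add: base_ring_def)
  next
    case (insert x I)
    then show ?case using B.finsum_insert[of I x f] by (simp add: base_ring_def)
  qed
qed

lemma sum_of_bool_option_value:
  fixes F :: "nat \<Rightarrow> 'a::comm_ring_1"
  assumes "\<And>p. x = Some p \<Longrightarrow> p < n"
  shows "(\<Sum>p<n. of_bool (x = Some p) * F p) = option_value x F"
proof (cases x)
  case (Some q)
  then have "(\<Sum>p<n. of_bool (x = Some p) * F p) = (\<Sum>p<n. if p = q then F p else 0)"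
    by (intro sum.cong) auto
  then show ?thesis using Some assms by simp
qed simp

text \<open>The identity is the sum of the basis vectors in \<open>U\<close>: exactly one of them
  fixes a given basis vector and the others kill it.\<close>

lemma is_structure_constants_of_partial_monoid:
  fixes mul :: "nat \<Rightarrow> nat \<Rightarrow> nat option"
  assumes closed: "\<And>i j p. i < n \<Longrightarrow> j < n \<Longrightarrow> mul i j = Some p \<Longrightarrow> p < n"
    and comm: "\<And>i j. i < n \<Longrightarrow> j < n \<Longrightarrow> mul i j = mul j i"
    and assoc: "\<And>i j l. i < n \<Longrightarrow> j < n \<Longrightarrow> l < n \<Longrightarrow>
      Option.bind (mul i j) (\<lambda>p. mul p l) = Option.bind (mul j l) (mul i)"
    and unit: "\<And>j. j < n \<Longrightarrow> \<exists>i\<in>U. i < n \<and> mul i j = Some j \<and> (\<forall>i'\<in>U. i' \<noteq> i \<longrightarrow> mul i' j = None)"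
  shows "is_structure_constants (base_ring :: 'k::comm_ring_1 ring) n
    (\<lambda>i j l. of_bool (mul i j = Some l)) (\<lambda>i. of_bool (i \<in> U))"
proof -
  have bind_value: "option_value x (\<lambda>p. of_bool (f p = Some m)) = of_bool (Option.bind x f = Some m)"
    for x m and f :: "nat \<Rightarrow> nat option"
    by (cases x) simp_all
  have A: "(\<Sum>p<n. of_bool (mul i j = Some p) * of_bool (mul p l = Some m)) =
      (\<Sum>p<n. of_bool (mul j l = Some p) * (of_bool (mul i p = Some m) :: 'k))"
    if "i < n" "j < n" "l < n" for i j l m
  proof -
    have "(\<Sum>p<n. of_bool (mul i j = Some p) * of_bool (mul p l = Some m)) =
        option_value (mul i j) (\<lambda>p. of_bool (mul p l = Some m) :: 'k)"
      by (rule sum_of_bool_option_value) (rule closed[OF that(1,2)])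
    also have "\<dots> = option_value (mul j l) (\<lambda>p. of_bool (mul i p = Some m))"
      unfolding bind_value assoc[OF that] ..
    also have "\<dots> = (\<Sum>p<n. of_bool (mul j l = Some p) * of_bool (mul i p = Some m))"
      by (rule sum_of_bool_option_value[symmetric]) (rule closed[OF that(2,3)])
    finally show ?thesis .
  qed
  have C: "of_bool (mul i j = Some l) = (of_bool (mul j i = Some l) :: 'k)" if "i < n" "j < n" for i j l
    using comm[OF that] by simp
  have U: "(\<Sum>i<n. of_bool (i \<in> U) * (of_bool (mul i j = Some l) :: 'k)) = (if j = l then 1 else 0)"
    if "j < n" for j l
  proof -
    obtain i where i: "i \<in> U" "i < n" "mul i j = Some j" "\<And>i'. i' \<in> U \<Longrightarrow> i' \<noteq> i \<Longrightarrow> mul i' j = None"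
      using unit[OF \<open>j < n\<close>] by blast
    have "(\<Sum>i<n. of_bool (i \<in> U) * (of_bool (mul i j = Some l) :: 'k)) =
        (\<Sum>i'<n. if i' = i then of_bool (j = l) else 0)"
      using i by (intro sum.cong refl) auto
    then show ?thesis using i(2) by simp
  qed
  show ?thesis
    unfolding is_structure_constants_def finsum_base_ring[OF finite_lessThan]
    by (simp only: base_ring_def ring_record_simps monoid.simps partial_object.simps)
      (intro conjI allI impI UNIV_I; (rule A C U; assumption))
qed

text \<open>The split algebra, whose basis vectors are orthogonal idempotents with sum 1.\<close>

lemma split_structure_constants:
  "is_structure_constants (base_ring :: 'k::comm_ring_1 ring) n
    (\<lambda>i j l. of_bool ((if i = j then Some i else None) = Some l)) (\<lambda>i. of_bool (i \<in> UNIV))"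
  by (rule is_structure_constants_of_partial_monoid) (auto split: if_splits)

text \<open>Differentiating the equation that basis vector \<open>i\<close> is idempotent gives
  \<open>D (i, j) = 0\<close> off the diagonal and \<open>2 * D (i, i) = D (i, i)\<close> on it,
  which suffices in every characteristic.\<close>

lemma split_no_derivation:
  fixes D :: "nat \<times> nat \<Rightarrow> 'k::comm_ring_1"
  assumes D: "\<And>t. t \<in> triples n \<Longrightarrow>
    coboundary n (\<lambda>i j l. of_bool ((if i = j then Some i else None) = Some l)) D t = 0"
  shows "\<forall>e\<in>{..<n} \<times> {..<n}. D e = 0"
proof -
  have "D (i, j) = 0" if "i < n" "j < n" for i j
  proof -
    let ?c = "\<lambda>i j l. of_bool ((if i = j then Some i else None) = Some l) :: 'k"
    have "coboundary n ?c D (i, i, j) =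
        (\<Sum>p<n. if p = i then 2 * of_bool (i = j) * D (i, i) - D (i, j) else 0)"
      unfolding coboundary_def prod.case by (intro sum.cong refl) auto
    also have "\<dots> = 2 * of_bool (i = j) * D (i, i) - D (i, j)"
      using that by simp
    finally show ?thesis
      using D[of "(i, i, j)"] that by (cases "i = j") simp_all
  qed
  then show ?thesis by auto
qed

lemma sg_structure_constants:
  assumes "8 \<le> n"
  shows "is_structure_constants (base_ring :: 'k::comm_ring_1 ring) n
    (\<lambda>i j l. of_bool (sg_mult i j = Some l)) (\<lambda>i. of_bool (i \<in> insert 0 {8..}))"
proof (rule is_structure_constants_of_partial_monoid)
  show "p < n" if "i < n" "j < n" "sg_mult i j = Some p" for i j p
    using sg_mult_less[OF that(3,1,2) assms] .
  show "sg_mult i j = sg_mult j i" for i j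
    by (rule sg_mult_commute)
  show "Option.bind (sg_mult i j) (\<lambda>p. sg_mult p l) = Option.bind (sg_mult j l) (sg_mult i)" for i j l
    by (rule sg_mult_assoc)
  show "\<exists>i\<in>insert 0 {8..}. i < n \<and> sg_mult i j = Some j \<and>
      (\<forall>i'\<in>insert 0 {8..}. i' \<noteq> i \<longrightarrow> sg_mult i' j = None)" if "j < n" for j
  proof (cases "j < 8")
    case True
    then show ?thesis
      using assms by (intro bexI[of _ 0]) (simp_all add: sg_mult_zero sg_mult_large)
  next
    case False
    then show ?thesis
      using that by (intro bexI[of _ j]) (simp_all add: sg_mult_zero sg_mult_large)
  qed
qed

text \<open>Rewriting \<open>sg_mult p l = Some m\<close> as \<open>sg_quot m l = Some p\<close>
  leaves at most one nonzero term in each of the four sums.\<close>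

lemma sg_cocycle_defect:
  fixes \<phi> :: "nat \<times> nat \<times> nat \<Rightarrow> 'a::comm_ring_1"
  assumes "8 \<le> n" "i < n" "j < n" "l < n" "m < n"
  shows "cocycle_defect n (\<lambda>i j l. of_bool (sg_mult i j = Some l)) \<phi> i j l m =
    option_value (sg_mult i j) (\<lambda>p. \<phi> (p, l, m)) + option_value (sg_quot m l) (\<lambda>p. \<phi> (i, j, p)) -
    option_value (sg_mult j l) (\<lambda>p. \<phi> (i, p, m)) - option_value (sg_quot m i) (\<lambda>p. \<phi> (j, l, p))"
proof -
  have "cocycle_defect n (\<lambda>i j l. of_bool (sg_mult i j = Some l)) \<phi> i j l m =
    (\<Sum>p<n. of_bool (sg_mult i j = Some p) * \<phi> (p, l, m)) +
    (\<Sum>p<n. of_bool (sg_quot m l = Some p) * \<phi> (i, j, p)) -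
    (\<Sum>p<n. of_bool (sg_mult j l = Some p) * \<phi> (i, p, m)) -
    (\<Sum>p<n. of_bool (sg_quot m i = Some p) * \<phi> (j, l, p))"
    unfolding cocycle_defect_def sum.distrib[symmetric] sum_subtractf[symmetric]
    by (intro sum.cong refl)
      (simp only: sg_mult_commute[of i] sg_mult_eq_Some[of _ l m] sg_mult_eq_Some[of _ i m]
        mult.commute[of "\<phi> _"])
  also have "\<dots> = option_value (sg_mult i j) (\<lambda>p. \<phi> (p, l, m)) + option_value (sg_quot m l) (\<lambda>p. \<phi> (i, j, p)) -
    option_value (sg_mult j l) (\<lambda>p. \<phi> (i, p, m)) - option_value (sg_quot m i) (\<lambda>p. \<phi> (j, l, p))"
    using assms
    by (intro arg_cong2[of _ _ _ _ "(-)"] arg_cong2[of _ _ _ _ "(+)"] sum_of_bool_option_value)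
      (blast intro: sg_mult_less sg_quot_less)+
  finally show ?thesis .
qed

section \<open>The tangent space of the product algebra\<close>

text \<open>
  The coordinates of the values of \<open>\<phi>(e, e)\<close> for the idempotents \<open>e\<close>, of the part of \<open>\<phi>(1\<^sub>B, z)\<close>
  outside \<open>B\<close>, and those that detect normalized cocycles on \<open>B\<close>.
\<close>

definition sg_coords :: "nat \<Rightarrow> (nat \<times> nat \<times> nat) set" where
  "sg_coords n = (\<lambda>(i, l). (i, i, l)) ` (insert 0 {8..<n} \<times> {..<n}) \<union>
     {0} \<times> {1..7} \<times> {8..<n} \<union> (\<lambda>((i, j), l). (i, j, l)) ` block_coords"

lemma card_block_coords: "card block_coords \<le> 53"
proof -
  let ?P = "{(1, 3), (1, 4), (2, 4)} :: (nat \<times> nat) set"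
    and ?Q = "{(1, 2), (3, 4)} :: (nat \<times> nat) set"
    and ?R = "{(1, 1), (2, 2), (3, 3), (4, 4), (2, 3)} :: (nat \<times> nat) set"
  have "card block_coords \<le> card (?P \<times> {..7::nat}) + card (?Q \<times> {1..7::nat}) + card (?R \<times> {5..7::nat})"
    unfolding block_coords_def
    by (intro order_trans[OF card_Un_le] add_right_mono card_Un_le)
  also have "\<dots> = 53"
    unfolding card_cartesian_product by simp
  finally show ?thesis .
qed

lemma finite_block_coords: "finite block_coords"
  by (simp add: block_coords_def)

lemma card_sg_coords:
  assumes "8 \<le> n"
  shows "card (sg_coords n) < n * n"
proof -
  obtain k where k: "n = k + 8" using assms by (metis add.commute le_Suc_ex)
  have "card (sg_coords n) \<le> card ((\<lambda>(i, l). (i, i, l)) ` (insert 0 {8..<n} \<times> {..<n})) +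
      card ({0::nat} \<times> {1..7::nat} \<times> {8..<n}) + card ((\<lambda>((i, j), l). (i, j, l)) ` block_coords)"
    unfolding sg_coords_def by (intro order_trans[OF card_Un_le] add_right_mono card_Un_le)
  also have "\<dots> \<le> card (insert 0 {8..<n} \<times> {..<n}) + 7 * (n - 8) + 53"
    using card_block_coords card_image_le[OF finite_block_coords, of "\<lambda>((i, j), l). (i, j, l)"]
    by (intro add_mono card_image_le) (auto simp: card_cartesian_product)
  \<comment> \<open>With \<open>n = k + 8\<close> the bound is k^2 + 16 k + 61, three less than
    n^2.\<close>
  also have "\<dots> < n * n"
    by (simp add: k card_cartesian_product algebra_simps)
  finally show ?thesis .
qed

lemma sg_coords_subset: "8 \<le> n \<Longrightarrow> sg_coords n \<subseteq> triples n"
  by (auto simp: sg_coords_def block_coords_def)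

text \<open>Equations that involve the orthogonal idempotents, including the unit of the block
  \<open>B\<close>, eliminate all values except those inside the block, where
  \<open>block_cocycle_zero\<close> applies.\<close>

lemma sg_cocycle_zero:
  fixes \<phi> :: "nat \<times> nat \<times> nat \<Rightarrow> 'a::comm_ring_1"
  assumes n: "8 \<le> n"
    and \<phi>: "\<And>r. r \<in> relation_rows n \<union> Coord ` sg_coords n \<Longrightarrow>
      row_value n (\<lambda>i j l. of_bool (sg_mult i j = Some l)) \<phi> r = 0"
  shows "\<forall>t\<in>triples n. \<phi> t = 0"
proof -
  have coord: "\<phi> t = 0" if "t \<in> sg_coords n" for t
    using \<phi>[of "Coord t"] that by (simp add: row_value_def)
  have idem: "\<phi> (i, i, l) = 0" if "i = 0 \<or> 8 \<le> i" "i < n" "l < n" for i l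
    by (rule coord) (use that in \<open>auto simp: sg_coords_def image_iff\<close>)
  have unit_part: "\<phi> (0, z, l) = 0" if "z \<in> {1..7}" "8 \<le> l" "l < n" for z l
    by (rule coord) (use that in \<open>auto simp: sg_coords_def\<close>)
  have block: "\<phi> (i, j, l) = 0" if "((i, j), l) \<in> block_coords" for i j l
    by (rule coord) (use that in \<open>force simp: sg_coords_def\<close>)
  have sym: "\<phi> (i, j, l) = \<phi> (j, i, l)" if "i < n" "j < n" "l < n" for i j l
    using \<phi>[of "Comm i j l"] that by (simp add: row_value_def)
  have cocycle: "option_value (sg_mult i j) (\<lambda>p. \<phi> (p, l, m)) + option_value (sg_quot m l) (\<lambda>p. \<phi> (i, j, p)) =
      option_value (sg_mult j l) (\<lambda>p. \<phi> (i, p, m)) + option_value (sg_quot m i) (\<lambda>p. \<phi> (j, l, p))"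
    if "i < n" "j < n" "l < n" "m < n" for i j l m
    using \<phi>[of "Assoc i j l m"] that sg_cocycle_defect[OF n that, of \<phi>]
    by (simp add: row_value_def algebra_simps)
  \<comment> \<open>Associativity for \<open>i, i, z\<close> reduces the value to some
    \<open>\<phi> (i, i, p)\<close> or to zero.\<close>
  have idem_off: "\<phi> (i, z, m) = 0" if "8 \<le> i" "i < n" "z < n" "m < n" "m \<noteq> i" for i z m
  proof (cases "z = i")
    case False
    then show ?thesis
      using cocycle[of i i z m] that idem[of i]
      by (cases "sg_quot m z") (auto simp: sg_mult_large sg_quot_large dest: sg_quot_less[OF _ _ n])
  qed (use that idem in simp)
  \<comment> \<open>Here \<open>\<phi> (i, z, i)\<close> is minus \<open>\<phi> (0, z, i)\<close>
    for \<open>z\<close> other than 0; the case of the block unit reduces to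
    \<open>\<phi> (0, 0, i)\<close>.\<close>
  have idem_block: "\<phi> (i, z, i) = 0" if "8 \<le> i" "i < n" "z < 8" for i z
  proof (cases "z = 0")
    case True
    have "\<phi> (0, i, i) = 0"
      using cocycle[of 0 0 i i] that n idem[of 0] by (simp add: sg_mult_zero sg_quot_zero sg_mult_large sg_quot_large)
    then show ?thesis using sym[of i 0 i] True that by simp
  next
    case False
    have "\<phi> (0, z, i) = 0" using that False by (intro unit_part) auto
    then show ?thesis
      using cocycle[of i 0 z i] that n False by (simp add: sg_mult_zero sg_quot_zero sg_mult_large sg_quot_large)
  qed
  have large: "\<phi> (i, j, m) = 0" if "8 \<le> i" "i < n" "j < n" "m < n" for i j m
  proof -
    consider "m \<noteq> i" | "m = i" "j < 8" | "m = i" "j = i" | "m = i" "8 \<le> j" "j \<noteq> i" by linarith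
    then show ?thesis
    proof cases
      case 4
      then show ?thesis using idem_off[of j i m] sym[of i j m] that by simp
    qed (use that idem_off idem_block idem in auto)
  qed
  \<comment> \<open>The vanishing of \<open>\<phi> (0, 0, p)\<close> normalizes the cocycle on the
    block.\<close>
  have zero_left: "\<phi> (0, z, m) = 0" if "z < 8" "m < 8" for z m
    using cocycle[of 0 0 z m] that n idem[of 0]
    by (cases "sg_quot m z") (auto simp: sg_mult_zero sg_quot_zero dest: sg_quot_less[OF _ _ n])
  \<comment> \<open>Outside the block, \<open>\<phi>\<close> at two block elements agrees with
    \<open>\<phi>\<close> at the block unit and their product.\<close>
  have block_out: "\<phi> (i, j, m) = 0" if "i < 8" "j < 8" "8 \<le> m" "m < n" for i j m
  proof -
    have "\<phi> (0, p, m) = 0" if "p < 8" for p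
      using that \<open>8 \<le> m\<close> \<open>m < n\<close> n idem[of 0 m] unit_part[of p m] by (cases "p = 0") auto
    moreover have "p < 8" if "sg_mult i j = Some p" for p
      using sg_mult_less[OF that, of 8] \<open>i < 8\<close> \<open>j < 8\<close> by simp
    ultimately show ?thesis
      using cocycle[of 0 i j m] that n
      by (cases "sg_mult i j") (auto simp: sg_mult_zero sg_quot_large)
  qed
  have block_in: "\<phi> (i, j, m) = 0" if "i < 8" "j < 8" "m < 8" for i j m
    by (rule block_cocycle_zero[OF sym cocycle zero_left block that]) (use n in linarith)+
  have "\<phi> (i, j, m) = 0" if "i < n" "j < n" "m < n" for i j m
  proof -
    consider "8 \<le> i" | "8 \<le> j" | "i < 8" "j < 8" "8 \<le> m" | "i < 8" "j < 8" "m < 8" by linarith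
    then show ?thesis
      by cases (use large[of i j m] large[of j i m] sym[of i j m] block_out[of i j m]
          block_in[of i j m] that in simp_all)
  qed
  then show ?thesis by auto
qed

theorem proposition9p6:
  fixes n :: nat
  assumes "n \<ge> 8"
  shows "reducible_space (based_algebra_scheme TYPE('k::field) n)"
  by (rule reducible_criterion[OF split_structure_constants split_no_derivation
        sg_structure_constants[OF assms] sg_coords_subset[OF assms] card_sg_coords[OF assms]
        sg_cocycle_zero[OF assms]])

end
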